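(* Consider the perturbed learning automata Markov chain described in the context, with transition probability functions $P_\lambda$ ($\lambda>0$), unperturbed kernel $P$, one-tremble kernel $Q$, and set of pure strategy states $\mathcal{S}$. There exists a unique probability vector $\pi=(\pi_s)_{s\in\mathcal{S}}$ such that for any collection of invariant probability measures $\{\mu_\lambda\in\mathfrak{P}(\mathcal{Z}):\mu_\lambda P_\lambda=\mu_\lambda,\ \lambda>0\}$ the following hold: (a) $\lim_{\lambda\to 0}\mu_\lambda(\cdot)=\hat\mu(\cdot):=\sum_{s\in\mathcal{S}}\pi_s\,\delta_s(\cdot)$, where convergence is weak convergence of probability measures and $\delta_s$ is the Dirac measure at $s$; (b) $\pi$ is an invariant distribution of the finite-state Markov chain $\hat P$ on $\mathcal{S}$ defined, for $s,s'\in\mathcal{S}$, by $$\hat P_{ss'}:=\lim_{t\to\infty} (QP^t)(s,\mathcal{N}_\delta(s')),$$ for some $\delta>0$ sufficiently small.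
   Context: Finite game: players $\mathcal{I}=\{1,\dots,n\}$, finite action sets $\mathcal{A}_i$, $\mathcal{A}=\mathcal{A}_1\times\cdots\times\mathcal{A}_n$, utilities $u_i:\mathcal{A}\to\mathbb{R}$ with $u_i(\alpha)>0$ for all $i,\alpha$ (positive-utility property). Let $\mathcal{X}_i=\Delta(|\mathcal{A}_i|)$ be the probability simplex, with actions identified with unit vectors $e_{\alpha_i}$; $\mathcal{X}=\mathcal{X}_1\times\cdots\times\mathcal{X}_n$, $\mathcal{Z}=\mathcal{A}\times\mathcal{X}$ (discrete topology on $\mathcal{A}$, Euclidean on $\mathcal{X}$, product topology on $\mathcal{Z}$); $\mathfrak{P}(\mathcal{Z})$ denotes Borel probability measures on $\mathcal{Z}$. The step size $\epsilon>0$ is small enough that $0<\epsilon u_i(\alpha)<1$ for all $i,\alpha$. Perturbed learning automata with perturbation $\lambda>0$: from state $(\alpha(t),x(t))$, each agent $i$ independently selects $\alpha_i(t+1)$ distributed according to $x_i(t)$ with probability $1-\lambda$ and uniformly on $\mathcal{A}_i$ with probability $\lambda$ ("trembling"); then $x_i(t+1)=x_i(t)+\epsilon u_i(\alpha(t+1))(e_{\alpha_i(t+1)}-x_i(t))$. This is a Markov chain on $\mathcal{Z}$ with transition probability function (t.p.f.) $P_\lambda$; $P$ is the t.p.f. for $\lambda=0$ (unperturbed process), and $P^t$ its $t$-step kernel. $Q$ is the t.p.f. of one step in which exactly one agent trembles (the trembling agent is equally likely to be any of the $n$ agents, it picks its action uniformly from its action set, every other agent picks its action according to its strategy, and then strategies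 are updated by the rule above); $QP^t(z,D)=\int Q(z,dy)P^t(y,D)$. A pure strategy state is $(\alpha,x)\in\mathcal{Z}$ with $x_i=e_{\alpha_i}$ for all $i$; $\mathcal{S}$ is the set of pure strategy states. $\mathcal{N}_\delta(z)=\{y\in\mathcal{Z}:|x-y|<\delta\}$. *)

theory Defs
  imports "HOL-Probability.Probability"
begin

text \<open>States: pairs (action profile, strategy profile). Players are the elements of a
finite type 'i, actions are natural numbers, the action set of player i is A i.
A strategy of player i is a function nat => real (a probability vector supported on A i).\<close>

type_synonym 'i state = "('i \<Rightarrow> nat) \<times> ('i \<Rightarrow> nat \<Rightarrow> real)"

definition prob_simplex :: "nat set \<Rightarrow> (nat \<Rightarrow> real) set" where
  "prob_simplex S = {p. (\<forall>a. 0 \<le> p a) \<and> (\<forall>a. a \<notin> S \<longrightarrow> p a = 0) \<and> sum p S = 1}"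

definition unitv :: "nat \<Rightarrow> nat \<Rightarrow> real" where
  "unitv a = (\<lambda>b. if b = a then 1 else 0)"

definition states :: "('i \<Rightarrow> nat set) \<Rightarrow> 'i state set" where
  "states A = {(\<alpha>, x). (\<forall>i. \<alpha> i \<in> A i) \<and> (\<forall>i. x i \<in> prob_simplex (A i))}"

definition pure_states :: "('i \<Rightarrow> nat set) \<Rightarrow> 'i state set" where
  "pure_states A = {(\<alpha>, x). (\<forall>i. \<alpha> i \<in> A i) \<and> (\<forall>i. x i = unitv (\<alpha> i))}"

definition la_update :: "real \<Rightarrow> ('i \<Rightarrow> ('i \<Rightarrow> nat) \<Rightarrow> real) \<Rightarrow> ('i \<Rightarrow> nat \<Rightarrow> real)
    \<Rightarrow> ('i \<Rightarrow> nat) \<Rightarrow> 'i state" where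
  "la_update \<epsilon> u x \<alpha>' = (\<alpha>', \<lambda>i a. x i a + \<epsilon> * u i \<alpha>' * (unitv (\<alpha>' i) a - x i a))"

text \<open>Transition probability function P_lambda of perturbed learning automata
(each agent independently trembles with probability l). P = pla_kernel A u eps 0.\<close>
definition pla_kernel :: "('i::finite \<Rightarrow> nat set) \<Rightarrow> ('i \<Rightarrow> ('i \<Rightarrow> nat) \<Rightarrow> real) \<Rightarrow> real \<Rightarrow> real
    \<Rightarrow> 'i state \<Rightarrow> 'i state pmf" where
  "pla_kernel A u \<epsilon> l z =
     map_pmf (la_update \<epsilon> u (snd z))
       (Pi_pmf UNIV 0 (\<lambda>i. bind_pmf (bernoulli_pmf l)
          (\<lambda>b. if b then pmf_of_set (A i) else embed_pmf (snd z i))))"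

definition tremble_kernel :: "('i::finite \<Rightarrow> nat set) \<Rightarrow> ('i \<Rightarrow> ('i \<Rightarrow> nat) \<Rightarrow> real) \<Rightarrow> real
    \<Rightarrow> 'i state \<Rightarrow> 'i state pmf" where
  "tremble_kernel A u \<epsilon> z =
     bind_pmf (pmf_of_set UNIV) (\<lambda>j.
       map_pmf (la_update \<epsilon> u (snd z))
         (Pi_pmf UNIV 0 (\<lambda>i. if i = j then pmf_of_set (A i) else embed_pmf (snd z i))))"

primrec kpow :: "('a \<Rightarrow> 'a pmf) \<Rightarrow> nat \<Rightarrow> 'a \<Rightarrow> 'a pmf" where
  "kpow K 0 z = return_pmf z"
| "kpow K (Suc t) z = bind_pmf (kpow K t z) K"

definition strat_dist :: "('i::finite \<Rightarrow> nat set) \<Rightarrow> ('i \<Rightarrow> nat \<Rightarrow> real) \<Rightarrow> ('i \<Rightarrow> nat \<Rightarrow> real) \<Rightarrow> real" where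
  "strat_dist A x y = sqrt (\<Sum>i\<in>UNIV. \<Sum>a\<in>A i. (x i a - y i a)^2)"

definition nbhd :: "('i::finite \<Rightarrow> nat set) \<Rightarrow> real \<Rightarrow> 'i state \<Rightarrow> 'i state set" where
  "nbhd A \<delta> z = {y \<in> states A. strat_dist A (snd y) (snd z) < \<delta>}"

definition invariant_measure :: "('a \<Rightarrow> 'a pmf) \<Rightarrow> 'a measure \<Rightarrow> bool" where
  "invariant_measure K \<mu> \<longleftrightarrow>
     (\<forall>D \<in> sets \<mu>. emeasure \<mu> D = (\<integral>\<^sup>+ z. emeasure (measure_pmf (K z)) D \<partial>\<mu>))"

definition QPt :: "('i::finite \<Rightarrow> nat set) \<Rightarrow> ('i \<Rightarrow> ('i \<Rightarrow> nat) \<Rightarrow> real) \<Rightarrow> real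
    \<Rightarrow> nat \<Rightarrow> 'i state \<Rightarrow> 'i state set \<Rightarrow> real" where
  "QPt A u \<epsilon> t z D = measure_pmf.prob (bind_pmf (tremble_kernel A u \<epsilon> z) (kpow (pla_kernel A u \<epsilon> 0) t)) D"

definition hatP :: "('i::finite \<Rightarrow> nat set) \<Rightarrow> ('i \<Rightarrow> ('i \<Rightarrow> nat) \<Rightarrow> real) \<Rightarrow> real
    \<Rightarrow> real \<Rightarrow> 'i state \<Rightarrow> 'i state \<Rightarrow> real" where
  "hatP A u \<epsilon> \<delta> s s' = lim (\<lambda>t. QPt A u \<epsilon> t s (nbhd A \<delta> s'))"

end

theory Submission
  imports Defs
begin

text \<open>
  Playing a fixed profile for ever from a state in which each of its actions has probability at
  least \<open>b > 0\<close> has probability bounded below, because the strategies approach the pure strategy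
  geometrically. Hence for continuous \<open>f\<close> the unperturbed iterates \<open>P\<^sup>t f\<close> converge uniformly to a
  continuous harmonic function \<open>H f\<close>, and a continuous harmonic function is determined by its values
  on the pure states: \<open>H f = (\<Sum>s. f s * absorb s)\<close>, where \<open>absorb s z\<close> is the probability of
  absorption in \<open>s\<close> from \<open>z\<close>. In particular the limiting matrix is \<open>limP s s' = Q (absorb s') s\<close>.

  Let \<open>T l\<close> be the operator of the process with perturbation \<open>l\<close> and \<open>n\<close> the number of players. To
  first order in \<open>l\<close> at most one agent trembles, \<open>T l = P + l n (Q - P) + O(l\<^sup>2)\<close>, so that an invariant
  measure \<open>\<mu>\<^sub>l\<close> satisfies \<open>\<integral> f d\<mu>\<^sub>l = \<integral> H f d\<mu>\<^sub>l + o(1)\<close> and, for harmonic \<open>h\<close>,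
  \<open>\<integral> h d\<mu>\<^sub>l = \<integral> Q h d\<mu>\<^sub>l + O(l)\<close>. The vectors \<open>\<integral> absorb s d\<mu>\<^sub>l\<close> are therefore almost stationary
  for \<open>limP\<close>. As one tremble can change any single coordinate of a pure state, \<open>limP\<close> is irreducible;
  its stationary distribution is unique, and by compactness the vectors converge to it.

  Uniqueness of \<open>\<pi>\<close> also needs that invariant measures exist. This is the Krylov-Bogoliubov argument:
  the compact state space is a continuous image of a compact set of reals, which reduces the choice of
  a weakly convergent sequence of Cesaro averages to Helly's selection theorem.
\<close>

section \<open>Limits, compactness and finite sums\<close>

lemma compact_PiE_UNIV:
  fixes X :: "'a \<Rightarrow> 'b::topological_space set"
  assumes "\<And>i. compact (X i)"
  shows "compact (PiE UNIV X)"
proof -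
  have "compactin (product_topology (\<lambda>i. euclidean) UNIV) (PiE UNIV X)"
    using assms by (simp add: compactin_PiE)
  then show ?thesis by (simp add: euclidean_product_topology)
qed

lemma tendsto_fun_componentwise:
  fixes f :: "'a \<Rightarrow> 'b \<Rightarrow> 'c::topological_space"
  assumes "\<And>i. ((\<lambda>x. f x i) \<longlongrightarrow> l i) F"
  shows "(f \<longlongrightarrow> l) F"
proof -
  have "limitin (product_topology (\<lambda>i::'b. euclidean :: 'c topology) UNIV) f l F"
    using assms by (simp add: limitin_componentwise)
  then show ?thesis by (simp add: euclidean_product_topology)
qed

lemma eventually_prod_principal:
  "(\<forall>\<^sub>F p in F \<times>\<^sub>F principal S. R p) \<longleftrightarrow> (\<forall>\<^sub>F x in F. \<forall>y\<in>S. R (x, y))"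
proof
  assume "\<forall>\<^sub>F p in F \<times>\<^sub>F principal S. R p"
  then obtain Q where "\<forall>\<^sub>F x in F. Q x" "\<And>x y. Q x \<Longrightarrow> y \<in> S \<Longrightarrow> R (x, y)"
    unfolding eventually_prod_filter eventually_principal by blast
  then show "\<forall>\<^sub>F x in F. \<forall>y\<in>S. R (x, y)" by (auto elim: eventually_mono)
next
  assume "\<forall>\<^sub>F x in F. \<forall>y\<in>S. R (x, y)"
  then show "\<forall>\<^sub>F p in F \<times>\<^sub>F principal S. R p"
    unfolding eventually_prod_filter eventually_principal by blast
qed

lemma eventually_at_right_0: "\<forall>\<^sub>F l in at_right 0. 0 < l \<and> l \<le> (1::real)"
  unfolding eventually_at_right_field by (intro exI[of _ 1]) auto

lemma tendsto_if_zero_unique: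
  fixes g :: "'a::topological_space \<Rightarrow> real"
  assumes "compact C" "continuous_on C g" and unique: "\<And>x. x \<in> C \<Longrightarrow> g x = 0 \<Longrightarrow> x = a"
    and p_in_C: "\<forall>\<^sub>F l in F. p l \<in> C" and g_p_tendsto: "((\<lambda>l. g (p l)) \<longlongrightarrow> 0) F"
  shows "(p \<longlongrightarrow> a) F"
proof (rule topological_tendstoI)
  fix U assume "open U" "a \<in> U"
  show "\<forall>\<^sub>F l in F. p l \<in> U"
  proof (cases "C \<subseteq> U")
    case True
    then show ?thesis using p_in_C by (auto elim: eventually_mono)
  next
    case False
    have "compact (C - U)" using assms(1) \<open>open U\<close> by (rule compact_diff)
    moreover have "continuous_on (C - U) (\<lambda>x. \<bar>g x\<bar>)"
      using assms(2) by (intro continuous_on_rabs) (auto intro: continuous_on_subset)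
    ultimately obtain m where m_min: "m \<in> C - U" "\<And>x. x \<in> C - U \<Longrightarrow> \<bar>g m\<bar> \<le> \<bar>g x\<bar>"
      using False continuous_attains_inf[of "C - U" "\<lambda>x. \<bar>g x\<bar>"] by blast
    then have "0 < \<bar>g m\<bar>" using unique[of m] \<open>a \<in> U\<close> by auto
    with g_p_tendsto have "\<forall>\<^sub>F l in F. \<bar>g (p l)\<bar> < \<bar>g m\<bar>"
      by (intro order_tendstoD) (auto intro: tendsto_rabs_zero)
    with p_in_C show ?thesis by eventually_elim (use m_min(2) in force)
  qed
qed

lemma sum_subsets_by_card:
  fixes g :: "'i::finite set \<Rightarrow> real"
  shows "(\<Sum>J\<in>UNIV. g J) = g {} + (\<Sum>j\<in>UNIV. g {j}) + (\<Sum>J | 2 \<le> card J. g J)"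
proof -
  have small: "J = {} \<or> (\<exists>j. J = {j})" if "\<not> 2 \<le> card J" for J :: "'i set"
  proof -
    from that consider "card J = 0" | "card J = 1" by linarith
    then show ?thesis by cases (auto simp: card_1_singleton_iff)
  qed
  then have "(UNIV :: 'i set set) = ({{}} \<union> range (\<lambda>j. {j})) \<union> {J. 2 \<le> card J}" by blast
  then have "(\<Sum>J\<in>UNIV. g J) = sum g (({{}} \<union> range (\<lambda>j. {j})) \<union> {J. 2 \<le> card J})" by simp
  also have "\<dots> = sum g {{}} + sum g (range (\<lambda>j. {j})) + (\<Sum>J | 2 \<le> card J. g J)"
  proof -
    have "sum g ({{}} \<union> range (\<lambda>j. {j}) \<union> {J. 2 \<le> card J}) =
        sum g ({{}} \<union> range (\<lambda>j. {j})) + (\<Sum>J | 2 \<le> card J. g J)"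
      by (rule sum.union_disjoint) auto
    moreover have "sum g ({{}} \<union> range (\<lambda>j. {j})) = sum g {{}} + sum g (range (\<lambda>j. {j}))"
      by (rule sum.union_disjoint) auto
    ultimately show ?thesis by simp
  qed
  also have "sum g (range (\<lambda>j. {j})) = (\<Sum>j\<in>UNIV. g {j})"
    by (subst sum.reindex) (auto simp: inj_on_def)
  finally show ?thesis by simp
qed

section \<open>Compact metric spaces as images of compact sets of reals\<close>

definition cantor_sum :: "(nat \<Rightarrow> bool) \<Rightarrow> real" where
  "cantor_sum b = (\<Sum>n. of_bool (b n) * (1 / 3) ^ n)"

lemma summable_cantor_sum: "summable (\<lambda>n. of_bool (b n) * (1 / 3 :: real) ^ n)"
  by (rule summable_comparison_test'[of "\<lambda>n. (1 / 3) ^ n"]) (auto simp: summable_geometric)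

lemma continuous_on_cantor_sum: "continuous_on UNIV cantor_sum"
proof (rule uniform_limit_theorem)
  show "uniform_limit UNIV (\<lambda>n b. \<Sum>i<n. of_bool (b i) * (1 / 3) ^ i) cantor_sum sequentially"
    unfolding cantor_sum_def
    by (rule Weierstrass_m_test[where M="\<lambda>n. (1 / 3) ^ n"]) (auto simp: summable_geometric)
  have "continuous_on UNIV (\<lambda>b::nat \<Rightarrow> bool. of_bool (b i) :: real)" for i
    by (rule continuous_on_compose2[OF Topological_Spaces.continuous_on_discrete[of UNIV]
          continuous_on_product_coordinates]) simp
  then show "\<forall>\<^sub>F n in sequentially. continuous_on UNIV (\<lambda>b. \<Sum>i<n. of_bool (b i) * (1 / 3) ^ i :: real)"
    by (intro always_eventually allI continuous_intros)
qed simp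

lemma inj_cantor_sum: "inj cantor_sum"
proof (rule injI, rule ccontr)
  fix b b' :: "nat \<Rightarrow> bool"
  assume sums_eq: "cantor_sum b = cantor_sum b'" and "b \<noteq> b'"
  then have differ: "\<exists>n. b n \<noteq> b' n" by auto
  define n where "n = (LEAST n. b n \<noteq> b' n)"
  define d where "d k = of_bool (b k) * (1 / 3) ^ k - of_bool (b' k) * (1 / 3 :: real) ^ k" for k
  have summable: "summable d"
    unfolding d_def by (intro summable_diff summable_cantor_sum)
  have "suminf d = 0"
    using sums_eq unfolding d_def cantor_sum_def by (simp add: suminf_diff[symmetric] summable_cantor_sum)
  moreover have "d k = 0" if "k < n" for k
    using not_less_Least[OF that[unfolded n_def]] by (simp add: d_def)
  ultimately have split: "d n = - (\<Sum>k. d (k + Suc n))"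
    using suminf_split_initial_segment[OF summable, of "Suc n"] by simp
  have first: "\<bar>d n\<bar> = (1 / 3) ^ n"
    using LeastI_ex[OF differ] unfolding n_def[symmetric] by (auto simp: d_def)
  have geometric: "(\<lambda>k. (1 / 3 :: real) ^ (k + Suc n)) sums ((1 / 3) ^ n / 2)"
    using sums_mult2[OF geometric_sums[of "1 / 3 :: real"], of "(1 / 3) ^ Suc n"] by (simp add: power_add)
  have "\<bar>\<Sum>k. d (k + Suc n)\<bar> \<le> (\<Sum>k. (1 / 3) ^ (k + Suc n))"
  proof (rule norm_suminf_le[of "\<lambda>k. d (k + Suc n)", unfolded real_norm_def])
    show "\<bar>d (k + Suc n)\<bar> \<le> (1 / 3) ^ (k + Suc n)" for k by (auto simp: d_def of_bool_def)
    show "summable (\<lambda>k. (1 / 3 :: real) ^ (k + Suc n))" using geometric by (rule sums_summable)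
  qed
  also have "\<dots> = (1 / 3) ^ n / 2" using geometric by (rule sums_unique[symmetric])
  finally have "(1 / 3 :: real) ^ n \<le> (1 / 3) ^ n / 2" using first split by simp
  then show False using zero_less_power[of "1 / 3 :: real" n] by linarith
qed

text \<open>On the sphere both answers are admitted, which makes the set of codes closed.\<close>
definition distance_code :: "(nat \<Rightarrow> 'a::metric_space) \<Rightarrow> (nat \<Rightarrow> bool) \<Rightarrow> 'a \<Rightarrow> bool" where
  "distance_code d b x \<longleftrightarrow> (\<forall>i j.
     (b (prod_encode (i, j)) \<longrightarrow> dist x (d i) \<le> inverse (Suc j)) \<and>
     (\<not> b (prod_encode (i, j)) \<longrightarrow> inverse (Suc j) \<le> dist x (d i)))"

lemma distance_code_exists: "\<exists>b. distance_code d b x"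
proof
  show "distance_code d (\<lambda>k. case prod_decode k of (i, j) \<Rightarrow> dist x (d i) \<le> inverse (Suc j)) x"
    by (simp add: distance_code_def)
qed

lemma distance_code_unique:
  assumes dense: "\<And>x e. 0 < e \<Longrightarrow> \<exists>i. dist x (d i) < e"
    and x_code: "distance_code d b x" and y_code: "distance_code d b y"
  shows "x = y"
proof (rule ccontr)
  assume "x \<noteq> y"
  then obtain j where separated: "inverse (real (Suc j)) < dist x y / 2"
    using reals_Archimedean[of "dist x y / 2"] by auto
  obtain i where near: "dist x (d i) < inverse (real (Suc j))"
    using dense[of "inverse (real (Suc j))"] by auto
  then have "b (prod_encode (i, j))" using x_code unfolding distance_code_def by (meson not_le)
  then have "dist y (d i) \<le> inverse (real (Suc j))" using y_code by (simp add: distance_code_def)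
  then show False using near separated dist_triangle2[of x y "d i"] by linarith
qed

lemma closed_distance_code:
  fixes d :: "nat \<Rightarrow> 'a::metric_space"
  shows "closed {z. distance_code d (fst z) (snd z)}"
proof -
  have bit: "continuous_on UNIV (\<lambda>z::(nat \<Rightarrow> bool) \<times> 'a. fst z k)" for k
    by (rule continuous_on_product_then_coordinatewise[OF continuous_on_fst[OF continuous_on_id]])
  have "open ((\<lambda>z::(nat \<Rightarrow> bool) \<times> 'a. fst z k) -` B)" for k B
    by (intro open_vimage Topological_Spaces.open_discrete bit)
  from this[of _ "{True}"] this[of _ "{False}"]
  have "open {z::(nat \<Rightarrow> bool) \<times> 'a. fst z k}" "open {z::(nat \<Rightarrow> bool) \<times> 'a. \<not> fst z k}" for k
    by (simp_all add: vimage_def)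
  then show ?thesis
    unfolding distance_code_def
    by (intro closed_Collect_all closed_Collect_conj closed_Collect_imp closed_Collect_le
        continuous_on_dist continuous_on_snd continuous_on_id continuous_on_const)
qed

theorem compact_image_of_compact_reals:
  fixes X :: "'a::{metric_space, second_countable_topology} set"
  assumes "compact X"
  obtains C :: "real set" and \<phi> where "compact C" "continuous_on C \<phi>" "\<phi> ` C = X"
proof -
  obtain D :: "'a set" where "countable D" and dense: "\<And>U. open U \<Longrightarrow> U \<noteq> {} \<Longrightarrow> \<exists>d\<in>D. d \<in> U"
    using countable_dense_setE by blast
  define d where "d = from_nat_into D"
  have "range d = D"
    unfolding d_def using \<open>countable D\<close> dense[of UNIV] by (intro range_from_nat_into) auto
  then have d_dense: "\<exists>i. dist x (d i) < e" if "0 < e" for x e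
    using dense[of "ball x e"] that by auto
  define Z where "Z = (UNIV \<times> X) \<inter> {z. distance_code d (fst z) (snd z)}"
  have "compact (UNIV :: (nat \<Rightarrow> bool) set)"
    using compact_PiE_UNIV[of "\<lambda>_::nat. UNIV :: bool set"] finite_imp_compact[of "UNIV :: bool set"] by simp
  then have "compact Z"
    unfolding Z_def using assms by (intro compact_Int_closed compact_Times closed_distance_code)
  let ?code = "\<lambda>z::(nat \<Rightarrow> bool) \<times> 'a. cantor_sum (fst z)"
  have inj: "inj_on ?code Z"
  proof (rule inj_onI)
    fix z z' assume z: "z \<in> Z" "z' \<in> Z" and "?code z = ?code z'"
    then have "fst z = fst z'" by (intro injD[OF inj_cantor_sum])
    moreover from this have "snd z = snd z'"
      using z by (intro distance_code_unique[of d "fst z"] d_dense) (auto simp: Z_def)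
    ultimately show "z = z'" by (rule prod_eqI)
  qed
  have cont: "continuous_on Z ?code"
    by (intro continuous_on_compose2[OF continuous_on_cantor_sum] continuous_intros) auto
  show thesis
  proof (rule that)
    show "compact (?code ` Z)" using cont \<open>compact Z\<close> by (rule compact_continuous_image)
    show "continuous_on (?code ` Z) (\<lambda>c. snd (the_inv_into Z ?code c))"
      by (intro continuous_on_snd continuous_on_inv_into cont \<open>compact Z\<close> inj)
    have "(\<lambda>c. snd (the_inv_into Z ?code c)) ` ?code ` Z = snd ` Z"
      using the_inv_into_f_f[OF inj] by (simp add: image_image)
    also have "\<dots> = X" using distance_code_exists[of d] by (force simp: Z_def)
    finally show "(\<lambda>c. snd (the_inv_into Z ?code c)) ` ?code ` Z = X" .
  qed
qed

section \<open>Borel probability measures on compact sets\<close>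

locale borel_prob_on = prob_space \<mu> for \<mu> :: "'a::topological_space measure" +
  fixes X :: "'a set"
  assumes sets_eq: "sets \<mu> = sets borel"
    and compact: "compact X"
    and X_borel: "X \<in> sets borel"
    and emeasure_eq_1: "emeasure \<mu> X = 1"
begin

lemma borel_measurable_eq: "borel_measurable \<mu> = borel_measurable borel"
  by (rule measurable_cong_sets) (simp_all add: sets_eq)

lemma AE_in_X: "AE x in \<mu>. x \<in> X"
  using emeasure_eq_1 X_borel by (intro AE_prob_1) (simp_all add: emeasure_eq_measure sets_eq)

lemma measure_X: "measure \<mu> X = 1"
  using emeasure_eq_1 by (simp add: emeasure_eq_measure)

lemma integral_eq_set_integral:
  fixes f :: "'a \<Rightarrow> real"
  assumes "f \<in> borel_measurable borel"
  shows "integral\<^sup>L \<mu> f = (LINT x:X|\<mu>. f x)"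
  unfolding set_lebesgue_integral_def using AE_in_X assms X_borel
  by (intro integral_cong_AE) (auto simp: borel_measurable_eq)

lemma set_integral_const: "(LINT x:X|\<mu>. c) = (c::real)"
  using X_borel by (simp add: set_integral_const sets_eq emeasure_eq_1 measure_X)

lemma set_integrable_continuous:
  fixes f :: "'a \<Rightarrow> real"
  assumes "continuous_on X f"
  shows "set_integrable \<mu> X f"
proof -
  obtain B where "0 \<le> B" "\<And>x. x \<in> X \<Longrightarrow> norm (f x) \<le> B"
    using continuous_on_compact_bound[OF compact assms] by blast
  then have "norm (indicator X x *\<^sub>R f x) \<le> B" for x
    by (simp add: indicator_def)
  then show ?thesis
    unfolding set_integrable_def using set_measurable_continuous_on[OF X_borel assms]
    by (intro integrable_const_bound[of _ B])
       (auto simp: set_borel_measurable_def borel_measurable_eq)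
qed

lemma set_integral_mono_continuous:
  fixes f g :: "'a \<Rightarrow> real"
  assumes "continuous_on X f" "continuous_on X g" "\<And>x. x \<in> X \<Longrightarrow> f x \<le> g x"
  shows "(LINT x:X|\<mu>. f x) \<le> (LINT x:X|\<mu>. g x)"
  using assms by (intro set_integral_mono set_integrable_continuous)

lemma abs_set_integral_le:
  fixes f :: "'a \<Rightarrow> real"
  assumes "continuous_on X f" "\<And>x. x \<in> X \<Longrightarrow> \<bar>f x\<bar> \<le> B"
  shows "\<bar>LINT x:X|\<mu>. f x\<bar> \<le> B"
proof -
  have "f x \<le> B" "- B \<le> f x" if "x \<in> X" for x
    using assms(2)[OF that] by auto
  then have "(LINT x:X|\<mu>. f x) \<le> B" "- B \<le> (LINT x:X|\<mu>. f x)"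
    using set_integral_mono_continuous[OF assms(1) continuous_on_const, of B]
      set_integral_mono_continuous[OF continuous_on_const assms(1), of "- B"]
    by (auto simp only: set_integral_const)
  then show ?thesis by auto
qed

lemma set_integral_tendsto_measure:
  fixes g :: "nat \<Rightarrow> 'a \<Rightarrow> real"
  assumes "closed F" "\<And>n. continuous_on X (g n)" "\<And>n x. \<bar>g n x\<bar> \<le> 1"
    and "\<And>x. x \<in> X \<Longrightarrow> (\<lambda>n. g n x) \<longlonglongrightarrow> indicator F x"
  shows "(\<lambda>n. LINT x:X|\<mu>. g n x) \<longlonglongrightarrow> measure \<mu> F"
proof -
  have "(\<lambda>n. LINT x:X|\<mu>. g n x) \<longlonglongrightarrow> (LINT x:X|\<mu>. indicator F x)"
    unfolding set_lebesgue_integral_def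
  proof (rule integral_dominated_convergence[where w="\<lambda>_. 1"])
    show "(\<lambda>x. indicator X x *\<^sub>R g n x) \<in> borel_measurable \<mu>" for n
      using set_integrable_continuous[OF assms(2)] unfolding set_integrable_def by auto
    show "(\<lambda>x. indicator X x *\<^sub>R (indicator F x :: real)) \<in> borel_measurable \<mu>"
      unfolding borel_measurable_eq
      by (intro borel_measurable_scaleR borel_measurable_indicator X_borel borel_closed assms(1))
    show "AE x in \<mu>. (\<lambda>n. indicator X x *\<^sub>R g n x) \<longlonglongrightarrow> indicator X x *\<^sub>R indicator F x"
    proof (rule AE_I2)
      show "(\<lambda>n. indicator X x *\<^sub>R g n x) \<longlonglongrightarrow> indicator X x *\<^sub>R indicator F x" for x
        using assms(4)[of x] by (cases "x \<in> X") simp_all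
    qed
  qed (use assms(3) in \<open>auto simp: indicator_def\<close>)
  also have "(LINT x:X|\<mu>. indicator F x) = measure \<mu> F"
    using assms(1) integral_eq_set_integral[of "indicator F"] sets_eq_imp_space_eq[OF sets_eq] by simp
  finally show ?thesis .
qed

end

lemma expectation_cong_set_pmf:
  fixes f g :: "'a \<Rightarrow> real"
  assumes "\<And>x. x \<in> set_pmf p \<Longrightarrow> f x = g x"
  shows "measure_pmf.expectation p f = measure_pmf.expectation p g"
  using assms by (intro integral_cong_AE) (auto simp: AE_measure_pmf_iff)

text \<open>No mass escapes from \<open>C\<close> in the limit, because \<open>min 1 (infdist c C)\<close> has mean \<open>0\<close> along the
  sequence.\<close>
lemma borel_prob_on_weak_limit:
  fixes C :: "real set" and p :: "nat \<Rightarrow> real pmf"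
  assumes C: "compact C" and p_subset: "\<And>n. set_pmf (p n) \<subseteq> C" and N: "real_distribution N"
    and lim: "\<And>f::real \<Rightarrow> real. continuous_on UNIV f \<Longrightarrow> (\<And>c. \<bar>f c\<bar> \<le> 1) \<Longrightarrow>
       (\<lambda>n. measure_pmf.expectation (p n) f) \<longlonglongrightarrow> integral\<^sup>L N f"
  shows "borel_prob_on N C"
proof -
  interpret N: real_distribution N by fact
  have "C \<noteq> {}" using p_subset set_pmf_not_empty by fastforce
  define f where "f c = min 1 (infdist c C)" for c
  have f: "continuous_on UNIV f" "\<And>c. \<bar>f c\<bar> \<le> 1"
    unfolding f_def by (intro continuous_intros continuous_on_infdist) (auto simp: infdist_nonneg)
  have "measure_pmf.expectation (p n) f = measure_pmf.expectation (p n) (\<lambda>_. 0)" for n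
    using p_subset[of n] by (intro expectation_cong_set_pmf) (auto simp: f_def)
  then have "integral\<^sup>L N f = 0" using lim[OF f] by (simp add: LIMSEQ_const_iff)
  moreover have "integrable N f"
    using f borel_measurable_continuous_onI[OF f(1)] by (intro N.integrable_const_bound[of _ 1]) auto
  ultimately have "AE c in N. f c = 0"
    by (subst (asm) integral_nonneg_eq_0_iff_AE) (auto simp: f_def infdist_nonneg)
  then have "AE c in N. c \<in> C"
  proof eventually_elim
    case (elim c)
    then have "infdist c C = 0" by (simp add: f_def min_def split: if_splits)
    then show ?case using in_closed_iff_infdist_zero[OF compact_imp_closed] C \<open>C \<noteq> {}\<close> by blast
  qed
  then have "emeasure N C = 1"
    using N.prob_eq_1[of C] compact_imp_closed[OF C] by (simp add: N.emeasure_eq_measure)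
  then show ?thesis by unfold_locales (use C compact_imp_closed[OF C] in auto)
qed

lemma bounded_pmf_weak_subsequence:
  fixes p :: "nat \<Rightarrow> real pmf"
  assumes "0 < B" and p_subset: "\<And>n. set_pmf (p n) \<subseteq> {- B..B}"
  obtains r N where "strict_mono r" "real_distribution N"
    "\<And>(f::real \<Rightarrow> real) b. continuous_on UNIV f \<Longrightarrow> (\<And>c. \<bar>f c\<bar> \<le> b) \<Longrightarrow>
       (\<lambda>n. measure_pmf.expectation (p (r n)) f) \<longlonglongrightarrow> integral\<^sup>L N f"
proof -
  define \<nu> where "\<nu> n = distr (measure_pmf (p n)) borel (\<lambda>c. c)" for n
  have \<nu>: "real_distribution (\<nu> n)" for n
    by (auto simp: real_distribution_def real_distribution_axioms_def
        \<nu>_def intro!: measure_pmf.prob_space_distr)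
  have expectation_\<nu>: "integral\<^sup>L (\<nu> n) f = measure_pmf.expectation (p n) f"
    if "continuous_on UNIV f" for n and f :: "real \<Rightarrow> real"
    using borel_measurable_continuous_onI[OF that] by (simp add: \<nu>_def integral_distr)
  have "measure (\<nu> n) {- B - 1<..B} = 1" for n
  proof -
    have "set_pmf (p n) \<subseteq> {- B - 1<..B}" using p_subset[of n] by fastforce
    then show ?thesis
      by (auto simp: \<nu>_def measure_distr measure_pmf.prob_eq_1 AE_measure_pmf_iff)
  qed
  then have "tight \<nu>"
    unfolding tight_def using \<nu> \<open>0 < B\<close> by (intro conjI allI impI exI[of _ "- B - 1"] exI[of _ B]) auto
  then obtain r N where r: "strict_mono (r::nat \<Rightarrow> nat)" and N: "real_distribution N"
      and "weak_conv_m (\<nu> \<circ> r) N"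
    using tight_imp_convergent_subsubsequence[OF _ strict_mono_id, of \<nu>] by auto
  then have "(\<lambda>n. measure_pmf.expectation (p (r n)) f) \<longlonglongrightarrow> integral\<^sup>L N f"
    if "continuous_on UNIV f" "\<And>c. \<bar>f c\<bar> \<le> b" for f :: "real \<Rightarrow> real" and b
    using weak_conv_imp_integral_bdd_continuous_conv[of "\<nu> \<circ> r" N f b] \<nu> that
    by (simp add: expectation_\<nu> continuous_on_eq_continuous_at)
  then show thesis using r N that by blast
qed

lemma compact_reals_weak_subsequence:
  fixes C :: "real set" and p :: "nat \<Rightarrow> real pmf"
  assumes C: "compact C" and p_subset: "\<And>n. set_pmf (p n) \<subseteq> C"
  obtains r N where "strict_mono r" "borel_prob_on N C"
    "\<And>f::real \<Rightarrow> real. continuous_on C f \<Longrightarrow>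
       (\<lambda>n. measure_pmf.expectation (p (r n)) f) \<longlonglongrightarrow> (LINT c:C|N. f c)"
proof -
  obtain B where B_bound: "0 < B" "\<And>c. c \<in> C \<Longrightarrow> \<bar>c\<bar> \<le> B"
    using compact_imp_bounded[OF C] by (auto simp: bounded_pos)
  have "set_pmf (p n) \<subseteq> {- B..B}" for n using p_subset[of n] B_bound(2) by (fastforce simp: abs_le_iff)
  then obtain r N where r: "strict_mono r" and N: "real_distribution N"
    and lim: "\<And>(f::real \<Rightarrow> real) b. continuous_on UNIV f \<Longrightarrow> (\<And>c. \<bar>f c\<bar> \<le> b) \<Longrightarrow>
       (\<lambda>n. measure_pmf.expectation (p (r n)) f) \<longlonglongrightarrow> integral\<^sup>L N f"
    using bounded_pmf_weak_subsequence[OF B_bound(1), of p] by blast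
  have "borel_prob_on N C"
    using C p_subset N lim by (rule borel_prob_on_weak_limit)
  moreover have "(\<lambda>n. measure_pmf.expectation (p (r n)) f) \<longlonglongrightarrow> (LINT c:C|N. f c)"
    if f: "continuous_on C f" for f :: "real \<Rightarrow> real"
  proof -
    obtain b where "0 \<le> b" "\<And>c. c \<in> C \<Longrightarrow> norm (f c) \<le> b"
      using continuous_on_compact_bound[OF C f] by blast
    then obtain g where g_extends: "continuous_on UNIV g" "\<And>c. c \<in> C \<Longrightarrow> g c = f c" "\<And>c. norm (g c) \<le> b"
      using Tietze[of C f UNIV b] f compact_imp_closed[OF C] by auto
    have "(LINT c:C|N. f c) = integral\<^sup>L N g"
      using borel_prob_on.integral_eq_set_integral[OF \<open>borel_prob_on N C\<close>, of g] g_extends(1,2)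
        borel_measurable_continuous_onI[OF g_extends(1)] C compact_imp_closed[OF C]
      by (simp add: set_lebesgue_integral_cong real_distribution.events_eq_borel[OF N])
    moreover have "measure_pmf.expectation (p (r n)) f = measure_pmf.expectation (p (r n)) g" for n
      using g_extends(2) p_subset by (intro expectation_cong_set_pmf) fastforce
    ultimately show ?thesis using lim[OF g_extends(1), of b] g_extends(3) by simp
  qed
  ultimately show thesis using r that by blast
qed

lemma borel_prob_on_distr:
  fixes C :: "'a::topological_space set" and \<phi> :: "'a \<Rightarrow> 'b::topological_space"
  assumes N: "borel_prob_on N C" and \<phi>: "continuous_on C \<phi>"
    and image_eq: "\<phi> ` C = X" and X_borel: "X \<in> sets borel"
  obtains \<mu> where "borel_prob_on \<mu> X"
    "\<And>f::'b \<Rightarrow> real. continuous_on X f \<Longrightarrow> (LINT x:X|\<mu>. f x) = (LINT c:C|N. f (\<phi> c))"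
proof -
  interpret N: borel_prob_on N C by fact
  define \<psi> where "\<psi> c = (if c \<in> C then \<phi> c else undefined)" for c
  define \<mu> where "\<mu> = distr N borel \<psi>"
  have \<psi>: "\<psi> \<in> measurable N borel"
    unfolding N.borel_measurable_eq \<psi>_def
    by (rule borel_measurable_continuous_on_if[OF N.X_borel \<phi>]) simp
  have compact_X: "compact X" unfolding image_eq[symmetric]
    using \<phi> N.compact by (rule compact_continuous_image)
  interpret borel_prob_on \<mu> X
  proof (intro borel_prob_on.intro borel_prob_on_axioms.intro)
    show "prob_space \<mu>" unfolding \<mu>_def using \<psi> by (rule N.prob_space_distr)
    have "AE c in N. \<psi> c \<in> X" using N.AE_in_X by eventually_elim (auto simp: \<psi>_def image_eq[symmetric])
    then have "AE x in \<mu>. x \<in> X" unfolding \<mu>_def using X_borel \<psi> by (subst AE_distr_iff) auto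
    then show "emeasure \<mu> X = 1"
      using \<open>prob_space \<mu>\<close> X_borel
      by (intro prob_space.emeasure_eq_1_AE) (auto simp: \<mu>_def)
  qed (simp_all add: \<mu>_def compact_X X_borel)
  have "(LINT x:X|\<mu>. f x) = (LINT c:C|N. f (\<phi> c))" if f: "continuous_on X f" for f :: "'b \<Rightarrow> real"
  proof -
    have f_borel: "(\<lambda>x. indicator X x *\<^sub>R f x) \<in> borel_measurable borel"
      using set_measurable_continuous_on[OF X_borel f] by (simp add: set_borel_measurable_def)
    have "(LINT x:X|\<mu>. f x) = (LINT c|N. indicator X (\<psi> c) *\<^sub>R f (\<psi> c))"
      unfolding set_lebesgue_integral_def \<mu>_def using f_borel \<psi> by (intro integral_distr)
    also have "\<dots> = (LINT c:C|N. indicator X (\<psi> c) *\<^sub>R f (\<psi> c))"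
      using measurable_compose[OF \<psi> f_borel]
      by (intro N.integral_eq_set_integral) (simp add: N.borel_measurable_eq)
    also have "\<dots> = (LINT c:C|N. f (\<phi> c))"
      using N.X_borel by (intro set_lebesgue_integral_cong) (auto simp: N.sets_eq \<psi>_def image_eq[symmetric])
    finally show ?thesis .
  qed
  then show thesis using that borel_prob_on_axioms by blast
qed

locale compact_metrizable =
  fixes X :: "'a::topological_space set" and e :: "'a \<Rightarrow> 'b::{metric_space, second_countable_topology}"
  assumes compact: "compact X"
    and continuous_embedding: "continuous_on UNIV e"
    and inj_embedding: "inj e"
begin

lemma continuous_on_embedding: "continuous_on S e"
  using continuous_embedding by (rule continuous_on_subset) simp

lemma closed: "closed X"
proof -
  have "closed (e ` X)"
    using continuous_on_embedding compact by (intro compact_imp_closed compact_continuous_image)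
  then have "closed (e -` e ` X)" using continuous_embedding by (rule closed_vimage)
  then show ?thesis using inj_embedding by (simp add: inj_vimage_image_eq)
qed

lemma borel: "X \<in> sets borel"
  using closed by (rule borel_closed)

lemma indicator_closed_approx:
  assumes "closed F"
  obtains g :: "nat \<Rightarrow> 'a \<Rightarrow> real" where "\<And>n. continuous_on X (g n)"
    "\<And>n x. \<bar>g n x\<bar> \<le> 1" "\<And>x. x \<in> X \<Longrightarrow> (\<lambda>n. g n x) \<longlonglongrightarrow> indicator F x"
proof (cases "X \<inter> F = {}")
  case True
  then have "indicator F x = (0::real)" if "x \<in> X" for x using that by (auto simp: indicator_def)
  then show thesis by (intro that[of "\<lambda>_ _. 0"]) simp_all
next
  case False
  define E where "E = e ` (X \<inter> F)"
  have "compact E"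
    unfolding E_def using compact assms
    by (intro compact_continuous_image compact_Int_closed continuous_on_embedding)
  define g where "g n x = max 0 (1 - real n * infdist (e x) E)" for n x
  have "(\<lambda>n. g n x) \<longlonglongrightarrow> indicator F x" if x: "x \<in> X" for x
  proof (cases "x \<in> F")
    case True
    then show ?thesis using x by (simp add: g_def E_def)
  next
    case notin: False
    then have "e x \<notin> E" using inj_embedding by (auto simp: E_def dest: injD)
    then have pos: "0 < infdist (e x) E"
      using in_closed_iff_infdist_zero[OF compact_imp_closed[OF \<open>compact E\<close>], of "e x"] False
        infdist_nonneg[of "e x" E] by (auto simp: E_def less_le)
    then obtain n0 where n0_large: "1 < real n0 * infdist (e x) E" using reals_Archimedean3 by blast
    have "real n0 * infdist (e x) E \<le> real n * infdist (e x) E" if "n \<ge> n0" for n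
      using that pos by (intro mult_right_mono) auto
    then have "g n x = 0" if "n \<ge> n0" for n using n0_large that by (force simp: g_def)
    then show ?thesis using notin
      by (intro tendsto_eventually eventually_sequentiallyI[of n0]) simp
  qed
  moreover have "\<bar>g n x\<bar> \<le> 1" for n x
    using infdist_nonneg[of "e x" E] by (auto simp: g_def)
  moreover have "continuous_on X (g n)" for n
    unfolding g_def by (intro continuous_intros continuous_on_infdist continuous_on_embedding)
  ultimately show thesis by (intro that)
qed

lemma borel_prob_on_eqI:
  assumes M: "borel_prob_on M X" and N: "borel_prob_on N X"
    and integrals_eq: "\<And>f::'a \<Rightarrow> real. continuous_on X f \<Longrightarrow> (LINT x:X|M. f x) = (LINT x:X|N. f x)"
  shows "M = N"
proof (rule measure_eqI_generator_eq[where E="Collect closed" and \<Omega>=UNIV and A="\<lambda>_. UNIV"])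
  interpret M: borel_prob_on M X by fact
  interpret N: borel_prob_on N X by fact
  show "Int_stable (Collect (closed :: 'a set \<Rightarrow> bool))" by (auto simp: Int_stable_def)
  show "sets M = sigma_sets UNIV (Collect closed)" "sets N = sigma_sets UNIV (Collect closed)"
    by (simp_all add: M.sets_eq N.sets_eq borel_eq_closed)
  show "emeasure M UNIV \<noteq> \<infinity>" by simp
  fix F :: "'a set"
  assume "F \<in> Collect closed"
  then have F: "closed F" by simp
  obtain g :: "nat \<Rightarrow> 'a \<Rightarrow> real" where g_approx: "\<And>n. continuous_on X (g n)" "\<And>n x. \<bar>g n x\<bar> \<le> 1"
      "\<And>x. x \<in> X \<Longrightarrow> (\<lambda>n. g n x) \<longlonglongrightarrow> indicator F x"
    using indicator_closed_approx[OF F] by blast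
  have "measure M F = measure N F"
    using M.set_integral_tendsto_measure[OF F g_approx] N.set_integral_tendsto_measure[OF F g_approx]
      integrals_eq[OF g_approx(1)]
    by (simp add: LIMSEQ_unique)
  then show "emeasure M F = emeasure N F"
    by (simp add: M.emeasure_eq_measure N.emeasure_eq_measure)
qed auto

lemma continuous_image_of_compact_reals:
  obtains C :: "real set" and \<phi> where "compact C" "continuous_on C \<phi>" "\<phi> ` C = X"
proof -
  have inj: "inj_on e X" using inj_embedding by (rule inj_on_subset) simp
  have "compact (e ` X)" using continuous_on_embedding compact by (rule compact_continuous_image)
  then obtain C :: "real set" and \<phi> where C: "compact C" and \<phi>: "continuous_on C \<phi>" "\<phi> ` C = e ` X"
    using compact_image_of_compact_reals by blast
  show thesis
  proof (rule that[OF C])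
    show "continuous_on C (\<lambda>c. the_inv_into X e (\<phi> c))"
      using continuous_on_inv_into[OF continuous_on_embedding compact inj] \<phi>
      by (intro continuous_on_compose2[OF _ \<phi>(1)]) auto
    have "(\<lambda>c. the_inv_into X e (\<phi> c)) ` C = the_inv_into X e ` e ` X" by (simp only: image_image flip: \<phi>(2))
    then show "(\<lambda>c. the_inv_into X e (\<phi> c)) ` C = X"
      using inj by (simp add: image_image the_inv_into_f_f)
  qed
qed

theorem compact_weak_subsequence:
  fixes p :: "nat \<Rightarrow> 'a pmf"
  assumes p_subset: "\<And>n. set_pmf (p n) \<subseteq> X"
  obtains r \<mu> where "strict_mono r" "borel_prob_on \<mu> X"
    "\<And>f::'a \<Rightarrow> real. continuous_on X f \<Longrightarrow>
       (\<lambda>n. measure_pmf.expectation (p (r n)) f) \<longlonglongrightarrow> (LINT x:X|\<mu>. f x)"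
proof -
  obtain C :: "real set" and \<phi> where C: "compact C" and \<phi>: "continuous_on C \<phi>" "\<phi> ` C = X"
    using continuous_image_of_compact_reals by blast
  define code where "code = inv_into C \<phi>"
  have code: "code x \<in> C" "\<phi> (code x) = x" if "x \<in> X" for x
    using that \<phi>(2) by (auto simp: code_def inv_into_into f_inv_into_f)
  have "set_pmf (map_pmf code (p n)) \<subseteq> C" for n
    using p_subset[of n] code by auto
  then obtain r N where "strict_mono r" and N: "borel_prob_on N C"
    and lim: "\<And>f::real \<Rightarrow> real. continuous_on C f \<Longrightarrow>
       (\<lambda>n. measure_pmf.expectation (map_pmf code (p (r n))) f) \<longlonglongrightarrow> (LINT c:C|N. f c)"
    using compact_reals_weak_subsequence[OF C, of "\<lambda>n. map_pmf code (p n)"] by blast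
  obtain \<mu> where \<mu>: "borel_prob_on \<mu> X"
    "\<And>f::'a \<Rightarrow> real. continuous_on X f \<Longrightarrow> (LINT x:X|\<mu>. f x) = (LINT c:C|N. f (\<phi> c))"
    using borel_prob_on_distr[OF N \<phi> borel] by blast
  have "(\<lambda>n. measure_pmf.expectation (p (r n)) f) \<longlonglongrightarrow> (LINT x:X|\<mu>. f x)"
    if f: "continuous_on X f" for f :: "'a \<Rightarrow> real"
  proof -
    have "measure_pmf.expectation (map_pmf code (p (r n))) (\<lambda>c. f (\<phi> c))
          = measure_pmf.expectation (p (r n)) f" for n
      using p_subset[of "r n"] code(2) by (auto intro!: expectation_cong_set_pmf)
    moreover have "continuous_on C (\<lambda>c. f (\<phi> c))"
      using f \<phi> by (auto intro: continuous_on_compose2)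
    ultimately show ?thesis using lim[of "\<lambda>c. f (\<phi> c)"] \<mu>(2)[OF f] by simp
  qed
  then show thesis using that \<open>strict_mono r\<close> \<mu>(1) by blast
qed

end

section \<open>Invariant measures of Feller kernels\<close>

lemma abs_expectation_le:
  fixes f :: "'a \<Rightarrow> real"
  assumes "\<And>x. x \<in> set_pmf p \<Longrightarrow> \<bar>f x\<bar> \<le> B"
  shows "\<bar>measure_pmf.expectation p f\<bar> \<le> B"
proof -
  have "integrable (measure_pmf p) f"
    using assms by (intro measure_pmf.integrable_const_bound[where B=B]) (auto simp: AE_measure_pmf_iff)
  moreover have "AE x in measure_pmf p. f x \<le> B" "AE x in measure_pmf p. - B \<le> f x"
    using assms by (auto simp: AE_measure_pmf_iff abs_le_iff minus_le_iff)
  ultimately have "measure_pmf.expectation p f \<le> B" "- B \<le> measure_pmf.expectation p f"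
    using measure_pmf.integral_le_const measure_pmf.integral_ge_const by blast+
  then show ?thesis by simp
qed

lemma expectation_bind_pmf:
  fixes f :: "'b \<Rightarrow> real"
  assumes "\<And>y. y \<in> set_pmf (M \<bind> N) \<Longrightarrow> \<bar>f y\<bar> \<le> B"
  shows "measure_pmf.expectation (M \<bind> N) f = measure_pmf.expectation M (\<lambda>x. measure_pmf.expectation (N x) f)"
proof -
  define g where "g y = (if y \<in> set_pmf (M \<bind> N) then f y else 0)" for y
  have "measure_pmf.expectation (M \<bind> N) f = measure_pmf.expectation (M \<bind> N) g"
    by (rule expectation_cong_set_pmf) (simp add: g_def)
  also have "\<dots> = measure_pmf.expectation M (\<lambda>x. measure_pmf.expectation (N x) g)"
    unfolding measure_pmf_bind
  proof (rule integral_bind[where K="count_space UNIV" and B="\<bar>B\<bar>" and B'=1])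
    show "\<bar>g y\<bar> \<le> \<bar>B\<bar>" for y
      using assms[of y] abs_ge_self[of B] unfolding g_def by (auto simp del: set_bind_pmf)
  qed (auto simp: measure_pmf.emeasure_space_1 measure_pmf.finite_measure_axioms
      intro!: measure_pmf_in_subprob_algebra)
  also have "\<dots> = measure_pmf.expectation M (\<lambda>x. measure_pmf.expectation (N x) f)"
    by (intro expectation_cong_set_pmf) (auto simp: g_def)
  finally show ?thesis .
qed

definition absorbing :: "('a \<Rightarrow> 'a pmf) \<Rightarrow> 'a set \<Rightarrow> bool" where
  "absorbing K S \<longleftrightarrow> (\<forall>z\<in>S. set_pmf (K z) \<subseteq> S)"

lemma absorbing_kpow: "absorbing K S \<Longrightarrow> absorbing (kpow K t) S"
  unfolding absorbing_def by (induction t) auto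

lemma expectation_kpow_Suc:
  fixes f :: "'a \<Rightarrow> real"
  assumes "absorbing K S" "z \<in> S" "\<And>y. y \<in> S \<Longrightarrow> \<bar>f y\<bar> \<le> B"
  shows "measure_pmf.expectation (kpow K (Suc t) z) f =
    measure_pmf.expectation (kpow K t z) (\<lambda>y. measure_pmf.expectation (K y) f)"
  using assms(2,3) absorbing_kpow[OF assms(1), of "Suc t"]
  unfolding kpow.simps absorbing_def by (intro expectation_bind_pmf) blast

lemma expectation_kpow:
  fixes f :: "'a \<Rightarrow> real"
  assumes K_operator: "absorbing K S" "\<And>g z. z \<in> S \<Longrightarrow> measure_pmf.expectation (K z) g = P g z"
    and "z \<in> S" "\<And>y. y \<in> S \<Longrightarrow> \<bar>f y\<bar> \<le> B"
  shows "measure_pmf.expectation (kpow K t z) f = (P ^^ t) f z"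
  using assms(4)
proof (induction t arbitrary: f)
  case (Suc t)
  have "measure_pmf.expectation (kpow K (Suc t) z) f =
      measure_pmf.expectation (kpow K t z) (\<lambda>y. measure_pmf.expectation (K y) f)"
    by (rule expectation_kpow_Suc[OF K_operator(1) \<open>z \<in> S\<close> Suc.prems])
  also have "\<dots> = measure_pmf.expectation (kpow K t z) (P f)"
    using absorbing_kpow[OF K_operator(1)] K_operator(2) \<open>z \<in> S\<close>
    by (intro expectation_cong_set_pmf) (auto simp: absorbing_def subset_iff)
  also have "\<dots> = (P ^^ t) (P f) z"
  proof (rule Suc.IH)
    show "\<bar>P f y\<bar> \<le> B" if "y \<in> S" for y
      using abs_expectation_le[of "K y" f B] K_operator that Suc.prems
      by (auto simp: absorbing_def subset_iff)
  qed
  finally show ?case by (simp add: funpow_swap1)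
qed simp

locale feller_kernel = compact_metrizable X e
    for X :: "'a::topological_space set" and e :: "'a \<Rightarrow> 'b::{metric_space, second_countable_topology}" +
  fixes K :: "'a \<Rightarrow> 'a pmf"
  assumes absorbing: "absorbing K X"
    and continuous_expectation:
      "continuous_on X f \<Longrightarrow> continuous_on X (\<lambda>z. measure_pmf.expectation (K z) (f :: 'a \<Rightarrow> real))"
begin

definition kernel :: "'a \<Rightarrow> 'a measure" where
  "kernel z = distr (measure_pmf (if z \<in> X then K z else return_pmf z)) borel (\<lambda>x. x)"

lemma sets_kernel [simp]: "sets (kernel z) = sets borel"
  by (simp add: kernel_def)

lemma prob_space_kernel: "prob_space (kernel z)"
  unfolding kernel_def by (intro measure_pmf.prob_space_distr) simp

lemma emeasure_kernel:
  "z \<in> X \<Longrightarrow> D \<in> sets borel \<Longrightarrow> emeasure (kernel z) D = emeasure (measure_pmf (K z)) D"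
  by (simp add: kernel_def emeasure_distr)

lemma emeasure_kernel_closed_measurable:
  assumes F: "closed F"
  shows "(\<lambda>z. emeasure (kernel z) F) \<in> borel_measurable borel"
proof -
  obtain g :: "nat \<Rightarrow> 'a \<Rightarrow> real" where g_approx: "\<And>n. continuous_on X (g n)" "\<And>n x. \<bar>g n x\<bar> \<le> 1"
      "\<And>x. x \<in> X \<Longrightarrow> (\<lambda>n. g n x) \<longlonglongrightarrow> indicator F x"
    using indicator_closed_approx[OF F] by blast
  define p where "p z = (if z \<in> X then measure_pmf.prob (K z) F else indicator F z)" for z
  have "p \<in> borel_measurable borel"
  proof (rule borel_measurable_LIMSEQ_real)
    let ?p = "\<lambda>n z. indicator X z *\<^sub>R measure_pmf.expectation (K z) (g n) + indicator (F - X) z"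
    have "(\<lambda>z. indicator X z *\<^sub>R measure_pmf.expectation (K z) (g n)) \<in> borel_measurable borel" for n
      using set_measurable_continuous_on[OF borel continuous_expectation[OF g_approx(1)]]
      by (simp add: set_borel_measurable_def)
    then show "?p n \<in> borel_measurable borel" for n
      by (intro borel_measurable_add borel_measurable_indicator sets.Diff borel borel_closed[OF F])
    fix z
    have "(\<lambda>n. measure_pmf.expectation (K z) (g n)) \<longlonglongrightarrow> measure_pmf.expectation (K z) (indicator F)"
      if "z \<in> X"
      by (rule integral_dominated_convergence[where w="\<lambda>_. 1"])
         (use g_approx absorbing that in \<open>auto simp: AE_measure_pmf_iff absorbing_def subset_iff\<close>)
    then show "(\<lambda>n. ?p n z) \<longlonglongrightarrow> p z"
      by (cases "z \<in> X") (simp_all add: p_def indicator_def)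
  qed
  moreover have "emeasure (kernel z) F = ennreal (p z)" for z
    using F by (simp add: p_def kernel_def emeasure_distr measure_pmf.emeasure_eq_measure indicator_def)
  ultimately show ?thesis by simp
qed

lemma kernel_measurable: "kernel \<in> measurable borel (subprob_algebra borel)"
proof (rule measurable_subprob_algebra_generated[where \<Omega>=UNIV and G="Collect closed"])
  show "sets borel = sigma_sets (UNIV :: 'a set) (Collect closed)" by (simp add: borel_eq_closed)
  show "Int_stable (Collect (closed :: 'a set \<Rightarrow> bool))" by (auto simp: Int_stable_def)
qed (auto intro: emeasure_kernel_closed_measurable prob_space_imp_subprob_space prob_space_kernel)

context
  fixes \<mu> :: "'a measure"
  assumes \<mu>: "borel_prob_on \<mu> X"
begin

interpretation borel_prob_on \<mu> X by (fact \<mu>)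

lemma kernel_measurable_on: "kernel \<in> measurable \<mu> (subprob_algebra borel)"
  using kernel_measurable measurable_cong_sets[OF sets_eq] by blast

lemma sets_bind_kernel: "sets (\<mu> \<bind> kernel) = sets borel"
  using sets_bind[OF sets_kernel not_empty] .

lemma emeasure_bind_kernel:
  assumes "D \<in> sets borel"
  shows "emeasure (\<mu> \<bind> kernel) D = (\<integral>\<^sup>+ z. emeasure (measure_pmf (K z)) D \<partial>\<mu>)"
proof -
  have "emeasure (\<mu> \<bind> kernel) D = (\<integral>\<^sup>+ z. emeasure (kernel z) D \<partial>\<mu>)"
    by (rule emeasure_bind[OF not_empty kernel_measurable_on assms])
  also have "\<dots> = (\<integral>\<^sup>+ z. emeasure (measure_pmf (K z)) D \<partial>\<mu>)"
    using AE_in_X by (intro nn_integral_cong_AE) (auto simp: emeasure_kernel assms)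
  finally show ?thesis .
qed

lemma borel_prob_on_bind_kernel: "borel_prob_on (\<mu> \<bind> kernel) X"
proof (intro borel_prob_on.intro borel_prob_on_axioms.intro)
  show "prob_space (\<mu> \<bind> kernel)"
    using prob_space_bind[OF AE_I2[OF prob_space_kernel] kernel_measurable_on] .
  have "AE z in \<mu>. emeasure (measure_pmf (K z)) X = 1"
    using AE_in_X absorbing
    by (auto simp: measure_pmf.emeasure_eq_1_AE AE_measure_pmf_iff absorbing_def subset_iff
        elim!: eventually_mono)
  then have "(\<integral>\<^sup>+ z. emeasure (measure_pmf (K z)) X \<partial>\<mu>) = (\<integral>\<^sup>+ z. 1 \<partial>\<mu>)"
    by (intro nn_integral_cong_AE) auto
  then show "emeasure (\<mu> \<bind> kernel) X = 1"
    using emeasure_bind_kernel[OF X_borel] emeasure_space_1 by simp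
qed (simp_all add: sets_bind_kernel compact borel)

lemma invariant_measure_iff_bind_kernel: "invariant_measure K \<mu> \<longleftrightarrow> \<mu> = \<mu> \<bind> kernel"
  unfolding invariant_measure_def using sets_bind_kernel sets_eq emeasure_bind_kernel
  by (metis (no_types, lifting) measure_eqI)

lemma set_integral_bind_kernel:
  fixes f :: "'a \<Rightarrow> real"
  assumes f: "continuous_on X f"
  shows "(LINT x:X|\<mu> \<bind> kernel. f x) = (LINT z:X|\<mu>. measure_pmf.expectation (K z) f)"
proof -
  define g where "g x = indicator X x *\<^sub>R f x" for x
  have g_borel: "g \<in> borel_measurable borel"
    using set_measurable_continuous_on[OF X_borel f] by (simp add: set_borel_measurable_def g_def[abs_def])
  obtain B where "0 \<le> B" "\<And>x. x \<in> X \<Longrightarrow> norm (f x) \<le> B"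
    using continuous_on_compact_bound[OF compact f] by blast
  then have g_le: "\<bar>g x\<bar> \<le> B" for x by (simp add: g_def indicator_def)
  have "(LINT x:X|\<mu> \<bind> kernel. f x) = integral\<^sup>L (\<mu> \<bind> kernel) g"
    by (simp add: set_lebesgue_integral_def g_def[abs_def])
  also have "\<dots> = (LINT z|\<mu>. integral\<^sup>L (kernel z) g)"
    using g_borel g_le kernel_measurable_on finite_measure_axioms
      prob_space.emeasure_space_1[OF prob_space_kernel]
    by (intro integral_bind[where K=borel and B=B and B'=1]) auto
  also have "\<dots> = (LINT z:X|\<mu>. integral\<^sup>L (kernel z) g)"
    using measurable_compose[OF kernel_measurable integral_measurable_subprob_algebra[OF g_borel]]
    by (rule integral_eq_set_integral)
  also have "\<dots> = (LINT z:X|\<mu>. measure_pmf.expectation (K z) g)"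
    using g_borel X_borel
    by (intro set_lebesgue_integral_cong) (simp_all add: sets_eq kernel_def integral_distr)
  also have "\<dots> = (LINT z:X|\<mu>. measure_pmf.expectation (K z) f)"
    using X_borel absorbing
    by (intro set_lebesgue_integral_cong)
       (auto simp: sets_eq absorbing_def subset_iff g_def intro!: expectation_cong_set_pmf)
  finally show ?thesis .
qed

lemma invariant_measure_iff:
  "invariant_measure K \<mu> \<longleftrightarrow>
     (\<forall>f::'a \<Rightarrow> real. continuous_on X f \<longrightarrow>
       (LINT z:X|\<mu>. measure_pmf.expectation (K z) f) = (LINT z:X|\<mu>. f z))"
proof (intro iffI allI impI)
  fix f :: "'a \<Rightarrow> real"
  assume inv: "invariant_measure K \<mu>" and f: "continuous_on X f"
  have "(LINT z:X|\<mu>. f z) = (LINT z:X|\<mu> \<bind> kernel. f z)"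
    using inv invariant_measure_iff_bind_kernel by simp
  then show "(LINT z:X|\<mu>. measure_pmf.expectation (K z) f) = (LINT z:X|\<mu>. f z)"
    by (simp add: set_integral_bind_kernel[OF f])
next
  assume "\<forall>f::'a \<Rightarrow> real. continuous_on X f \<longrightarrow>
      (LINT z:X|\<mu>. measure_pmf.expectation (K z) f) = (LINT z:X|\<mu>. f z)"
  then have "\<mu> = \<mu> \<bind> kernel"
    by (intro borel_prob_on_eqI \<mu> borel_prob_on_bind_kernel) (simp add: set_integral_bind_kernel)
  then show "invariant_measure K \<mu>" using invariant_measure_iff_bind_kernel by blast
qed

end

definition cesaro :: "'a \<Rightarrow> nat \<Rightarrow> 'a pmf" where
  "cesaro z n = pmf_of_set {..n} \<bind> (\<lambda>t. kpow K t z)"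

lemma set_pmf_cesaro: "z \<in> X \<Longrightarrow> set_pmf (cesaro z n) \<subseteq> X"
  using absorbing_kpow[OF absorbing] by (auto simp: cesaro_def absorbing_def)

lemma expectation_cesaro:
  fixes f :: "'a \<Rightarrow> real"
  assumes "z \<in> X" "\<And>y. y \<in> X \<Longrightarrow> \<bar>f y\<bar> \<le> B"
  shows "measure_pmf.expectation (cesaro z n) f = (\<Sum>t\<le>n. measure_pmf.expectation (kpow K t z) f) / Suc n"
proof -
  have "measure_pmf.expectation (cesaro z n) f =
      measure_pmf.expectation (pmf_of_set {..n}) (\<lambda>t. measure_pmf.expectation (kpow K t z) f)"
    unfolding cesaro_def using set_pmf_cesaro[OF assms(1), of n] assms(2)
    by (intro expectation_bind_pmf[where B=B]) (auto simp: cesaro_def)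
  then show ?thesis by (simp add: integral_pmf_of_set)
qed

lemma cesaro_almost_invariant:
  fixes f :: "'a \<Rightarrow> real"
  assumes z: "z \<in> X" and f_bound: "\<And>y. y \<in> X \<Longrightarrow> \<bar>f y\<bar> \<le> B"
  shows "\<bar>measure_pmf.expectation (cesaro z n) (\<lambda>y. measure_pmf.expectation (K y) f)
    - measure_pmf.expectation (cesaro z n) f\<bar> \<le> 2 * B / Suc n"
proof -
  define e where "e t = measure_pmf.expectation (kpow K t z) f" for t
  have bound: "\<bar>e t\<bar> \<le> B" for t
    unfolding e_def
    using absorbing_kpow[OF absorbing] z f_bound unfolding absorbing_def by (intro abs_expectation_le) blast
  have "\<bar>measure_pmf.expectation (K y) f\<bar> \<le> B" if "y \<in> X" for y
    using absorbing that f_bound unfolding absorbing_def by (intro abs_expectation_le) blast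
  from expectation_cesaro[OF z this]
  have "measure_pmf.expectation (cesaro z n) (\<lambda>y. measure_pmf.expectation (K y) f)
      = (\<Sum>t\<le>n. measure_pmf.expectation (kpow K t z) (\<lambda>y. measure_pmf.expectation (K y) f)) / Suc n" .
  also have "\<dots> = (\<Sum>t\<le>n. e (Suc t)) / Suc n"
    using expectation_kpow_Suc[OF absorbing z, where f=f and B=B] f_bound by (simp only: e_def)
  finally have "measure_pmf.expectation (cesaro z n) (\<lambda>y. measure_pmf.expectation (K y) f)
      - measure_pmf.expectation (cesaro z n) f = (\<Sum>t\<le>n. e (Suc t) - e t) / Suc n"
    using expectation_cesaro[OF z, where f=f and B=B] f_bound
    by (simp only: e_def sum_subtractf diff_divide_distrib)
  also have "\<dots> = (e (Suc n) - e 0) / Suc n"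
    using sum_lessThan_telescope[of e "Suc n"] by (simp only: lessThan_Suc_atMost)
  finally show ?thesis
    using bound[of "Suc n"] bound[of 0] by (simp add: divide_right_mono)
qed

theorem invariant_measure_exists:
  assumes "X \<noteq> {}"
  obtains \<mu> where "borel_prob_on \<mu> X" "invariant_measure K \<mu>"
proof -
  obtain z where z: "z \<in> X" using assms by blast
  obtain r \<mu> where r: "strict_mono r" and \<mu>: "borel_prob_on \<mu> X"
    and lim: "\<And>f::'a \<Rightarrow> real. continuous_on X f \<Longrightarrow>
       (\<lambda>n. measure_pmf.expectation (cesaro z (r n)) f) \<longlonglongrightarrow> (LINT x:X|\<mu>. f x)"
    by (rule compact_weak_subsequence[OF set_pmf_cesaro[OF z]]) (rule that)
  have "(LINT z:X|\<mu>. measure_pmf.expectation (K z) f) = (LINT z:X|\<mu>. f z)"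
    if f: "continuous_on X f" for f :: "'a \<Rightarrow> real"
  proof -
    obtain B where B_bound: "\<And>x. x \<in> X \<Longrightarrow> \<bar>f x\<bar> \<le> B"
      using continuous_on_compact_bound[OF compact f] by (metis real_norm_def)
    let ?d = "\<lambda>n. measure_pmf.expectation (cesaro z n) (\<lambda>y. measure_pmf.expectation (K y) f)
      - measure_pmf.expectation (cesaro z n) f"
    have "?d \<longlonglongrightarrow> 0"
    proof (rule Lim_null_comparison)
      show "\<forall>\<^sub>F n in sequentially. norm (?d n) \<le> 2 * B * inverse (Suc n)"
        using cesaro_almost_invariant[OF z, where f=f and B=B] B_bound by (simp add: divide_inverse)
      show "(\<lambda>n. 2 * B * inverse (Suc n)) \<longlonglongrightarrow> 0"
        by (rule tendsto_mult_right_zero[OF LIMSEQ_inverse_real_of_nat])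
    qed
    from LIMSEQ_subseq_LIMSEQ[OF this r] have "(\<lambda>n. ?d (r n)) \<longlonglongrightarrow> 0" by (simp add: o_def)
    moreover have "(\<lambda>n. ?d (r n)) \<longlonglongrightarrow> (LINT z:X|\<mu>. measure_pmf.expectation (K z) f) - (LINT z:X|\<mu>. f z)"
      by (intro tendsto_diff lim f continuous_expectation)
    ultimately show ?thesis using LIMSEQ_unique by fastforce
  qed
  then have "invariant_measure K \<mu>" using invariant_measure_iff[OF \<mu>] by blast
  then show thesis using that \<mu> by blast
qed

end

section \<open>Stationary distributions of finite Markov chains\<close>

definition prob_vectors :: "'a set \<Rightarrow> ('a \<Rightarrow> real) set" where
  "prob_vectors S = {p. (\<forall>s. 0 \<le> p s) \<and> (\<forall>s. s \<notin> S \<longrightarrow> p s = 0) \<and> sum p S = 1}"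

lemma prob_vectors_le_1:
  assumes "finite S" "p \<in> prob_vectors S"
  shows "p s \<le> 1"
proof (cases "s \<in> S")
  case True
  then have "p s \<le> sum p S"
    using assms by (intro member_le_sum) (auto simp: prob_vectors_def)
  then show ?thesis using assms by (simp add: prob_vectors_def)
qed (use assms in \<open>simp add: prob_vectors_def\<close>)

lemma compact_prob_vectors:
  assumes "finite S"
  shows "compact (prob_vectors S)"
proof -
  have "prob_vectors S = PiE UNIV (\<lambda>_. {0..1}) \<inter> ((\<Inter>s\<in>- S. {p. p s = 0}) \<inter> {p. sum p S = 1})"
    using prob_vectors_le_1[OF assms] by (auto simp: prob_vectors_def PiE_iff)
  also have "compact \<dots>"
    by (intro compact_Int_closed compact_PiE_UNIV closed_Int closed_INT ballI closed_Collect_eq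
        continuous_on_sum continuous_on_product_coordinates continuous_on_const compact_Icc)
  finally show ?thesis .
qed

locale finite_markov_chain =
  fixes S :: "'a set" and M :: "'a \<Rightarrow> 'a \<Rightarrow> real"
  assumes finite_S: "finite S"
    and nonneg: "s \<in> S \<Longrightarrow> s' \<in> S \<Longrightarrow> 0 \<le> M s s'"
    and row_sum: "s \<in> S \<Longrightarrow> (\<Sum>s'\<in>S. M s s') = 1"
begin

definition left_invariant :: "('a \<Rightarrow> real) \<Rightarrow> bool" where
  "left_invariant v \<longleftrightarrow> (\<forall>s'\<in>S. (\<Sum>s\<in>S. v s * M s s') = v s')"

definition stationary :: "('a \<Rightarrow> real) \<Rightarrow> bool" where
  "stationary p \<longleftrightarrow> p \<in> prob_vectors S \<and> left_invariant p"

definition defect :: "('a \<Rightarrow> real) \<Rightarrow> real" where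
  "defect v = (\<Sum>s'\<in>S. \<bar>(\<Sum>s\<in>S. v s * M s s') - v s'\<bar>)"

lemma defect_eq_0_iff: "defect v = 0 \<longleftrightarrow> left_invariant v"
  using finite_S by (auto simp: defect_def left_invariant_def sum_nonneg_eq_0_iff)

lemma continuous_on_defect: "continuous_on T defect"
  unfolding defect_def
  by (intro continuous_on_sum continuous_on_rabs continuous_on_diff continuous_on_mult continuous_on_const
      continuous_on_subset[OF continuous_on_product_coordinates]) auto

lemma stationary_exists:
  assumes "F \<noteq> bot" "\<forall>\<^sub>F l in F. p l \<in> prob_vectors S" "((\<lambda>l. defect (p l)) \<longlongrightarrow> 0) F"
  obtains q where "stationary q"
proof -
  have "prob_vectors S \<noteq> {}" using eventually_happens'[OF assms(1,2)] by blast
  then obtain q where q_min: "q \<in> prob_vectors S" "\<And>p. p \<in> prob_vectors S \<Longrightarrow> defect q \<le> defect p"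
    using continuous_attains_inf[OF compact_prob_vectors[OF finite_S] _ continuous_on_defect] by blast
  have "\<forall>\<^sub>F l in F. defect q \<le> defect (p l)"
    using assms(2) by eventually_elim (rule q_min(2))
  then have "defect q \<le> 0" using assms(1,3) by (intro tendsto_lowerbound)
  moreover have "0 \<le> defect q" unfolding defect_def by (simp add: sum_nonneg)
  ultimately have "stationary q" using q_min(1) defect_eq_0_iff[of q] by (simp add: stationary_def)
  then show thesis by (rule that)
qed

lemma left_invariant_diff:
  "left_invariant v \<Longrightarrow> left_invariant w \<Longrightarrow> left_invariant (\<lambda>s. v s - w s)"
  by (simp add: left_invariant_def left_diff_distrib sum_subtractf)

text \<open>The positive part can only gain mass under the chain, but the total mass is preserved.\<close>
lemma left_invariant_positive_part:
  assumes v: "left_invariant v"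
  shows "left_invariant (\<lambda>s. max 0 (v s))"
proof -
  let ?w = "\<lambda>s'. \<Sum>s\<in>S. max 0 (v s) * M s s'"
  have gain: "max 0 (v s') \<le> ?w s'" if "s' \<in> S" for s'
  proof -
    have "v s' = (\<Sum>s\<in>S. v s * M s s')" using v that by (simp add: left_invariant_def)
    also have "\<dots> \<le> ?w s'" using that by (intro sum_mono mult_right_mono) (auto simp: nonneg)
    finally show ?thesis using that by (auto intro!: sum_nonneg mult_nonneg_nonneg simp: nonneg)
  qed
  have "(\<Sum>s'\<in>S. ?w s') = (\<Sum>s\<in>S. max 0 (v s) * (\<Sum>s'\<in>S. M s s'))"
    unfolding sum_distrib_left by (rule sum.swap)
  also have "\<dots> = (\<Sum>s\<in>S. max 0 (v s))" by (intro sum.cong) (auto simp: row_sum)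
  finally have "(\<Sum>s'\<in>S. ?w s' - max 0 (v s')) = 0" by (simp add: sum_subtractf)
  then have "\<forall>s'\<in>S. ?w s' - max 0 (v s') = 0"
    using gain finite_S by (subst (asm) sum_nonneg_eq_0_iff) auto
  then show ?thesis by (simp add: left_invariant_def)
qed

end

locale irreducible_markov_chain = finite_markov_chain +
  assumes irreducible: "s \<in> S \<Longrightarrow> s' \<in> S \<Longrightarrow> (s, s') \<in> {(r, r'). r \<in> S \<and> r' \<in> S \<and> 0 < M r r'}\<^sup>*"
begin

lemma left_invariant_pos:
  assumes w_invariant: "left_invariant w" "\<And>s. s \<in> S \<Longrightarrow> 0 \<le> w s" and s_pos: "s \<in> S" "0 < w s" and s': "s' \<in> S"
  shows "0 < w s'"
  using irreducible[OF s_pos(1) s']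
proof (induction rule: rtrancl_induct)
  case base
  then show ?case by (rule s_pos(2))
next
  case (step r r')
  then have r: "r \<in> S" "r' \<in> S" "0 < M r r'" by auto
  with step.IH have "0 < w r * M r r'" by simp
  also have "\<dots> \<le> (\<Sum>s\<in>S. w s * M s r')"
    using r w_invariant(2) nonneg finite_S by (intro member_le_sum[of r S "\<lambda>s. w s * M s r'"]) auto
  also have "\<dots> = w r'" using w_invariant(1) r by (simp add: left_invariant_def)
  finally show ?case .
qed

lemma stationary_unique:
  assumes "stationary p" "stationary q"
  shows "p = q"
proof -
  have dominated: "p s \<le> q s" if p: "stationary p" and q: "stationary q" and s: "s \<in> S" for p q s
  proof (rule ccontr)
    assume "\<not> p s \<le> q s"
    then have pos: "0 < max 0 (p s - q s)" by simp
    have "left_invariant (\<lambda>s. max 0 (p s - q s))"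
      using p q by (intro left_invariant_positive_part left_invariant_diff) (auto simp: stationary_def)
    then have "0 < max 0 (p s' - q s')" if "s' \<in> S" for s'
      using left_invariant_pos[where w="\<lambda>s. max 0 (p s - q s)", OF _ _ s pos that] by simp
    then have "sum q S < sum p S"
      using finite_S s by (intro sum_strict_mono) (auto simp: less_max_iff_disj)
    then show False using p q by (simp add: stationary_def prob_vectors_def)
  qed
  have "p s = q s" for s
    using dominated[OF assms] dominated[OF assms(2,1)] assms
    by (cases "s \<in> S") (auto simp: stationary_def prob_vectors_def intro: antisym)
  then show ?thesis by auto
qed

lemma tendsto_stationary:
  assumes "stationary q" "\<forall>\<^sub>F l in F. p l \<in> prob_vectors S" "((\<lambda>l. defect (p l)) \<longlongrightarrow> 0) F"
  shows "((\<lambda>l. p l s) \<longlongrightarrow> q s) F"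
proof -
  have "(p \<longlongrightarrow> q) F"
  proof (rule tendsto_if_zero_unique)
    show "compact (prob_vectors S)" using finite_S by (rule compact_prob_vectors)
    show "continuous_on (prob_vectors S) defect" by (rule continuous_on_defect)
    show "v = q" if "v \<in> prob_vectors S" "defect v = 0" for v
      using that assms(1) by (intro stationary_unique) (simp add: stationary_def defect_eq_0_iff)
  qed (rule assms)+
  then show ?thesis
    by (rule continuous_on_tendsto_compose[OF continuous_on_product_coordinates]) auto
qed

end

section \<open>Markov operators\<close>

locale markov_operator =
  fixes S :: "'a set" and P :: "('a \<Rightarrow> real) \<Rightarrow> 'a \<Rightarrow> real"
  assumes add: "z \<in> S \<Longrightarrow> P (\<lambda>y. f y + g y) z = P f z + P g z"
    and cmult: "z \<in> S \<Longrightarrow> P (\<lambda>y. c * f y) z = c * P f z"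
    and one: "z \<in> S \<Longrightarrow> P (\<lambda>_. 1) z = 1"
    and nonneg: "z \<in> S \<Longrightarrow> (\<And>y. y \<in> S \<Longrightarrow> 0 \<le> f y) \<Longrightarrow> 0 \<le> P f z"
begin

lemma const: "z \<in> S \<Longrightarrow> P (\<lambda>_. c) z = c"
  using cmult[of z c "\<lambda>_. 1"] one by simp

lemma diff: "z \<in> S \<Longrightarrow> P (\<lambda>y. f y - g y) z = P f z - P g z"
  using add[of z f "\<lambda>y. - 1 * g y"] cmult[of z "- 1" g] by simp

lemma sum: "z \<in> S \<Longrightarrow> P (\<lambda>y. \<Sum>k\<in>I. f k y) z = (\<Sum>k\<in>I. P (f k) z)"
  by (induction I rule: infinite_finite_induct) (simp_all add: const add)

lemma mono: "z \<in> S \<Longrightarrow> (\<And>y. y \<in> S \<Longrightarrow> f y \<le> g y) \<Longrightarrow> P f z \<le> P g z"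
  using nonneg[of z "\<lambda>y. g y - f y"] diff[of z g f] by simp

lemma cong: "z \<in> S \<Longrightarrow> (\<And>y. y \<in> S \<Longrightarrow> f y = g y) \<Longrightarrow> P f z = P g z"
  by (intro antisym mono) auto

lemma abs_le:
  assumes "z \<in> S"
  shows "\<bar>P f z\<bar> \<le> P (\<lambda>y. \<bar>f y\<bar>) z"
proof -
  have "P f z \<le> P (\<lambda>y. \<bar>f y\<bar>) z" "P (\<lambda>y. - 1 * \<bar>f y\<bar>) z \<le> P f z"
    using assms by (auto intro: mono)
  then show ?thesis unfolding cmult[OF assms] by simp
qed

lemma bound: "z \<in> S \<Longrightarrow> (\<And>y. y \<in> S \<Longrightarrow> \<bar>f y\<bar> \<le> B) \<Longrightarrow> \<bar>P f z\<bar> \<le> B"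
  using abs_le[of z f] mono[of z "\<lambda>y. \<bar>f y\<bar>" "\<lambda>_. B"] const[of z B] by simp

lemma funpow: "markov_operator S (P ^^ t)"
proof (induction t)
  case 0
  show ?case by unfold_locales simp_all
next
  case (Suc t)
  then interpret Pt: markov_operator S "P ^^ t" .
  show ?case
  proof
    fix z f g assume z: "z \<in> S"
    show "(P ^^ Suc t) (\<lambda>y. f y + g y) z = (P ^^ Suc t) f z + (P ^^ Suc t) g z"
      using cong[OF z Pt.add] add[OF z] by simp
    show "(P ^^ Suc t) (\<lambda>y. c * f y) z = c * (P ^^ Suc t) f z" for c
      using cong[OF z Pt.cmult] cmult[OF z] by simp
    show "(P ^^ Suc t) (\<lambda>_. 1) z = 1"
      using cong[OF z Pt.one] one[OF z] by simp
    show "0 \<le> (P ^^ Suc t) f z" if "\<And>y. y \<in> S \<Longrightarrow> 0 \<le> f y"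
      using that nonneg[OF z Pt.nonneg] by simp
  qed
qed

definition harmonic :: "('a \<Rightarrow> real) \<Rightarrow> bool" where
  "harmonic h \<longleftrightarrow> (\<forall>z\<in>S. P h z = h z)"

lemma harmonic_funpow: "harmonic h \<Longrightarrow> z \<in> S \<Longrightarrow> (P ^^ t) h z = h z"
proof (induction t)
  case (Suc t)
  then show ?case
    using markov_operator.cong[OF funpow, of z "P h" h t] by (simp add: harmonic_def funpow_swap1)
qed simp

lemma harmonic_diff: "harmonic f \<Longrightarrow> harmonic g \<Longrightarrow> harmonic (\<lambda>z. f z - g z)"
  by (simp add: harmonic_def diff)

lemma harmonic_sum_cmult: "(\<And>k. k \<in> I \<Longrightarrow> harmonic (f k)) \<Longrightarrow> harmonic (\<lambda>z. \<Sum>k\<in>I. c k * f k z)"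
  by (simp add: harmonic_def sum cmult)

end

lemma markov_operator_mixture:
  fixes P :: "'k \<Rightarrow> ('a \<Rightarrow> real) \<Rightarrow> 'a \<Rightarrow> real"
  assumes "\<And>k. k \<in> I \<Longrightarrow> markov_operator S (P k)" "\<And>k. k \<in> I \<Longrightarrow> 0 \<le> w k" "sum w I = 1"
  shows "markov_operator S (\<lambda>f z. \<Sum>k\<in>I. w k * P k f z)"
proof
  fix z f g assume z: "z \<in> S"
  note markov = assms(1)[THEN markov_operator.add[OF _ z]] assms(1)[THEN markov_operator.cmult[OF _ z]]
    assms(1)[THEN markov_operator.one[OF _ z]]
  show "(\<Sum>k\<in>I. w k * P k (\<lambda>y. f y + g y) z) = (\<Sum>k\<in>I. w k * P k f z) + (\<Sum>k\<in>I. w k * P k g z)"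
    by (simp add: markov distrib_left sum.distrib)
  show "(\<Sum>k\<in>I. w k * P k (\<lambda>y. c * f y) z) = c * (\<Sum>k\<in>I. w k * P k f z)" for c
    by (simp add: markov sum_distrib_left mult.left_commute)
  show "(\<Sum>k\<in>I. w k * P k (\<lambda>_. 1) z) = 1"
    using assms(3) by (simp add: markov)
  show "0 \<le> (\<Sum>k\<in>I. w k * P k f z)" if "\<And>y. y \<in> S \<Longrightarrow> 0 \<le> f y"
    using that assms(2) markov_operator.nonneg[OF assms(1) z, of _ f]
    by (intro sum_nonneg mult_nonneg_nonneg) auto
qed

section \<open>Perturbed learning automata\<close>

lemma prob_simplex_eq_prob_vectors: "prob_simplex = prob_vectors"
  by (simp add: prob_simplex_def prob_vectors_def fun_eq_iff)

locale pla =
  fixes A :: "'i::finite \<Rightarrow> nat set"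
    and u :: "'i \<Rightarrow> ('i \<Rightarrow> nat) \<Rightarrow> real"
    and \<epsilon> :: real
  assumes finite_actions [simp]: "\<And>i. finite (A i)"
    and actions_nonempty [simp]: "\<And>i. A i \<noteq> {}"
    and step_pos: "\<And>i \<alpha>. (\<And>j. \<alpha> j \<in> A j) \<Longrightarrow> 0 < \<epsilon> * u i \<alpha>"
    and step_less_1: "\<And>i \<alpha>. (\<And>j. \<alpha> j \<in> A j) \<Longrightarrow> \<epsilon> * u i \<alpha> < 1"
begin

definition profiles :: "('i \<Rightarrow> nat) set" where
  "profiles = {\<alpha>. \<forall>i. \<alpha> i \<in> A i}"

definition strategies :: "('i \<Rightarrow> nat \<Rightarrow> real) set" where
  "strategies = {x. \<forall>i. x i \<in> prob_simplex (A i)}"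

abbreviation update :: "('i \<Rightarrow> nat \<Rightarrow> real) \<Rightarrow> ('i \<Rightarrow> nat) \<Rightarrow> 'i state" where
  "update \<equiv> la_update \<epsilon> u"

lemma profiles_eq_PiE: "profiles = PiE UNIV A"
  by (auto simp: profiles_def PiE_def)

lemma finite_profiles [simp]: "finite profiles"
  unfolding profiles_eq_PiE by (rule finite_PiE) auto

lemma profiles_nonempty: "profiles \<noteq> {}"
  unfolding profiles_eq_PiE by (simp add: PiE_eq_empty_iff)

lemma profilesD: "\<alpha> \<in> profiles \<Longrightarrow> \<alpha> i \<in> A i"
  by (simp add: profiles_def)

lemma step_bounds: "\<alpha> \<in> profiles \<Longrightarrow> 0 < \<epsilon> * u i \<alpha>" "\<alpha> \<in> profiles \<Longrightarrow> \<epsilon> * u i \<alpha> < 1"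
  using step_pos step_less_1 by (auto simp: profiles_def)

lemma states_eq: "states A = profiles \<times> strategies"
  by (auto simp: states_def profiles_def strategies_def)

lemma snd_states: "z \<in> states A \<Longrightarrow> snd z \<in> strategies"
  by (auto simp: states_eq)

lemma strategiesD:
  assumes "x \<in> strategies"
  shows "0 \<le> x i a" "x i a \<le> 1" "a \<notin> A i \<Longrightarrow> x i a = 0" "sum (x i) (A i) = 1"
  using assms prob_vectors_le_1[of "A i" "x i"]
  by (auto simp: strategies_def prob_simplex_eq_prob_vectors prob_vectors_def)

lemma strategiesI:
  assumes "\<And>i a. 0 \<le> x i a" "\<And>i a. a \<notin> A i \<Longrightarrow> x i a = 0" "\<And>i. sum (x i) (A i) = 1"
  shows "x \<in> strategies"
  using assms by (simp add: strategies_def prob_simplex_def)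

lemma card_actions_pos: "0 < real (card (A i))"
  by (simp add: card_gt_0_iff)

lemma compact_states: "compact (states A)"
proof -
  have "strategies = PiE UNIV (\<lambda>i. prob_vectors (A i))"
    by (auto simp: strategies_def prob_simplex_eq_prob_vectors PiE_def)
  then have "compact strategies"
    by (simp add: compact_PiE_UNIV compact_prob_vectors)
  then show ?thesis
    unfolding states_eq by (rule compact_Times[OF finite_imp_compact[OF finite_profiles]])
qed

lemma fst_update [simp]: "fst (update x \<alpha>) = \<alpha>"
  by (simp add: la_update_def)

lemma update_minus_unitv:
  "snd (update x \<alpha>) i a - unitv (\<alpha> i) a = (1 - \<epsilon> * u i \<alpha>) * (x i a - unitv (\<alpha> i) a)"
  by (simp add: la_update_def algebra_simps)

lemma update_states:
  assumes x: "x \<in> strategies" and \<alpha>: "\<alpha> \<in> profiles"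
  shows "update x \<alpha> \<in> states A"
proof -
  have convex: "snd (update x \<alpha>) i a = (1 - \<epsilon> * u i \<alpha>) * x i a + \<epsilon> * u i \<alpha> * unitv (\<alpha> i) a" for i a
    by (simp add: la_update_def algebra_simps)
  have "snd (update x \<alpha>) \<in> strategies"
  proof (rule strategiesI)
    show "0 \<le> snd (update x \<alpha>) i a" for i a
      using step_bounds[OF \<alpha>, of i] strategiesD[OF x] by (simp add: convex unitv_def)
    show "snd (update x \<alpha>) i a = 0" if "a \<notin> A i" for i a
      using that profilesD[OF \<alpha>] strategiesD[OF x] by (auto simp: convex unitv_def)
    show "sum (snd (update x \<alpha>) i) (A i) = 1" for i
      using strategiesD[OF x] profilesD[OF \<alpha>, of i]
      by (simp add: convex sum.distrib unitv_def flip: sum_distrib_left)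
  qed
  then show ?thesis using \<alpha> by (simp add: states_eq la_update_def)
qed

lemma continuous_on_strategy: "continuous_on S (\<lambda>z::'i state. snd z i a)"
  using continuous_on_product_then_coordinatewise[OF continuous_on_product_then_coordinatewise[OF
      continuous_on_snd[OF continuous_on_id]]] .

lemma continuous_on_update: "continuous_on S (\<lambda>z::'i state. update (snd z) \<alpha>)"
  unfolding la_update_def
  by (intro continuous_on_Pair continuous_on_const continuous_on_coordinatewise_then_product
      continuous_on_add continuous_on_mult continuous_on_diff continuous_on_strategy)

subsection \<open>Transition operators\<close>

definition tremble :: "'i set \<Rightarrow> ('i \<Rightarrow> nat \<Rightarrow> real) \<Rightarrow> 'i \<Rightarrow> nat \<Rightarrow> real" where
  "tremble J x i a = (if i \<in> J then indicator (A i) a / card (A i) else x i a)"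

definition play_prob :: "'i set \<Rightarrow> ('i \<Rightarrow> nat \<Rightarrow> real) \<Rightarrow> ('i \<Rightarrow> nat) \<Rightarrow> real" where
  "play_prob J x \<alpha> = (\<Prod>i\<in>UNIV. tremble J x i (\<alpha> i))"

definition step :: "'i set \<Rightarrow> ('i state \<Rightarrow> real) \<Rightarrow> 'i state \<Rightarrow> real" where
  "step J f z = (\<Sum>\<alpha>\<in>profiles. play_prob J (snd z) \<alpha> * f (update (snd z) \<alpha>))"

abbreviation P :: "('i state \<Rightarrow> real) \<Rightarrow> 'i state \<Rightarrow> real" where
  "P \<equiv> step {}"

definition Q :: "('i state \<Rightarrow> real) \<Rightarrow> 'i state \<Rightarrow> real" where
  "Q f z = (\<Sum>j\<in>UNIV. 1 / CARD('i) * step {j} f z)"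

definition T :: "real \<Rightarrow> ('i state \<Rightarrow> real) \<Rightarrow> 'i state \<Rightarrow> real" where
  "T l f z = (\<Sum>J\<in>UNIV. l ^ card J * (1 - l) ^ card (- J) * step J f z)"

lemma tremble_empty [simp]: "tremble {} x = x"
  by (simp add: tremble_def fun_eq_iff)

lemma play_prob_empty: "play_prob {} x \<alpha> = (\<Prod>i\<in>UNIV. x i (\<alpha> i))"
  by (simp add: play_prob_def)

lemma tremble_strategies:
  assumes "x \<in> strategies"
  shows "tremble J x \<in> strategies"
proof (rule strategiesI)
  show "sum (tremble J x i) (A i) = 1" for i
    using strategiesD[OF assms] card_actions_pos[of i] by (cases "i \<in> J") (auto simp: tremble_def)
qed (use strategiesD[OF assms] in \<open>auto simp: tremble_def\<close>)

lemma play_prob_nonneg: "x \<in> strategies \<Longrightarrow> 0 \<le> play_prob J x \<alpha>"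
  unfolding play_prob_def by (intro prod_nonneg ballI strategiesD tremble_strategies)

lemma play_prob_le_1: "x \<in> strategies \<Longrightarrow> play_prob J x \<alpha> \<le> 1"
  unfolding play_prob_def by (intro prod_le_1 ballI conjI strategiesD tremble_strategies)

lemma sum_play_prob:
  assumes "x \<in> strategies"
  shows "(\<Sum>\<alpha>\<in>profiles. play_prob J x \<alpha>) = 1"
proof -
  have "(\<Sum>\<alpha>\<in>profiles. play_prob J x \<alpha>) = (\<Prod>i\<in>UNIV. \<Sum>a\<in>A i. tremble J x i a)"
    unfolding profiles_eq_PiE play_prob_def by (rule prod_sum_PiE[symmetric]) auto
  then show ?thesis using strategiesD[OF tremble_strategies[OF assms]] by simp
qed

sublocale step: markov_operator "states A" "step J" for J
proof
  fix z f g assume "z \<in> states A"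
  then have x: "snd z \<in> strategies" by (rule snd_states)
  show "step J (\<lambda>y. f y + g y) z = step J f z + step J g z"
    by (simp add: step_def distrib_left sum.distrib)
  show "step J (\<lambda>y. c * f y) z = c * step J f z" for c
    by (simp add: step_def sum_distrib_left mult.left_commute)
  show "step J (\<lambda>_. 1) z = 1"
    by (simp add: step_def sum_play_prob[OF x])
  show "0 \<le> step J f z" if "\<And>y. y \<in> states A \<Longrightarrow> 0 \<le> f y"
    unfolding step_def by (intro sum_nonneg mult_nonneg_nonneg play_prob_nonneg that update_states x)
qed

sublocale iterate: markov_operator "states A" "P ^^ t" for t
  by (rule step.funpow)

sublocale Q: markov_operator "states A" Q
  unfolding Q_def by (rule markov_operator_mixture) (simp_all add: step.markov_operator_axioms)

lemma step_ge_single: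
  assumes "z \<in> states A" "\<And>y. y \<in> states A \<Longrightarrow> 0 \<le> f y" "\<alpha> \<in> profiles"
  shows "play_prob J (snd z) \<alpha> * f (update (snd z) \<alpha>) \<le> step J f z"
  unfolding step_def using assms
  by (intro member_le_sum) (auto simp: update_states play_prob_nonneg snd_states)

lemma continuous_on_step:
  assumes "continuous_on (states A) f"
  shows "continuous_on (states A) (step J f)"
proof -
  have "continuous_on (states A) (\<lambda>z. tremble J (snd z) i a)" for i a
    by (cases "i \<in> J") (simp_all add: tremble_def continuous_on_strategy)
  moreover have "continuous_on (states A) (\<lambda>z. f (update (snd z) \<alpha>))" if "\<alpha> \<in> profiles" for \<alpha>
    using that
    by (intro continuous_on_compose2[OF assms continuous_on_update] image_subsetI update_states snd_states)
  ultimately have "continuous_on (states A) (\<lambda>z. step J f z)"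
    unfolding step_def play_prob_def by (intro continuous_on_sum continuous_on_mult continuous_on_prod)
  then show ?thesis by simp
qed

lemma continuous_on_iterate: "continuous_on (states A) f \<Longrightarrow> continuous_on (states A) ((P ^^ t) f)"
  by (induction t) (simp_all add: continuous_on_step)

lemma continuous_on_Q: "continuous_on (states A) f \<Longrightarrow> continuous_on (states A) (Q f)"
  unfolding Q_def[abs_def]
  by (intro continuous_on_sum continuous_on_mult continuous_on_const continuous_on_step)

lemma continuous_on_T: "continuous_on (states A) f \<Longrightarrow> continuous_on (states A) (T l f)"
  unfolding T_def[abs_def]
  by (intro continuous_on_sum continuous_on_mult continuous_on_const continuous_on_step)

subsection \<open>Playing one profile forever\<close>

definition replay :: "('i \<Rightarrow> nat) \<Rightarrow> nat \<Rightarrow> 'i state \<Rightarrow> 'i state" where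
  "replay \<alpha> m = (\<lambda>z. update (snd z) \<alpha>) ^^ m"

definition replay_prob :: "('i \<Rightarrow> nat) \<Rightarrow> nat \<Rightarrow> 'i state \<Rightarrow> real" where
  "replay_prob \<alpha> m z = (\<Prod>t<m. play_prob {} (snd (replay \<alpha> t z)) \<alpha>)"

definition gap :: "('i \<Rightarrow> nat) \<Rightarrow> 'i state \<Rightarrow> real" where
  "gap \<alpha> z = (\<Sum>i\<in>UNIV. 1 - snd z i (\<alpha> i))"

definition rate :: real where
  "rate = Max ((\<lambda>(i, \<alpha>). 1 - \<epsilon> * u i \<alpha>) ` (UNIV \<times> profiles))"

definition pure :: "('i \<Rightarrow> nat) \<Rightarrow> 'i state" where
  "pure \<alpha> = (\<alpha>, \<lambda>i. unitv (\<alpha> i))"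

lemma replay_0 [simp]: "replay \<alpha> 0 z = z"
  by (simp add: replay_def)

lemma replay_Suc: "replay \<alpha> (Suc m) z = update (snd (replay \<alpha> m z)) \<alpha>"
  by (simp add: replay_def)

lemma replay_Suc_shift: "replay \<alpha> (Suc m) z = replay \<alpha> m (update (snd z) \<alpha>)"
  by (simp add: replay_def funpow_Suc_right del: funpow.simps)

lemma replay_add: "replay \<alpha> (m + n) z = replay \<alpha> n (replay \<alpha> m z)"
  by (subst add.commute) (simp add: replay_def funpow_add)

lemma replay_states: "\<alpha> \<in> profiles \<Longrightarrow> z \<in> states A \<Longrightarrow> replay \<alpha> m z \<in> states A"
  by (induction m) (auto simp: replay_Suc update_states snd_states)

lemma replay_prob_Suc_shift:
  "replay_prob \<alpha> (Suc m) z = play_prob {} (snd z) \<alpha> * replay_prob \<alpha> m (update (snd z) \<alpha>)"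
  by (simp add: replay_prob_def prod.lessThan_Suc_shift replay_Suc_shift del: prod.lessThan_Suc)

lemma replay_prob_add: "replay_prob \<alpha> (m + n) z = replay_prob \<alpha> m z * replay_prob \<alpha> n (replay \<alpha> m z)"
proof (induction m arbitrary: z)
  case 0
  show ?case by (simp add: replay_prob_def[where m=0])
next
  case (Suc m)
  then show ?case by (simp add: replay_prob_Suc_shift replay_Suc_shift)
qed

lemma replay_prob_nonneg: "\<alpha> \<in> profiles \<Longrightarrow> z \<in> states A \<Longrightarrow> 0 \<le> replay_prob \<alpha> m z"
  unfolding replay_prob_def by (intro prod_nonneg ballI play_prob_nonneg snd_states replay_states)

lemma replay_prob_le_1: "\<alpha> \<in> profiles \<Longrightarrow> z \<in> states A \<Longrightarrow> replay_prob \<alpha> m z \<le> 1"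
  unfolding replay_prob_def
  by (intro prod_le_1 ballI conjI play_prob_nonneg play_prob_le_1 snd_states replay_states)

lemma replay_prob_le_iterate:
  assumes \<alpha>: "\<alpha> \<in> profiles" and "z \<in> states A" and f_nonneg: "\<And>y. y \<in> states A \<Longrightarrow> 0 \<le> f y"
  shows "replay_prob \<alpha> m z * f (replay \<alpha> m z) \<le> (P ^^ m) f z"
  using assms(2)
proof (induction m arbitrary: z)
  case 0
  then show ?case by (simp add: replay_prob_def)
next
  case (Suc m)
  let ?y = "update (snd z) \<alpha>"
  have x: "snd z \<in> strategies" using Suc.prems by (rule snd_states)
  have "replay_prob \<alpha> (Suc m) z * f (replay \<alpha> (Suc m) z) =
      play_prob {} (snd z) \<alpha> * (replay_prob \<alpha> m ?y * f (replay \<alpha> m ?y))"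
    by (simp add: replay_prob_Suc_shift replay_Suc_shift)
  also have "\<dots> \<le> play_prob {} (snd z) \<alpha> * (P ^^ m) f ?y"
    using Suc.IH[OF update_states[OF x \<alpha>]] play_prob_nonneg[OF x] by (rule mult_left_mono)
  also have "\<dots> \<le> P ((P ^^ m) f) z"
    using Suc.prems iterate.nonneg[OF _ f_nonneg] \<alpha> by (intro step_ge_single)
  finally show ?case by simp
qed

lemma iterate_le_replay:
  assumes "\<alpha> \<in> profiles" "z \<in> states A" "\<And>y. y \<in> states A \<Longrightarrow> f y \<le> b"
  shows "(P ^^ m) f z \<le> (1 - replay_prob \<alpha> m z) * b + replay_prob \<alpha> m z * f (replay \<alpha> m z)"
proof -
  have "replay_prob \<alpha> m z * (b - f (replay \<alpha> m z)) \<le> (P ^^ m) (\<lambda>y. b - f y) z"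
    using assms by (intro replay_prob_le_iterate) auto
  then show ?thesis using assms(2) by (simp add: iterate.diff iterate.const algebra_simps)
qed

lemma rate_ge: "\<alpha> \<in> profiles \<Longrightarrow> 1 - \<epsilon> * u i \<alpha> \<le> rate"
  unfolding rate_def by (rule Max_ge) auto

lemma rate_less_1: "rate < 1"
  unfolding rate_def using profiles_nonempty step_bounds by (subst Max_less_iff) auto

lemma rate_nonneg: "0 \<le> rate"
proof -
  obtain \<alpha> where \<alpha>: "\<alpha> \<in> profiles" using profiles_nonempty by auto
  show ?thesis using rate_ge[OF \<alpha>] step_bounds(2)[OF \<alpha>] by (meson diff_ge_0_iff_ge less_imp_le order_trans)
qed

lemma rate_power_tendsto_0: "(\<lambda>m. rate ^ m) \<longlonglongrightarrow> 0"
  using rate_less_1 rate_nonneg by (intro LIMSEQ_power_zero) auto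

lemma abs_replay_minus_unitv_le:
  assumes "\<alpha> \<in> profiles"
  shows "\<bar>snd (replay \<alpha> m z) i a - unitv (\<alpha> i) a\<bar> \<le> rate ^ m * \<bar>snd z i a - unitv (\<alpha> i) a\<bar>"
proof (induction m)
  case (Suc m)
  have "\<bar>1 - \<epsilon> * u i \<alpha>\<bar> \<le> rate"
    using rate_ge[OF assms, of i] step_bounds(2)[OF assms, of i] by auto
  then have "\<bar>1 - \<epsilon> * u i \<alpha>\<bar> * \<bar>snd (replay \<alpha> m z) i a - unitv (\<alpha> i) a\<bar>
      \<le> rate * (rate ^ m * \<bar>snd z i a - unitv (\<alpha> i) a\<bar>)"
    using Suc rate_nonneg by (intro mult_mono) auto
  then show ?case by (simp add: replay_Suc update_minus_unitv abs_mult)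
qed simp

lemma one_minus_replay_le:
  assumes "\<alpha> \<in> profiles" "z \<in> states A"
  shows "1 - snd (replay \<alpha> m z) i (\<alpha> i) \<le> rate ^ m * (1 - snd z i (\<alpha> i))"
  using abs_replay_minus_unitv_le[OF assms(1), of m z i "\<alpha> i"]
    strategiesD(2)[OF snd_states[OF assms(2)], of i "\<alpha> i"]
  by (simp add: unitv_def)

lemma replay_own_ge:
  assumes "\<alpha> \<in> profiles" "z \<in> states A"
  shows "snd z i (\<alpha> i) \<le> snd (replay \<alpha> m z) i (\<alpha> i)"
proof -
  have "rate ^ m * (1 - snd z i (\<alpha> i)) \<le> 1 * (1 - snd z i (\<alpha> i))"
    using rate_nonneg rate_less_1 strategiesD(2)[OF snd_states[OF assms(2)]]
    by (intro mult_right_mono power_le_one) auto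
  then show ?thesis using one_minus_replay_le[OF assms, of m i] by simp
qed

lemma gap_nonneg: "z \<in> states A \<Longrightarrow> 0 \<le> gap \<alpha> z"
  unfolding gap_def by (intro sum_nonneg) (simp add: strategiesD snd_states)

lemma gap_le_card:
  assumes "z \<in> states A"
  shows "gap \<alpha> z \<le> CARD('i)"
proof -
  have "gap \<alpha> z \<le> (\<Sum>i\<in>(UNIV :: 'i set). 1)"
    unfolding gap_def using assms by (intro sum_mono) (simp add: strategiesD snd_states)
  then show ?thesis by simp
qed

lemma gap_replay_le:
  assumes "\<alpha> \<in> profiles" "z \<in> states A"
  shows "gap \<alpha> (replay \<alpha> m z) \<le> rate ^ m * gap \<alpha> z"
  unfolding gap_def sum_distrib_left by (intro sum_mono one_minus_replay_le assms)

lemma play_prob_ge_gap: "z \<in> states A \<Longrightarrow> 1 - gap \<alpha> z \<le> play_prob {} (snd z) \<alpha>"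
  using Weierstrass_prod_ineq[of UNIV "\<lambda>i. 1 - snd z i (\<alpha> i)"]
  by (auto simp: gap_def play_prob_empty strategiesD snd_states)

lemma replay_prob_ge_gap:
  assumes \<alpha>: "\<alpha> \<in> profiles" and z: "z \<in> states A"
  shows "1 - gap \<alpha> z / (1 - rate) \<le> replay_prob \<alpha> m z"
proof -
  let ?w = "\<lambda>t. play_prob {} (snd (replay \<alpha> t z)) \<alpha>"
  have "(\<Sum>t<m. 1 - ?w t) \<le> (\<Sum>t<m. rate ^ t * gap \<alpha> z)"
    using play_prob_ge_gap[OF replay_states[OF assms]] gap_replay_le[OF assms]
    by (intro sum_mono) (smt (verit))
  also have "\<dots> \<le> (1 / (1 - rate)) * gap \<alpha> z"
    unfolding sum_distrib_right[symmetric]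
  proof (rule mult_right_mono)
    have "(\<Sum>t<m. rate ^ t) \<le> (\<Sum>t. rate ^ t)"
      using rate_nonneg rate_less_1 by (intro sum_le_suminf summable_geometric) auto
    then show "(\<Sum>t<m. rate ^ t) \<le> 1 / (1 - rate)"
      using rate_nonneg rate_less_1 by (simp add: suminf_geometric)
  qed (rule gap_nonneg[OF z])
  finally have "1 - gap \<alpha> z / (1 - rate) \<le> 1 - (\<Sum>t<m. 1 - ?w t)" by simp
  also have "\<dots> \<le> (\<Prod>t<m. 1 - (1 - ?w t))"
    by (rule Weierstrass_prod_ineq)
       (use assms in \<open>auto simp: play_prob_nonneg play_prob_le_1 snd_states replay_states\<close>)
  finally show ?thesis by (simp add: replay_prob_def)
qed

definition escape_bound :: "nat \<Rightarrow> real" where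
  "escape_bound m = CARD('i) / (1 - rate) * rate ^ m"

lemma escape_bound_tendsto_0: "escape_bound \<longlonglongrightarrow> 0"
  unfolding escape_bound_def[abs_def] by (rule tendsto_mult_right_zero[OF rate_power_tendsto_0])

lemma escape_prob_le:
  assumes "\<alpha> \<in> profiles" "z \<in> states A"
  shows "1 - replay_prob \<alpha> t (replay \<alpha> m z) \<le> escape_bound m"
proof -
  have "gap \<alpha> (replay \<alpha> m z) \<le> rate ^ m * CARD('i)"
    using gap_replay_le[OF assms, of m]
      mult_left_mono[OF gap_le_card[OF assms(2), of \<alpha>], of "rate ^ m"] rate_nonneg
    by simp
  then have "gap \<alpha> (replay \<alpha> m z) / (1 - rate) \<le> rate ^ m * CARD('i) / (1 - rate)"
    using rate_less_1 by (intro divide_right_mono) auto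
  then show ?thesis
    using replay_prob_ge_gap[OF assms(1) replay_states[OF assms], of m t]
    by (simp add: escape_bound_def mult.commute)
qed

lemma replay_prob_uniformly_pos:
  assumes "0 < b"
  obtains c where "0 < c"
    "\<And>\<alpha> z m. \<alpha> \<in> profiles \<Longrightarrow> z \<in> states A \<Longrightarrow> (\<And>i. b \<le> snd z i (\<alpha> i)) \<Longrightarrow> c \<le> replay_prob \<alpha> m z"
proof -
  have "\<forall>\<^sub>F m in sequentially. escape_bound m < 1 / 2"
    using escape_bound_tendsto_0 by (rule order_tendstoD) simp
  then obtain m0 where m0_small: "escape_bound m0 < 1 / 2" by (auto simp: eventually_sequentially)
  show thesis
  proof (rule that[of "(b ^ CARD('i)) ^ m0 * (1 / 2)"])
    fix \<alpha> z m assume \<alpha>: "\<alpha> \<in> profiles" and z: "z \<in> states A" and b_le: "\<And>i. b \<le> snd z i (\<alpha> i)"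
    let ?y = "replay \<alpha> m0 z"
    have "b \<le> snd (replay \<alpha> t z) i (\<alpha> i)" for t i
      using b_le replay_own_ge[OF \<alpha> z] by (rule order_trans)
    then have "(\<Prod>t<m0. \<Prod>i\<in>(UNIV :: 'i set). b) \<le> replay_prob \<alpha> m0 z"
      unfolding replay_prob_def play_prob_empty using assms by (intro prod_mono conjI prod_nonneg) auto
    then have start: "(b ^ CARD('i)) ^ m0 \<le> replay_prob \<alpha> m0 z" by simp
    have continue: "1 / 2 \<le> replay_prob \<alpha> m ?y"
      using m0_small escape_prob_le[OF \<alpha> z, of m m0] by linarith
    have "(b ^ CARD('i)) ^ m0 * (1 / 2) \<le> replay_prob \<alpha> m0 z * replay_prob \<alpha> m ?y"
      using start continue assms replay_prob_nonneg[OF \<alpha> z] by (intro mult_mono) auto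
    also have "\<dots> = replay_prob \<alpha> m z * replay_prob \<alpha> m0 (replay \<alpha> m z)"
      by (simp flip: replay_prob_add add: add.commute)
    also have "\<dots> \<le> replay_prob \<alpha> m z"
      by (intro mult_right_le_one_le replay_prob_nonneg replay_prob_le_1 replay_states \<alpha> z)
    finally show "(b ^ CARD('i)) ^ m0 * (1 / 2) \<le> replay_prob \<alpha> m z" .
  qed (use assms in simp)
qed

lemma likely_profile_exists:
  assumes "z \<in> states A"
  shows "\<exists>\<alpha>\<in>profiles. \<forall>i. 1 / (\<Sum>i\<in>UNIV. card (A i)) \<le> snd z i (\<alpha> i)"
proof -
  let ?b = "1 / real (\<Sum>i\<in>UNIV. card (A i))"
  have "\<exists>a\<in>A i. ?b \<le> snd z i a" for i
  proof (rule ccontr)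
    assume "\<not> ?thesis"
    then have "(\<Sum>a\<in>A i. snd z i a) < (\<Sum>a\<in>A i. ?b)" by (intro sum_strict_mono) auto
    then have "1 < card (A i) * ?b" using strategiesD[OF snd_states[OF assms]] by simp
    moreover have "card (A i) \<le> (\<Sum>i\<in>UNIV. card (A i))" by (intro member_le_sum) auto
    ultimately show False using card_actions_pos[of i] by (simp add: field_simps del: of_nat_sum)
  qed
  then obtain \<alpha> where "\<And>i. \<alpha> i \<in> A i \<and> ?b \<le> snd z i (\<alpha> i)" by metis
  then show ?thesis by (auto simp: profiles_def)
qed

lemma lock_in_uniformly_pos:
  obtains c where "0 < c" "c \<le> 1" "\<And>z. z \<in> states A \<Longrightarrow> \<exists>\<alpha>\<in>profiles. \<forall>m. c \<le> replay_prob \<alpha> m z"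
proof -
  have "0 < (\<Sum>i\<in>UNIV. card (A i))" by (intro sum_pos) (auto simp: card_gt_0_iff)
  then have "0 < 1 / real (\<Sum>i\<in>UNIV. card (A i))" by (simp del: of_nat_sum)
  then obtain c where "0 < c" and c_le: "\<And>\<alpha> z m. \<lbrakk>\<alpha> \<in> profiles; z \<in> states A;
      \<And>i. 1 / real (\<Sum>i\<in>UNIV. card (A i)) \<le> snd z i (\<alpha> i)\<rbrakk> \<Longrightarrow> c \<le> replay_prob \<alpha> m z"
    using replay_prob_uniformly_pos by blast
  show thesis
  proof (rule that[of "min c 1"])
    show "\<exists>\<alpha>\<in>profiles. \<forall>m. min c 1 \<le> replay_prob \<alpha> m z" if "z \<in> states A" for z
      using likely_profile_exists[OF that] c_le[OF _ that] by (meson min.coboundedI1)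
  qed (use \<open>0 < c\<close> in auto)
qed

subsection \<open>Uniform convergence of the unperturbed process\<close>

lemma pure_states_eq: "pure_states A = pure ` profiles"
  by (auto simp: pure_states_def pure_def profiles_def image_iff)

lemma finite_pure_states [simp]: "finite (pure_states A)"
  by (simp add: pure_states_eq)

lemma pure_in_states: "\<alpha> \<in> profiles \<Longrightarrow> pure \<alpha> \<in> states A"
  by (auto simp: states_def pure_def profiles_def prob_simplex_def unitv_def)

lemma pure_states_subset: "s \<in> pure_states A \<Longrightarrow> s \<in> states A"
  by (auto simp: pure_states_eq pure_in_states)

lemma replay_tendsto_pure:
  assumes "\<alpha> \<in> profiles"
  shows "((\<lambda>(m, z). replay \<alpha> m z) \<longlongrightarrow> pure \<alpha>) (sequentially \<times>\<^sub>F principal (states A))"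
proof -
  let ?F = "sequentially \<times>\<^sub>F principal (states A)"
  have "fst (replay \<alpha> m z) = \<alpha>" if "0 < m" for m z
    using that by (cases m) (simp_all add: replay_Suc)
  then have "\<forall>\<^sub>F p in ?F. fst (case p of (m, z) \<Rightarrow> replay \<alpha> m z) = \<alpha>"
    unfolding eventually_prod_principal by (intro eventually_mono[OF eventually_gt_at_top[of 0]]) simp
  then have profile: "((\<lambda>p. fst (case p of (m, z) \<Rightarrow> replay \<alpha> m z)) \<longlongrightarrow> \<alpha>) ?F"
    by (rule tendsto_eventually)
  have "((\<lambda>p. snd (case p of (m, z) \<Rightarrow> replay \<alpha> m z) i a) \<longlongrightarrow> unitv (\<alpha> i) a) ?F" for i a
  proof (rule LIM_zero_cancel, rule Lim_null_comparison)
    have "\<bar>snd (replay \<alpha> m z) i a - unitv (\<alpha> i) a\<bar> \<le> rate ^ m" if "z \<in> states A" for m z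
    proof -
      have "\<bar>snd z i a - unitv (\<alpha> i) a\<bar> \<le> 1"
        using strategiesD(1,2)[OF snd_states[OF that], of i a] by (auto simp: unitv_def)
      then show ?thesis
        using abs_replay_minus_unitv_le[OF assms, of m z i a] rate_nonneg
        by (meson mult_left_le order_trans zero_le_power)
    qed
    then show "\<forall>\<^sub>F p in ?F. norm (snd (case p of (m, z) \<Rightarrow> replay \<alpha> m z) i a - unitv (\<alpha> i) a) \<le> rate ^ fst p"
      unfolding eventually_prod_principal by simp
    show "((\<lambda>p. rate ^ fst p) \<longlongrightarrow> 0) ?F"
      by (rule filterlim_compose[OF rate_power_tendsto_0 filterlim_fst])
  qed
  then have "((\<lambda>p. snd (case p of (m, z) \<Rightarrow> replay \<alpha> m z)) \<longlongrightarrow> (\<lambda>i. unitv (\<alpha> i))) ?F"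
    by (intro tendsto_fun_componentwise)
  from tendsto_Pair[OF profile this] show ?thesis by (simp add: pure_def)
qed

lemma replay_uniformly_close:
  fixes f :: "'i state \<Rightarrow> real"
  assumes f: "continuous_on (states A) f" and "0 < e"
  shows "\<forall>\<^sub>F m in sequentially. \<forall>\<alpha>\<in>profiles. \<forall>z\<in>states A. \<bar>f (replay \<alpha> m z) - f (pure \<alpha>)\<bar> < e"
proof (rule eventually_ball_finite[OF finite_profiles], rule ballI)
  fix \<alpha> assume \<alpha>: "\<alpha> \<in> profiles"
  have "((\<lambda>p. f (case p of (m, z) \<Rightarrow> replay \<alpha> m z)) \<longlongrightarrow> f (pure \<alpha>)) (sequentially \<times>\<^sub>F principal (states A))"
    by (rule continuous_on_tendsto_compose[OF f replay_tendsto_pure[OF \<alpha>] pure_in_states[OF \<alpha>]])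
       (simp add: eventually_prod_principal replay_states \<alpha>)
  from tendstoD[OF this \<open>0 < e\<close>]
  show "\<forall>\<^sub>F m in sequentially. \<forall>z\<in>states A. \<bar>f (replay \<alpha> m z) - f (pure \<alpha>)\<bar> < e"
    by (simp add: eventually_prod_principal dist_real_def)
qed

lemma iterate_replay_le:
  assumes \<alpha>: "\<alpha> \<in> profiles" and z: "z \<in> states A"
    and g_bounds: "\<And>y. y \<in> states A \<Longrightarrow> 0 \<le> g y" "\<And>y. y \<in> states A \<Longrightarrow> g y \<le> B"
    and close: "g (replay \<alpha> (m + t) z) \<le> d"
  shows "(P ^^ t) g (replay \<alpha> m z) \<le> escape_bound m * B + d"
proof -
  let ?y = "replay \<alpha> m z"
  have y: "?y \<in> states A" using \<alpha> z by (rule replay_states)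
  have "0 \<le> B" using g_bounds[OF y] by linarith
  have "(P ^^ t) g ?y \<le> (1 - replay_prob \<alpha> t ?y) * B + replay_prob \<alpha> t ?y * g (replay \<alpha> t ?y)"
    using g_bounds(2) by (rule iterate_le_replay[OF \<alpha> y])
  also have "\<dots> \<le> escape_bound m * B + 1 * g (replay \<alpha> t ?y)"
    using escape_prob_le[OF \<alpha> z] replay_prob_le_1[OF \<alpha> y] \<open>0 \<le> B\<close> g_bounds(1)[OF replay_states[OF \<alpha> y]]
    by (intro add_mono mult_right_mono) auto
  finally show ?thesis using close by (simp add: replay_add)
qed

lemma iterate_le_geometric:
  assumes lock_in: "0 < c" "c \<le> 1" "\<And>z. z \<in> states A \<Longrightarrow> \<exists>\<alpha>\<in>profiles. c \<le> replay_prob \<alpha> m z"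
    and g_bounds: "\<And>y. y \<in> states A \<Longrightarrow> 0 \<le> g y" "\<And>y. y \<in> states A \<Longrightarrow> g y \<le> B"
    and replayed: "\<And>\<alpha> y t. \<alpha> \<in> profiles \<Longrightarrow> y \<in> states A \<Longrightarrow> (P ^^ t) g (replay \<alpha> m y) \<le> d"
    and "z \<in> states A"
  shows "(P ^^ (k * m + t)) g z \<le> (1 - c) ^ k * B + d / c"
  using assms(7)
proof (induction k arbitrary: z)
  case 0
  obtain \<alpha> where "\<alpha> \<in> profiles" using profiles_nonempty by blast
  then have "0 \<le> d" using replayed[of \<alpha> z 0] g_bounds(1)[OF replay_states[of \<alpha> z m]] 0 by fastforce
  have "(P ^^ t) g z \<le> B"
    using iterate.mono[OF 0 g_bounds(2)] iterate.const[OF 0] by simp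
  also have "B \<le> B + d / c" using lock_in \<open>0 \<le> d\<close> by simp
  finally show ?case by simp
next
  case (Suc k)
  let ?b = "(1 - c) ^ k * B + d / c" and ?h = "(P ^^ (k * m + t)) g"
  obtain \<alpha> where \<alpha>: "\<alpha> \<in> profiles" "c \<le> replay_prob \<alpha> m z" using lock_in(3)[OF Suc.prems] by blast
  have y: "replay \<alpha> m z \<in> states A" using \<alpha>(1) Suc.prems by (rule replay_states)
  have bound_nonneg: "0 \<le> ?b"
      using Suc.IH[OF y] iterate.nonneg[OF y g_bounds(1)] by (rule order_trans[rotated])
  have "(P ^^ (Suc k * m + t)) g z = (P ^^ m) ?h z" by (simp add: add.assoc funpow_add)
  also have "\<dots> \<le> (1 - replay_prob \<alpha> m z) * ?b + replay_prob \<alpha> m z * ?h (replay \<alpha> m z)"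
    using Suc.IH by (rule iterate_le_replay[OF \<alpha>(1) Suc.prems])
  also have "\<dots> \<le> (1 - c) * ?b + 1 * d"
    using \<alpha>(2) bound_nonneg replay_prob_le_1[OF \<alpha>(1) Suc.prems] replayed[OF \<alpha>(1) Suc.prems]
      iterate.nonneg[OF y g_bounds(1)]
    by (intro add_mono mult_right_mono mult_mono) auto
  also have "\<dots> = (1 - c) ^ Suc k * B + d / c" using lock_in by (simp add: field_simps)
  finally show ?case .
qed

text \<open>From every state the process locks in to some profile with probability at least \<open>c\<close>, and
  then \<open>g\<close> is small; so each round of \<open>m\<close> steps multiplies the bound on \<open>P\<^sup>t g\<close> by \<open>1 - c\<close>.\<close>
lemma iterate_uniform_decay:
  fixes G :: "('i state \<Rightarrow> real) set"
  assumes G_bounds: "\<And>g y. g \<in> G \<Longrightarrow> y \<in> states A \<Longrightarrow> 0 \<le> g y" "\<And>g y. g \<in> G \<Longrightarrow> y \<in> states A \<Longrightarrow> g y \<le> B"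
    and close: "\<And>d. 0 < d \<Longrightarrow>
      \<forall>\<^sub>F m in sequentially. \<forall>g\<in>G. \<forall>\<alpha>\<in>profiles. \<forall>z\<in>states A. g (replay \<alpha> m z) \<le> d"
    and "0 < e"
  shows "\<forall>\<^sub>F t in sequentially. \<forall>g\<in>G. \<forall>z\<in>states A. (P ^^ t) g z \<le> e"
proof -
  obtain c where lock_in: "0 < c" "c \<le> 1" "\<And>z. z \<in> states A \<Longrightarrow> \<exists>\<alpha>\<in>profiles. \<forall>m. c \<le> replay_prob \<alpha> m z"
    using lock_in_uniformly_pos by blast
  define d where "d = e * c / 4"
  have d_pos: "0 < d" using \<open>0 < e\<close> lock_in by (simp add: d_def)
  have "\<forall>\<^sub>F m in sequentially. escape_bound m * B < d"
    using tendsto_mult_left_zero[OF escape_bound_tendsto_0] d_pos by (rule order_tendstoD)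
  from eventually_conj[OF this close[OF d_pos]] obtain m where m_large: "\<And>k. m \<le> k \<Longrightarrow> escape_bound k * B < d"
      "\<And>k g \<alpha> z. \<lbrakk>m \<le> k; g \<in> G; \<alpha> \<in> profiles; z \<in> states A\<rbrakk> \<Longrightarrow> g (replay \<alpha> k z) \<le> d"
    unfolding eventually_sequentially by blast
  have replayed: "(P ^^ t) g (replay \<alpha> m z) \<le> 2 * d"
    if "g \<in> G" "\<alpha> \<in> profiles" "z \<in> states A" for g \<alpha> z t
  proof -
    have "g (replay \<alpha> (m + t) z) \<le> d" using that by (intro m_large(2)) auto
    then have "(P ^^ t) g (replay \<alpha> m z) \<le> escape_bound m * B + d"
      using that by (intro iterate_replay_le G_bounds)
    then show ?thesis using m_large(1)[OF order_refl] by simp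
  qed
  have geometric: "(P ^^ (k * m + t)) g z \<le> (1 - c) ^ k * B + 2 * d / c"
    if "g \<in> G" "z \<in> states A" for k t g z
    by (intro iterate_le_geometric G_bounds replayed that lock_in) (use lock_in(3) in blast)+
  have "(\<lambda>k. (1 - c) ^ k * B) \<longlonglongrightarrow> 0"
    using lock_in by (intro tendsto_mult_left_zero LIMSEQ_power_zero) auto
  then have "\<forall>\<^sub>F k in sequentially. (1 - c) ^ k * B < e / 2"
    using \<open>0 < e\<close> by (intro order_tendstoD) auto
  then obtain k where "(1 - c) ^ k * B < e / 2" by (auto simp: eventually_sequentially)
  moreover have "2 * d / c = e / 2" using lock_in by (simp add: d_def)
  ultimately have "(P ^^ t) g z \<le> e" if "k * m \<le> t" "g \<in> G" "z \<in> states A" for t g z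
    using geometric[OF that(2,3), of k "t - k * m"] that(1) by simp
  then show ?thesis unfolding eventually_sequentially by blast
qed

lemma iterate_uniformly_close:
  assumes f: "continuous_on (states A) f" and "0 < e"
  shows "\<forall>\<^sub>F m in sequentially. \<forall>\<alpha>\<in>profiles. \<forall>z\<in>states A. \<forall>t.
    \<bar>(P ^^ t) f (replay \<alpha> m z) - f (pure \<alpha>)\<bar> < e"
proof -
  obtain B where B_bound: "\<And>z. z \<in> states A \<Longrightarrow> \<bar>f z\<bar> \<le> B"
    using continuous_on_compact_bound[OF compact_states f] by (metis real_norm_def)
  have "\<forall>\<^sub>F m in sequentially. escape_bound m * (2 * B) < e / 2"
    using tendsto_mult_left_zero[OF escape_bound_tendsto_0] by (rule order_tendstoD) (simp add: \<open>0 < e\<close>)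
  moreover have "\<forall>\<^sub>F m in sequentially. \<forall>\<alpha>\<in>profiles. \<forall>z\<in>states A. \<bar>f (replay \<alpha> m z) - f (pure \<alpha>)\<bar> < e / 2"
    using f \<open>0 < e\<close> by (intro replay_uniformly_close) auto
  ultimately have "\<forall>\<^sub>F m in sequentially. escape_bound m * (2 * B) < e / 2 \<and>
      (\<forall>\<alpha>\<in>profiles. \<forall>z\<in>states A. \<bar>f (replay \<alpha> m z) - f (pure \<alpha>)\<bar> < e / 2)"
    by (rule eventually_conj)
  then obtain m0 where m0_large: "\<And>m. m0 \<le> m \<Longrightarrow> escape_bound m * (2 * B) < e / 2"
      "\<And>m \<alpha> z. \<lbrakk>m0 \<le> m; \<alpha> \<in> profiles; z \<in> states A\<rbrakk> \<Longrightarrow> \<bar>f (replay \<alpha> m z) - f (pure \<alpha>)\<bar> < e / 2"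
    unfolding eventually_sequentially by blast
  have "\<bar>(P ^^ t) f (replay \<alpha> m z) - f (pure \<alpha>)\<bar> < e"
    if m: "m0 \<le> m" and \<alpha>: "\<alpha> \<in> profiles" and z: "z \<in> states A" for m \<alpha> z t
  proof -
    let ?y = "replay \<alpha> m z" and ?g = "\<lambda>y. \<bar>f y - f (pure \<alpha>)\<bar>"
    have y: "?y \<in> states A" using \<alpha> z by (rule replay_states)
    have g_le: "?g y \<le> 2 * B" if "y \<in> states A" for y
      using B_bound[OF that] B_bound[OF pure_in_states[OF \<alpha>]] by linarith
    have "\<bar>(P ^^ t) f ?y - f (pure \<alpha>)\<bar> \<le> (P ^^ t) ?g ?y"
      using iterate.abs_le[OF y, where f="\<lambda>y. f y - f (pure \<alpha>)" and t=t] y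
      by (simp add: iterate.diff iterate.const)
    also have "\<dots> \<le> escape_bound m * (2 * B) + ?g (replay \<alpha> (m + t) z)"
      using g_le by (intro iterate_replay_le \<alpha> z) auto
    also have "\<dots> < e / 2 + e / 2"
      using m0_large(1)[OF m] m0_large(2)[OF _ \<alpha> z, of "m + t"] m by (intro add_strict_mono) auto
    finally show ?thesis by simp
  qed
  then show ?thesis unfolding eventually_sequentially by blast
qed

lemma iterate_increment_decay:
  assumes f: "continuous_on (states A) f" and "0 < e"
  shows "\<forall>\<^sub>F t in sequentially. \<forall>s. \<forall>z\<in>states A. (P ^^ t) (\<lambda>z. \<bar>f z - (P ^^ s) f z\<bar>) z \<le> e"
proof -
  obtain B where B_bound: "\<And>z. z \<in> states A \<Longrightarrow> \<bar>f z\<bar> \<le> B"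
    using continuous_on_compact_bound[OF compact_states f] by (metis real_norm_def)
  let ?G = "range (\<lambda>s z. \<bar>f z - (P ^^ s) f z\<bar>)"
  have "\<forall>\<^sub>F t in sequentially. \<forall>g\<in>?G. \<forall>z\<in>states A. (P ^^ t) g z \<le> e"
  proof (rule iterate_uniform_decay[OF _ _ _ \<open>0 < e\<close>])
    fix g y assume "g \<in> ?G" and y: "y \<in> states A"
    then obtain s where g_eq: "g = (\<lambda>z. \<bar>f z - (P ^^ s) f z\<bar>)" by blast
    have "\<bar>(P ^^ s) f y\<bar> \<le> B" using y B_bound by (rule iterate.bound)
    then show "g y \<le> 2 * B" using B_bound[OF y] by (simp add: g_eq)
    show "0 \<le> g y" by (simp add: g_eq)
  next
    fix d :: real assume "0 < d"
    then have "\<forall>\<^sub>F m in sequentially. \<forall>\<alpha>\<in>profiles. \<forall>z\<in>states A. \<forall>t.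
        \<bar>(P ^^ t) f (replay \<alpha> m z) - f (pure \<alpha>)\<bar> < d / 2"
      using f by (intro iterate_uniformly_close) auto
    then show "\<forall>\<^sub>F m in sequentially. \<forall>g\<in>?G. \<forall>\<alpha>\<in>profiles. \<forall>z\<in>states A. g (replay \<alpha> m z) \<le> d"
    proof eventually_elim
      case (elim m)
      have "\<bar>f (replay \<alpha> m z) - (P ^^ s) f (replay \<alpha> m z)\<bar> \<le> d"
        if "\<alpha> \<in> profiles" "z \<in> states A" for s \<alpha> z
      proof -
        have "\<bar>f (replay \<alpha> m z) - f (pure \<alpha>)\<bar> < d / 2"
          using elim[rule_format, OF that, of 0] by simp
        moreover note elim[rule_format, OF that, of s]
        ultimately show ?thesis by linarith
      qed
      then show ?case by auto
    qed
  qed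
  then show ?thesis by eventually_elim auto
qed

lemma iterate_uniformly_Cauchy:
  assumes f: "continuous_on (states A) f"
  shows "uniformly_Cauchy_on (states A) (\<lambda>t. (P ^^ t) f)"
proof (rule uniformly_Cauchy_onI)
  fix e :: real assume "0 < e"
  then obtain t0 where t0_close: "\<And>s z. z \<in> states A \<Longrightarrow> (P ^^ t0) (\<lambda>z. \<bar>f z - (P ^^ s) f z\<bar>) z \<le> e / 3"
    using iterate_increment_decay[OF f, of "e / 3"] by (auto simp: eventually_sequentially)
  have near: "\<bar>(P ^^ t0) f z - (P ^^ t) f z\<bar> \<le> e / 3" if "t0 \<le> t" "z \<in> states A" for t z
  proof -
    have "(P ^^ t) f = (P ^^ t0) ((P ^^ (t - t0)) f)"
      using that(1) by (simp flip: funpow_add comp_apply[of "P ^^ t0"])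
    then have "\<bar>(P ^^ t0) f z - (P ^^ t) f z\<bar> = \<bar>(P ^^ t0) (\<lambda>z. f z - (P ^^ (t - t0)) f z) z\<bar>"
      by (simp add: iterate.diff[OF that(2)])
    also have "\<dots> \<le> e / 3" using iterate.abs_le[OF that(2)] t0_close[OF that(2)] by (rule order_trans)
    finally show ?thesis .
  qed
  have "dist ((P ^^ t) f z) ((P ^^ t') f z) < e" if "t0 \<le> t" "t0 \<le> t'" "z \<in> states A" for t t' z
    using near[OF that(1,3)] near[OF that(2,3)] \<open>0 < e\<close> unfolding dist_real_def by linarith
  then show "\<exists>M. \<forall>z\<in>states A. \<forall>t\<ge>M. \<forall>t'\<ge>M. dist ((P ^^ t) f z) ((P ^^ t') f z) < e" by blast
qed

definition H :: "('i state \<Rightarrow> real) \<Rightarrow> 'i state \<Rightarrow> real" where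
  "H f z = lim (\<lambda>t. (P ^^ t) f z)"

lemma iterate_uniform_limit:
  "continuous_on (states A) f \<Longrightarrow> uniform_limit (states A) (\<lambda>t. (P ^^ t) f) (H f) sequentially"
  using Cauchy_uniformly_convergent[OF iterate_uniformly_Cauchy]
  unfolding uniformly_convergent_uniform_limit_iff H_def .

lemma iterate_tendsto:
  "continuous_on (states A) f \<Longrightarrow> z \<in> states A \<Longrightarrow> (\<lambda>t. (P ^^ t) f z) \<longlonglongrightarrow> H f z"
  by (rule tendsto_uniform_limitI[OF iterate_uniform_limit])

lemma continuous_on_H:
  assumes "continuous_on (states A) f"
  shows "continuous_on (states A) (H f)"
  by (rule uniform_limit_theorem[OF _ iterate_uniform_limit[OF assms]])
     (simp_all add: continuous_on_iterate assms)

lemma step_tendsto: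
  assumes "\<And>y. y \<in> states A \<Longrightarrow> (\<lambda>t. f t y) \<longlonglongrightarrow> g y" "z \<in> states A"
  shows "(\<lambda>t. step J (f t) z) \<longlonglongrightarrow> step J g z"
  unfolding step_def using assms
  by (intro tendsto_sum tendsto_mult tendsto_const) (simp add: update_states snd_states)

lemma harmonic_H:
  assumes "continuous_on (states A) f"
  shows "step.harmonic {} (H f)"
  unfolding step.harmonic_def
proof
  fix z assume z: "z \<in> states A"
  have "(\<lambda>t. P ((P ^^ t) f) z) \<longlonglongrightarrow> P (H f) z"
    by (rule step_tendsto[OF iterate_tendsto[OF assms] z])
  moreover have "(\<lambda>t. P ((P ^^ t) f) z) \<longlonglongrightarrow> H f z"
    using LIMSEQ_Suc[OF iterate_tendsto[OF assms z]] by simp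
  ultimately show "P (H f) z = H f z" by (rule LIMSEQ_unique)
qed

lemma update_pure: "update (snd (pure \<alpha>)) \<alpha> = pure \<alpha>"
  by (simp add: la_update_def pure_def)

lemma play_prob_pure: "play_prob {} (snd (pure \<alpha>)) \<beta> = (if \<beta> = \<alpha> then 1 else 0)"
  by (auto simp: play_prob_empty pure_def unitv_def fun_eq_iff)

lemma P_pure: "\<alpha> \<in> profiles \<Longrightarrow> P f (pure \<alpha>) = f (pure \<alpha>)"
  by (simp add: step_def play_prob_pure if_distrib[of "\<lambda>c. c * _"] sum.delta update_pure cong: if_cong)

lemma H_pure:
  assumes "s \<in> pure_states A"
  shows "H f s = f s"
proof -
  have "(P ^^ t) f s = f s" for t
    using assms by (induction t) (auto simp: pure_states_eq P_pure)
  then show ?thesis by (simp add: H_def)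
qed

lemma harmonic_eq_0:
  assumes h: "continuous_on (states A) h" "step.harmonic {} h" "\<And>s. s \<in> pure_states A \<Longrightarrow> h s = 0"
    and z: "z \<in> states A"
  shows "h z = 0"
proof -
  obtain B where B_bound: "\<And>z. z \<in> states A \<Longrightarrow> \<bar>h z\<bar> \<le> B"
    using continuous_on_compact_bound[OF compact_states h(1)] by (metis real_norm_def)
  have "\<bar>h z\<bar> \<le> e" if "0 < e" for e
  proof -
    have "\<forall>\<^sub>F t in sequentially. \<forall>g\<in>{\<lambda>z. \<bar>h z\<bar>}. \<forall>z\<in>states A. (P ^^ t) g z \<le> e"
    proof (rule iterate_uniform_decay[OF _ _ _ \<open>0 < e\<close>])
      fix d :: real assume "0 < d"
      have pure: "h (pure \<alpha>) = 0" if "\<alpha> \<in> profiles" for \<alpha>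
        using h(3) that by (simp add: pure_states_eq)
      show "\<forall>\<^sub>F m in sequentially. \<forall>g\<in>{\<lambda>z. \<bar>h z\<bar>}. \<forall>\<alpha>\<in>profiles. \<forall>z\<in>states A. g (replay \<alpha> m z) \<le> d"
        using replay_uniformly_close[OF h(1) \<open>0 < d\<close>] by eventually_elim (force simp: pure less_imp_le)
    qed (use B_bound in auto)
    then obtain t where "(P ^^ t) (\<lambda>z. \<bar>h z\<bar>) z \<le> e" using z by (auto simp: eventually_sequentially)
    then show ?thesis
      using iterate.abs_le[OF z, where f=h and t=t] step.harmonic_funpow[OF h(2) z, of t] by simp
  qed
  then show ?thesis using field_le_epsilon[of "\<bar>h z\<bar>" 0] by simp
qed

lemma harmonic_eqI:
  assumes "continuous_on (states A) f" "step.harmonic {} f" "continuous_on (states A) g" "step.harmonic {} g"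
    and "\<And>s. s \<in> pure_states A \<Longrightarrow> f s = g s" "z \<in> states A"
  shows "f z = g z"
proof -
  have "f s - g s = 0" if "s \<in> pure_states A" for s using assms(5)[OF that] by simp
  from harmonic_eq_0[OF continuous_on_diff[OF assms(1,3)] step.harmonic_diff[OF assms(2,4)] this assms(6)]
  show ?thesis by simp
qed

subsection \<open>Absorption probabilities\<close>

definition bump :: "real \<Rightarrow> 'i state \<Rightarrow> 'i state \<Rightarrow> real" where
  "bump r s z = max 0 (1 - strat_dist A (snd z) (snd s) / r)"

definition absorb :: "'i state \<Rightarrow> 'i state \<Rightarrow> real" where
  "absorb s = H (bump 1 s)"

lemma strat_dist_nonneg: "0 \<le> strat_dist A x y"
  unfolding strat_dist_def by (intro real_sqrt_ge_zero sum_nonneg) auto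

lemma strat_dist_self [simp]: "strat_dist A x x = 0"
  by (simp add: strat_dist_def)

lemma strat_dist_pure:
  assumes "s \<in> pure_states A" "s' \<in> pure_states A" "s \<noteq> s'"
  shows "1 \<le> strat_dist A (snd s) (snd s')"
proof -
  obtain \<alpha> \<beta> where pure_eq: "s = pure \<alpha>" "s' = pure \<beta>" and \<alpha>: "\<alpha> \<in> profiles"
    using assms by (auto simp: pure_states_eq)
  with assms(3) obtain i where differ: "\<alpha> i \<noteq> \<beta> i" by (metis ext)
  let ?d = "\<lambda>i. \<Sum>a\<in>A i. (snd s i a - snd s' i a)\<^sup>2"
  have "1 = (snd s i (\<alpha> i) - snd s' i (\<alpha> i))\<^sup>2" using differ by (simp add: pure_eq pure_def unitv_def)
  also have "\<dots> \<le> ?d i" using profilesD[OF \<alpha>] by (intro member_le_sum) auto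
  also have "\<dots> \<le> (\<Sum>i\<in>UNIV. ?d i)" by (intro member_le_sum[of i UNIV ?d] sum_nonneg) auto
  finally show ?thesis by (simp add: strat_dist_def)
qed

lemma continuous_on_bump: "continuous_on S (bump r s)"
proof -
  have "continuous_on S (\<lambda>z::'i state. strat_dist A (snd z) x)" for x
    unfolding strat_dist_def
    by (intro continuous_on_real_sqrt continuous_on_sum continuous_on_power continuous_on_diff
        continuous_on_const continuous_on_strategy)
  then show ?thesis
    unfolding bump_def[abs_def] divide_inverse
    by (intro continuous_on_max continuous_on_diff continuous_on_mult continuous_on_const)
qed

lemma bump_pure:
  assumes "0 < r" "r \<le> 1" "s \<in> pure_states A" "s' \<in> pure_states A"
  shows "bump r s s' = (if s' = s then 1 else 0)"
proof (cases "s' = s")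
  case False
  then have "r \<le> strat_dist A (snd s') (snd s)" using strat_dist_pure[of s' s] assms by simp
  then show ?thesis using False assms(1) by (simp add: bump_def)
qed (simp add: bump_def)

lemma continuous_on_absorb: "continuous_on (states A) (absorb s)"
  unfolding absorb_def by (rule continuous_on_H[OF continuous_on_bump])

lemma harmonic_absorb: "step.harmonic {} (absorb s)"
  unfolding absorb_def by (rule harmonic_H[OF continuous_on_bump])

lemma absorb_pure:
  "s \<in> pure_states A \<Longrightarrow> s' \<in> pure_states A \<Longrightarrow> absorb s s' = (if s' = s then 1 else 0)"
  by (simp add: absorb_def H_pure bump_pure)

lemma H_eq_sum_absorb:
  assumes f: "continuous_on (states A) f" and z: "z \<in> states A"
  shows "H f z = (\<Sum>s\<in>pure_states A. f s * absorb s z)"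
proof (rule harmonic_eqI[OF continuous_on_H[OF f] harmonic_H[OF f] _ _ _ z])
  show "continuous_on (states A) (\<lambda>z. \<Sum>s\<in>pure_states A. f s * absorb s z)"
    by (intro continuous_on_sum continuous_on_mult continuous_on_const continuous_on_absorb)
  show "step.harmonic {} (\<lambda>z. \<Sum>s\<in>pure_states A. f s * absorb s z)"
    by (intro step.harmonic_sum_cmult harmonic_absorb)
  fix s assume s: "s \<in> pure_states A"
  have "(\<Sum>s'\<in>pure_states A. f s' * absorb s' s) = (\<Sum>s'\<in>pure_states A. if s' = s then f s else 0)"
    using s by (intro sum.cong) (auto simp: absorb_pure)
  then show "H f s = (\<Sum>s'\<in>pure_states A. f s' * absorb s' s)" using s by (simp add: H_pure)
qed

lemma H_eq_absorb:
  assumes "continuous_on (states A) f" "s \<in> pure_states A" "z \<in> states A"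
    and "\<And>s'. s' \<in> pure_states A \<Longrightarrow> f s' = (if s' = s then 1 else 0)"
  shows "H f z = absorb s z"
proof -
  have "H f z = (\<Sum>s'\<in>pure_states A. if s' = s then absorb s z else 0)"
    unfolding H_eq_sum_absorb[OF assms(1,3)] using assms(4) by (intro sum.cong) auto
  then show ?thesis using assms(2) by simp
qed

lemma absorb_nonneg:
  assumes z: "z \<in> states A"
  shows "0 \<le> absorb s z"
proof -
  have "0 \<le> (P ^^ t) (bump 1 s) z" for t
    using z by (rule iterate.nonneg) (simp add: bump_def)
  then show ?thesis
    unfolding absorb_def by (intro LIMSEQ_le_const[OF iterate_tendsto[OF continuous_on_bump z]]) auto
qed

lemma sum_absorb:
  assumes "z \<in> states A"
  shows "(\<Sum>s\<in>pure_states A. absorb s z) = 1"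
proof -
  have "H (\<lambda>_. 1) z = 1" by (simp add: H_def iterate.const[OF assms])
  then show ?thesis using H_eq_sum_absorb[OF continuous_on_const assms, of 1] by simp
qed

lemma absorb_update_pos:
  assumes x: "x \<in> strategies" and \<alpha>: "\<alpha> \<in> profiles"
  shows "0 < absorb (pure \<alpha>) (update x \<alpha>)"
proof -
  let ?z = "update x \<alpha>" and ?h = "absorb (pure \<alpha>)"
  have z: "?z \<in> states A" using x \<alpha> by (rule update_states)
  have "1 - rate \<le> snd ?z i (\<alpha> i)" for i
  proof -
    have "1 - snd ?z i (\<alpha> i) = (1 - \<epsilon> * u i \<alpha>) * (1 - x i (\<alpha> i))"
      using update_minus_unitv[of x \<alpha> i "\<alpha> i"] by (simp add: unitv_def algebra_simps)
    also have "\<dots> \<le> rate * 1"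
      using rate_ge[OF \<alpha>, of i] rate_nonneg strategiesD(1,2)[OF x, of i "\<alpha> i"] by (intro mult_mono) auto
    finally show ?thesis by simp
  qed
  then obtain c where c_le: "0 < c" "\<And>m. c \<le> replay_prob \<alpha> m ?z"
    using replay_prob_uniformly_pos[of "1 - rate"] rate_less_1 \<alpha> z by (metis diff_gt_0_iff_gt)
  have "\<forall>\<^sub>F m in sequentially. \<forall>\<beta>\<in>profiles. \<forall>z\<in>states A. \<bar>?h (replay \<beta> m z) - ?h (pure \<beta>)\<bar> < 1 / 2"
    by (rule replay_uniformly_close[OF continuous_on_absorb]) simp
  then obtain m where "\<bar>?h (replay \<alpha> m ?z) - ?h (pure \<alpha>)\<bar> < 1 / 2"
    using \<alpha> z by (auto simp: eventually_sequentially)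
  moreover have "?h (pure \<alpha>) = 1" using \<alpha> by (simp add: absorb_pure pure_states_eq)
  ultimately have "0 < ?h (replay \<alpha> m ?z)" by linarith
  then have "0 < replay_prob \<alpha> m ?z * ?h (replay \<alpha> m ?z)"
    using c_le(1) c_le(2)[of m] by simp
  also have "\<dots> \<le> (P ^^ m) ?h ?z" using absorb_nonneg by (rule replay_prob_le_iterate[OF \<alpha> z])
  also have "\<dots> = ?h ?z" by (rule step.harmonic_funpow[OF harmonic_absorb z])
  finally show ?thesis .
qed

subsection \<open>The limiting chain on the pure states\<close>

definition limP :: "'i state \<Rightarrow> 'i state \<Rightarrow> real" where
  "limP s s' = Q (absorb s') s"

lemma limP_pos:
  assumes \<alpha>: "\<alpha> \<in> profiles" and b: "b \<in> A j"
  shows "0 < limP (pure \<alpha>) (pure (\<alpha>(j := b)))"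
proof -
  let ?\<beta> = "\<alpha>(j := b)" and ?x = "snd (pure \<alpha>)"
  let ?h = "absorb (pure ?\<beta>)"
  have \<beta>: "?\<beta> \<in> profiles" using \<alpha> b by (simp add: profiles_def)
  have z: "pure \<alpha> \<in> states A" using \<alpha> by (rule pure_in_states)
  have "0 < play_prob {j} ?x ?\<beta>"
    unfolding play_prob_def using b card_actions_pos
    by (intro prod_pos) (auto simp: tremble_def pure_def unitv_def)
  then have "0 < play_prob {j} ?x ?\<beta> * ?h (update ?x ?\<beta>)"
    using absorb_update_pos[OF snd_states[OF z] \<beta>] by simp
  also have "\<dots> \<le> step {j} ?h (pure \<alpha>)" by (rule step_ge_single[OF z absorb_nonneg \<beta>])
  finally have "0 < 1 / CARD('i) * step {j} ?h (pure \<alpha>)" by simp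
  also have "\<dots> \<le> limP (pure \<alpha>) (pure ?\<beta>)"
    unfolding limP_def Q_def
    by (intro member_le_sum[where f="\<lambda>j. 1 / CARD('i) * step {j} ?h (pure \<alpha>)"]
        mult_nonneg_nonneg step.nonneg z absorb_nonneg) auto
  finally show ?thesis .
qed

sublocale limP: irreducible_markov_chain "pure_states A" limP
proof
  fix s assume s: "s \<in> pure_states A"
  then have z: "s \<in> states A" by (rule pure_states_subset)
  show "0 \<le> limP s s'" for s'
    unfolding limP_def using z absorb_nonneg by (rule Q.nonneg)
  have "(\<Sum>s'\<in>pure_states A. limP s s') = Q (\<lambda>y. \<Sum>s'\<in>pure_states A. absorb s' y) s"
    unfolding limP_def by (rule Q.sum[OF z, symmetric])
  also have "\<dots> = Q (\<lambda>_. 1) s" by (rule Q.cong[OF z sum_absorb])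
  finally show "(\<Sum>s'\<in>pure_states A. limP s s') = 1" by (simp add: Q.const[OF z])
  fix s' assume s': "s' \<in> pure_states A"
  let ?E = "{(r, r'). r \<in> pure_states A \<and> r' \<in> pure_states A \<and> 0 < limP r r'}"
  obtain \<alpha> \<beta> where \<alpha>: "s = pure \<alpha>" "\<alpha> \<in> profiles" and \<beta>: "s' = pure \<beta>" "\<beta> \<in> profiles"
    using s s' by (auto simp: pure_states_eq)
  have "(s, pure (override_on \<alpha> \<beta> J)) \<in> ?E\<^sup>*" if "finite J" for J
    using that
  proof (induction J rule: finite_induct)
    case (insert j J)
    let ?\<gamma> = "override_on \<alpha> \<beta> J"
    have \<gamma>: "?\<gamma> \<in> profiles" using \<alpha> \<beta> by (auto simp: profiles_def override_on_def)
    have override_insert: "override_on \<alpha> \<beta> (insert j J) = ?\<gamma>(j := \<beta> j)" by (auto simp: override_on_def)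
    have "?\<gamma>(j := \<beta> j) \<in> profiles" using \<gamma> \<beta>(2) by (simp add: profiles_def)
    then have "(pure ?\<gamma>, pure (?\<gamma>(j := \<beta> j))) \<in> ?E"
      using \<gamma> limP_pos[OF \<gamma> profilesD[OF \<beta>(2)]] by (simp add: pure_states_eq)
    then show ?case unfolding override_insert by (rule rtrancl_into_rtrancl[OF insert.IH])
  qed (simp add: \<alpha>(1))
  from this[of UNIV] show "(s, s') \<in> ?E\<^sup>*" by (simp add: \<beta>(1) override_on_def)
qed simp

subsection \<open>Kernels and operators\<close>

lemma pmf_embed_strategy:
  assumes "x \<in> strategies"
  shows "pmf (embed_pmf (x i)) a = x i a"
proof (rule pmf_embed_pmf)
  show "0 \<le> x i a" for a using assms by (rule strategiesD)
  have "(\<integral>\<^sup>+a. ennreal (x i a) \<partial>count_space UNIV)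
      = (\<integral>\<^sup>+a. ennreal (x i a) * indicator (A i) a \<partial>count_space UNIV)"
    using strategiesD(3)[OF assms] by (intro nn_integral_cong) (auto simp: indicator_def)
  also have "\<dots> = (\<Sum>a\<in>A i. ennreal (x i a))"
    by (subst nn_integral_indicator_finite) auto
  also have "\<dots> = 1" using strategiesD(1,4)[OF assms, of i] by (subst sum_ennreal) auto
  finally show "(\<integral>\<^sup>+a. ennreal (x i a) \<partial>count_space UNIV) = 1" .
qed

lemma set_Pi_pmf_profiles:
  assumes "q \<in> strategies" "\<And>i a. pmf (p i) a = q i a"
  shows "set_pmf (Pi_pmf UNIV 0 p) \<subseteq> profiles"
proof -
  have "set_pmf (p i) \<subseteq> A i" for i
    using strategiesD(3)[OF assms(1)] assms(2) by (metis set_pmf_iff subsetI)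
  then have "PiE_dflt UNIV 0 (set_pmf \<circ> p) \<subseteq> profiles"
    by (auto simp: PiE_dflt_def profiles_def)
  then show ?thesis using set_Pi_pmf_subset'[of UNIV 0 p] by simp
qed

lemma expectation_Pi_pmf_profiles:
  fixes g :: "('i \<Rightarrow> nat) \<Rightarrow> real"
  assumes "q \<in> strategies" "\<And>i a. pmf (p i) a = q i a"
  shows "measure_pmf.expectation (Pi_pmf UNIV 0 p) g = (\<Sum>\<alpha>\<in>profiles. (\<Prod>i\<in>UNIV. q i (\<alpha> i)) * g \<alpha>)"
proof -
  have "measure_pmf.expectation (Pi_pmf UNIV 0 p) g = (\<Sum>\<alpha>\<in>profiles. g \<alpha> * pmf (Pi_pmf UNIV 0 p) \<alpha>)"
    using set_Pi_pmf_profiles[OF assms] by (intro integral_measure_pmf_real) auto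
  also have "\<dots> = (\<Sum>\<alpha>\<in>profiles. (\<Prod>i\<in>UNIV. q i (\<alpha> i)) * g \<alpha>)"
    by (intro sum.cong refl, subst pmf_Pi') (simp_all add: assms(2))
  finally show ?thesis .
qed

definition perturbed :: "real \<Rightarrow> ('i \<Rightarrow> nat \<Rightarrow> real) \<Rightarrow> 'i \<Rightarrow> nat \<Rightarrow> real" where
  "perturbed l x i a = l * tremble UNIV x i a + (1 - l) * x i a"

lemma perturbed_strategies:
  assumes "x \<in> strategies" "0 \<le> l" "l \<le> 1"
  shows "perturbed l x \<in> strategies"
  using strategiesD[OF assms(1)] strategiesD[OF tremble_strategies[OF assms(1), of UNIV]] assms(2,3)
  by (intro strategiesI) (simp_all add: perturbed_def sum.distrib flip: sum_distrib_left)

lemma pmf_perturbed: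
  assumes "x \<in> strategies" "0 \<le> l" "l \<le> 1"
  shows "pmf (bernoulli_pmf l \<bind> (\<lambda>b. if b then pmf_of_set (A i) else embed_pmf (x i))) a = perturbed l x i a"
  using assms(2,3) by (simp add: pmf_bind pmf_embed_strategy[OF assms(1)] perturbed_def tremble_def)

lemma prod_perturbed:
  "(\<Prod>i\<in>UNIV. perturbed l x i (\<alpha> i)) = (\<Sum>J\<in>UNIV. l ^ card J * (1 - l) ^ card (- J) * play_prob J x \<alpha>)"
proof -
  have "(\<Prod>i\<in>UNIV. perturbed l x i (\<alpha> i)) =
      (\<Sum>J\<in>UNIV. (\<Prod>i\<in>J. l * tremble UNIV x i (\<alpha> i)) * (\<Prod>i\<in>- J. (1 - l) * x i (\<alpha> i)))"
    unfolding perturbed_def by (subst prod_add) (simp_all add: Compl_eq_Diff_UNIV)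
  also have "\<dots> = (\<Sum>J\<in>UNIV. l ^ card J * (1 - l) ^ card (- J) * play_prob J x \<alpha>)"
  proof (rule sum.cong[OF refl])
    fix J :: "'i set"
    have "play_prob J x \<alpha> = (\<Prod>i\<in>UNIV. if i \<in> J then tremble UNIV x i (\<alpha> i) else x i (\<alpha> i))"
      unfolding play_prob_def by (intro prod.cong) (auto simp: tremble_def)
    also have "\<dots> = (\<Prod>i\<in>J. tremble UNIV x i (\<alpha> i)) * (\<Prod>i\<in>- J. x i (\<alpha> i))"
      by (simp add: prod.If_cases)
    finally show "(\<Prod>i\<in>J. l * tremble UNIV x i (\<alpha> i)) * (\<Prod>i\<in>- J. (1 - l) * x i (\<alpha> i)) =
        l ^ card J * (1 - l) ^ card (- J) * play_prob J x \<alpha>"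
      by (simp add: prod.distrib mult_ac)
  qed
  finally show ?thesis .
qed

lemma expectation_pla_kernel:
  assumes z: "z \<in> states A" and l: "0 \<le> l" "l \<le> 1"
  shows "measure_pmf.expectation (pla_kernel A u \<epsilon> l z) f = T l f z"
proof -
  note x = snd_states[OF z]
  have "measure_pmf.expectation (pla_kernel A u \<epsilon> l z) f =
      (\<Sum>\<alpha>\<in>profiles. (\<Prod>i\<in>UNIV. perturbed l (snd z) i (\<alpha> i)) * f (update (snd z) \<alpha>))"
    unfolding pla_kernel_def integral_map_pmf
    by (rule expectation_Pi_pmf_profiles[OF perturbed_strategies[OF x l] pmf_perturbed[OF x l]])
  also have "\<dots> = T l f z"
    unfolding T_def step_def prod_perturbed sum_distrib_right sum_distrib_left mult.assoc by (rule sum.swap)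
  finally show ?thesis .
qed

lemma absorbing_pla_kernel:
  assumes l: "0 \<le> l" "l \<le> 1"
  shows "absorbing (pla_kernel A u \<epsilon> l) (states A)"
  unfolding absorbing_def
proof
  fix z assume "z \<in> states A"
  then have x: "snd z \<in> strategies" by (rule snd_states)
  show "set_pmf (pla_kernel A u \<epsilon> l z) \<subseteq> states A"
    using set_Pi_pmf_profiles[OF perturbed_strategies[OF x l] pmf_perturbed[OF x l]] update_states[OF x]
    unfolding pla_kernel_def set_map_pmf by blast
qed

definition embed :: "'i state \<Rightarrow> ('i \<Rightarrow> real) \<times> ('i \<Rightarrow> nat \<Rightarrow> real)" where
  "embed z = (\<lambda>i. real (fst z i), snd z)"

lemma feller_pla_kernel:
  assumes l: "0 \<le> l" "l \<le> 1"
  shows "feller_kernel (states A) embed (pla_kernel A u \<epsilon> l)"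
proof
  have "continuous_on UNIV (\<lambda>z::'i state. fst z i)" for i
    by (rule continuous_on_product_then_coordinatewise[OF continuous_on_fst[OF continuous_on_id]])
  then show "continuous_on UNIV embed"
    unfolding embed_def[abs_def]
    by (intro continuous_on_Pair continuous_on_coordinatewise_then_product continuous_on_of_nat
        continuous_on_snd continuous_on_id)
  show "inj embed"
    by (rule injI) (simp add: embed_def fun_eq_iff prod_eq_iff)
  show "continuous_on (states A) (\<lambda>z. measure_pmf.expectation (pla_kernel A u \<epsilon> l z) f)"
    if "continuous_on (states A) f" for f :: "'i state \<Rightarrow> real"
    using continuous_on_T[OF that, of l] by (simp add: expectation_pla_kernel l cong: continuous_on_cong)
qed (fact compact_states absorbing_pla_kernel[OF l])+

lemma T_0: "T 0 f z = P f z"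
proof -
  have "T 0 f z = (\<Sum>J\<in>(UNIV :: 'i set set). if J = {} then P f z else 0)"
    unfolding T_def by (intro sum.cong) (auto simp: card_gt_0_iff)
  then show ?thesis by simp
qed

lemma pmf_one_tremble:
  assumes "x \<in> strategies"
  shows "pmf (if i = j then pmf_of_set (A i) else embed_pmf (x i)) a = tremble {j} x i a"
  by (auto simp: tremble_def pmf_embed_strategy[OF assms])

lemma set_pmf_tremble_kernel:
  assumes "z \<in> states A"
  shows "set_pmf (tremble_kernel A u \<epsilon> z) \<subseteq> states A"
proof -
  note x = snd_states[OF assms]
  show ?thesis
    using set_Pi_pmf_profiles[OF tremble_strategies[OF x] pmf_one_tremble[OF x]] update_states[OF x]
    unfolding tremble_kernel_def by (auto simp: subset_iff)
qed

lemma expectation_tremble_kernel: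
  assumes z: "z \<in> states A" and f_bound: "\<And>y. y \<in> states A \<Longrightarrow> \<bar>f y\<bar> \<le> B"
  shows "measure_pmf.expectation (tremble_kernel A u \<epsilon> z) f = Q f z"
proof -
  note x = snd_states[OF z]
  let ?p = "\<lambda>j. Pi_pmf UNIV 0 (\<lambda>i. if i = j then pmf_of_set (A i) else embed_pmf (snd z i))"
  have "measure_pmf.expectation (tremble_kernel A u \<epsilon> z) f =
      measure_pmf.expectation (pmf_of_set UNIV)
        (\<lambda>j. measure_pmf.expectation (map_pmf (update (snd z)) (?p j)) f)"
    using set_pmf_tremble_kernel[OF z] f_bound unfolding tremble_kernel_def
    by (intro expectation_bind_pmf) blast
  also have "\<dots> = measure_pmf.expectation (pmf_of_set UNIV) (\<lambda>j. step {j} f z)"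
    unfolding integral_map_pmf expectation_Pi_pmf_profiles[OF tremble_strategies[OF x] pmf_one_tremble[OF x]]
    by (simp add: step_def play_prob_def)
  finally show ?thesis by (simp add: integral_pmf_of_set Q_def sum_divide_distrib)
qed

lemma QPt_eq:
  assumes z: "z \<in> states A"
  shows "QPt A u \<epsilon> t z D = Q ((P ^^ t) (indicator D)) z"
proof -
  have P_kernel: "absorbing (pla_kernel A u \<epsilon> 0) (states A)"
    "\<And>g z. z \<in> states A \<Longrightarrow> measure_pmf.expectation (pla_kernel A u \<epsilon> 0 z) g = P g z"
    by (simp_all add: absorbing_pla_kernel expectation_pla_kernel T_0)
  have "QPt A u \<epsilon> t z D = measure_pmf.expectation (tremble_kernel A u \<epsilon> z)
      (\<lambda>y. measure_pmf.expectation (kpow (pla_kernel A u \<epsilon> 0) t y) (indicator D))"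
  proof -
    have "QPt A u \<epsilon> t z D = measure_pmf.expectation
        (tremble_kernel A u \<epsilon> z \<bind> kpow (pla_kernel A u \<epsilon> 0) t) (indicator D)"
      by (simp add: QPt_def)
    also have "\<dots> = measure_pmf.expectation (tremble_kernel A u \<epsilon> z)
        (\<lambda>y. measure_pmf.expectation (kpow (pla_kernel A u \<epsilon> 0) t y) (indicator D))"
      by (rule expectation_bind_pmf[where B=1]) (simp add: indicator_def)
    finally show ?thesis .
  qed
  also have "\<dots> = measure_pmf.expectation (tremble_kernel A u \<epsilon> z) ((P ^^ t) (indicator D))"
    using expectation_kpow[OF P_kernel, of _ "indicator D" 1 t] set_pmf_tremble_kernel[OF z]
    by (intro expectation_cong_set_pmf) (auto simp: indicator_def)
  also have "\<dots> = Q ((P ^^ t) (indicator D)) z"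
  proof (rule expectation_tremble_kernel[OF z])
    show "\<bar>(P ^^ t) (indicator D) y\<bar> \<le> 1" if "y \<in> states A" for y
      using that by (rule iterate.bound) (simp add: indicator_def)
  qed
  finally show ?thesis .
qed

lemma Q_iterate_tendsto:
  assumes "continuous_on (states A) f" "z \<in> states A"
  shows "(\<lambda>t. Q ((P ^^ t) f) z) \<longlonglongrightarrow> Q (H f) z"
  unfolding Q_def using assms
  by (intro tendsto_sum tendsto_mult tendsto_const step_tendsto iterate_tendsto)

text \<open>The indicator of a neighbourhood is squeezed between two continuous functions that agree on
  the pure states, so both have the same limit.\<close>
lemma QPt_tendsto_limP:
  assumes radius: "0 < \<delta>" "\<delta> < 1 / 2" and s: "s \<in> pure_states A" and s': "s' \<in> pure_states A"
  shows "(\<lambda>t. QPt A u \<epsilon> t s (nbhd A \<delta> s')) \<longlonglongrightarrow> limP s s'"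
proof -
  let ?I = "indicat_real (nbhd A \<delta> s')"
  define hi where "hi z = min 1 (2 * bump (2 * \<delta>) s' z)" for z
  have z: "s \<in> states A" using s by (rule pure_states_subset)
  have lim: "(\<lambda>t. Q ((P ^^ t) f) s) \<longlonglongrightarrow> limP s s'"
    if "continuous_on (states A) f" "\<And>r. r \<in> pure_states A \<Longrightarrow> f r = (if r = s' then 1 else 0)" for f
    using Q_iterate_tendsto[OF that(1) z] Q.cong[OF z H_eq_absorb[OF that(1) s' _ that(2)]]
    by (simp add: limP_def)
  have lower: "(\<lambda>t. Q ((P ^^ t) (bump \<delta> s')) s) \<longlonglongrightarrow> limP s s'"
    using radius s' by (intro lim continuous_on_bump bump_pure) auto
  have "continuous_on (states A) hi"
    unfolding hi_def by (intro continuous_on_min continuous_on_mult continuous_on_const continuous_on_bump)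
  then have upper: "(\<lambda>t. Q ((P ^^ t) hi) s) \<longlonglongrightarrow> limP s s'"
    using radius s' by (intro lim) (simp_all add: hi_def bump_pure)
  have squeeze: "bump \<delta> s' y \<le> ?I y" "?I y \<le> hi y" if "y \<in> states A" for y
    using that radius strat_dist_nonneg[of "snd y" "snd s'"]
    by (auto simp: indicator_def nbhd_def hi_def bump_def field_simps)
  show ?thesis
    unfolding QPt_eq[OF z]
    by (rule tendsto_sandwich[OF _ _ lower upper])
       (intro always_eventually allI Q.mono[OF z] iterate.mono squeeze; assumption)+
qed

subsection \<open>Small perturbations\<close>

definition tremble_weight :: "real \<Rightarrow> nat \<Rightarrow> real" where
  "tremble_weight l k = l ^ k * (1 - l) ^ (CARD('i) - k)"

lemma T_eq: "T l f z = (\<Sum>J\<in>UNIV. tremble_weight l (card J) * step J f z)"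
  by (simp add: T_def tremble_weight_def card_Diff_subset Compl_eq_Diff_UNIV)

lemma sum_tremble_weight: "(\<Sum>J\<in>(UNIV :: 'i set set). tremble_weight l (card J)) = 1"
proof -
  have "(1::real) = (\<Prod>i\<in>(UNIV :: 'i set). l + (1 - l))" by simp
  also have "\<dots> = (\<Sum>J\<in>(UNIV :: 'i set set). tremble_weight l (card J))"
    by (subst prod_add) (simp_all add: tremble_weight_def card_Diff_subset)
  finally show ?thesis ..
qed

lemma tremble_weight_0_ge: "l \<le> 1 \<Longrightarrow> 1 - real CARD('i) * l \<le> tremble_weight l 0"
  using Bernoulli_inequality[of "- l" "CARD('i)"] by (simp add: tremble_weight_def)

lemma tremble_weight_1_bounds:
  assumes "0 \<le> l" "l \<le> 1"
  shows "l * (1 - real CARD('i) * l) \<le> tremble_weight l 1" "tremble_weight l 1 \<le> l"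
proof -
  have "1 - real CARD('i) * l \<le> 1 - (CARD('i) - 1 :: nat) * l"
    using assms by (simp add: mult_right_mono)
  also have "\<dots> \<le> (1 - l) ^ (CARD('i) - 1)"
    using Bernoulli_inequality[of "- l" "CARD('i) - 1"] assms by simp
  finally show "l * (1 - real CARD('i) * l) \<le> tremble_weight l 1"
    using assms by (simp add: tremble_weight_def mult_left_mono)
  show "tremble_weight l 1 \<le> l"
    using assms by (simp add: tremble_weight_def mult_left_le power_le_one)
qed

lemma several_trembles_eq:
  "(\<Sum>J | 2 \<le> card (J :: 'i set). tremble_weight l (card J)) =
    1 - tremble_weight l 0 - real CARD('i) * tremble_weight l 1"
  using sum_subsets_by_card[of "\<lambda>J :: 'i set. tremble_weight l (card J)"] sum_tremble_weight[of l]
  by simp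

lemma several_trembles_le:
  assumes "0 \<le> l" "l \<le> 1"
  shows "1 - tremble_weight l 0 - real CARD('i) * tremble_weight l 1 \<le> (real CARD('i))\<^sup>2 * l\<^sup>2"
proof -
  have "real CARD('i) * (l * (1 - real CARD('i) * l)) \<le> real CARD('i) * tremble_weight l 1"
    using tremble_weight_1_bounds(1)[OF assms] by (intro mult_left_mono) auto
  then show ?thesis
    using tremble_weight_0_ge[OF assms(2)] by (simp add: algebra_simps power2_eq_square)
qed

lemma T_first_order:
  assumes z: "z \<in> states A" and f_bound: "\<And>y. y \<in> states A \<Longrightarrow> \<bar>f y\<bar> \<le> B" and l: "0 \<le> l" "l \<le> 1"
  shows "\<bar>T l f z - (tremble_weight l 0 * P f z + real CARD('i) * tremble_weight l 1 * Q f z)\<bar>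
    \<le> B * ((real CARD('i))\<^sup>2 * l\<^sup>2)"
proof -
  have "0 \<le> B" using f_bound[OF z] by linarith
  have weight: "0 \<le> tremble_weight l k" for k using l by (simp add: tremble_weight_def)
  have "T l f z = tremble_weight l 0 * P f z + real CARD('i) * tremble_weight l 1 * Q f z
      + (\<Sum>J | 2 \<le> card J. tremble_weight l (card J) * step J f z)"
    unfolding T_eq by (subst sum_subsets_by_card) (simp add: Q_def flip: sum_distrib_left sum_divide_distrib)
  then have "\<bar>T l f z - (tremble_weight l 0 * P f z + real CARD('i) * tremble_weight l 1 * Q f z)\<bar>
      \<le> (\<Sum>J | 2 \<le> card J. \<bar>tremble_weight l (card J) * step J f z\<bar>)"
    using sum_abs by simp
  also have "\<dots> \<le> (\<Sum>J | 2 \<le> card (J :: 'i set). tremble_weight l (card J) * B)"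
    unfolding abs_mult using weight step.bound[OF z f_bound] by (intro sum_mono mult_mono) auto
  also have "\<dots> = B * (1 - tremble_weight l 0 - real CARD('i) * tremble_weight l 1)"
    unfolding sum_distrib_right[symmetric] several_trembles_eq by (rule mult.commute)
  also have "\<dots> \<le> B * ((real CARD('i))\<^sup>2 * l\<^sup>2)"
    using several_trembles_le[OF l] \<open>0 \<le> B\<close> by (rule mult_left_mono)
  finally show ?thesis .
qed

lemma abs_T_minus_P_le:
  assumes z: "z \<in> states A" and f_bound: "\<And>y. y \<in> states A \<Longrightarrow> \<bar>f y\<bar> \<le> B" and l: "0 \<le> l" "l \<le> 1"
  shows "\<bar>T l f z - P f z\<bar> \<le> ((real CARD('i))\<^sup>2 + 2 * real CARD('i)) * B * l"
proof -
  let ?n = "real CARD('i)" and ?a = "tremble_weight l 0" and ?b = "tremble_weight l 1"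
  have "0 \<le> B" using f_bound[OF z] by linarith
  have "?a \<le> 1" using l by (simp add: tremble_weight_def power_le_one)
  then have "\<bar>1 - ?a\<bar> \<le> ?n * l" using tremble_weight_0_ge[OF l(2)] by simp
  then have P_part: "\<bar>(1 - ?a) * P f z\<bar> \<le> ?n * l * B"
    unfolding abs_mult using step.bound[OF z f_bound] by (intro mult_mono) auto
  have "0 \<le> ?b" using l by (simp add: tremble_weight_def)
  then have "\<bar>?n * ?b\<bar> \<le> ?n * l" using tremble_weight_1_bounds(2)[OF l] by simp
  then have Q_part: "\<bar>?n * ?b * Q f z\<bar> \<le> ?n * l * B"
    unfolding abs_mult[of "?n * ?b"] using Q.bound[OF z f_bound] l by (intro mult_mono) auto
  have "B * (?n\<^sup>2 * l\<^sup>2) \<le> B * (?n\<^sup>2 * l)"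
    using l \<open>0 \<le> B\<close> by (intro mult_left_mono) (auto simp: power2_eq_square mult_left_le)
  then have first_order: "\<bar>T l f z - (?a * P f z + ?n * ?b * Q f z)\<bar> \<le> B * (?n\<^sup>2 * l)"
    using T_first_order[where f=f and B=B and l=l and z=z] z f_bound l by force
  have "T l f z - P f z = (T l f z - (?a * P f z + ?n * ?b * Q f z)) - (1 - ?a) * P f z + ?n * ?b * Q f z"
    by (simp add: algebra_simps)
  then have "\<bar>T l f z - P f z\<bar> \<le> \<bar>T l f z - (?a * P f z + ?n * ?b * Q f z)\<bar>
      + \<bar>(1 - ?a) * P f z\<bar> + \<bar>?n * ?b * Q f z\<bar>" by linarith
  also have "\<dots> \<le> B * (?n\<^sup>2 * l) + ?n * l * B + ?n * l * B"
    using first_order P_part Q_part by (intro add_mono)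
  finally show ?thesis by (simp add: algebra_simps)
qed

lemma states_borel: "states A \<in> sets borel"
  using feller_pla_kernel[of 0] by (auto simp: feller_kernel_def compact_metrizable.borel)

lemma borel_prob_on_states_iff:
  "borel_prob_on \<mu> (states A) \<longleftrightarrow> sets \<mu> = sets borel \<and> prob_space \<mu> \<and> emeasure \<mu> (states A) = 1"
  by (auto simp: borel_prob_on_def borel_prob_on_axioms_def compact_states states_borel)

definition invariant_family :: "(real \<Rightarrow> 'i state measure) \<Rightarrow> bool" where
  "invariant_family \<mu> \<longleftrightarrow> (\<forall>l. 0 < l \<and> l \<le> 1 \<longrightarrow>
     sets (\<mu> l) = sets borel \<and> prob_space (\<mu> l) \<and> emeasure (\<mu> l) (states A) = 1 \<and>
     invariant_measure (pla_kernel A u \<epsilon> l) (\<mu> l))"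

lemma invariant_family_exists: "\<exists>\<mu>. invariant_family \<mu>"
proof -
  have "states A \<noteq> {}" using profiles_nonempty pure_in_states by blast
  then have "\<exists>\<mu>. borel_prob_on \<mu> (states A) \<and> invariant_measure (pla_kernel A u \<epsilon> l) \<mu>"
    if "0 < l" "l \<le> 1" for l
    using feller_kernel.invariant_measure_exists[OF feller_pla_kernel, of l] that by (metis less_imp_le)
  then have "\<forall>l. \<exists>\<mu>. 0 < l \<and> l \<le> 1 \<longrightarrow>
      borel_prob_on \<mu> (states A) \<and> invariant_measure (pla_kernel A u \<epsilon> l) \<mu>" by blast
  then obtain \<mu> where "\<forall>l. 0 < l \<and> l \<le> 1 \<longrightarrow>
      borel_prob_on (\<mu> l) (states A) \<and> invariant_measure (pla_kernel A u \<epsilon> l) (\<mu> l)" by metis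
  then show ?thesis unfolding invariant_family_def borel_prob_on_states_iff by blast
qed

abbreviation mean :: "'i state measure \<Rightarrow> ('i state \<Rightarrow> real) \<Rightarrow> real" where
  "mean \<mu> f \<equiv> set_lebesgue_integral \<mu> (states A) f"

context
  fixes \<mu> :: "real \<Rightarrow> 'i state measure"
  assumes family: "invariant_family \<mu>"
begin

lemma borel_prob_on_family: "0 < l \<Longrightarrow> l \<le> 1 \<Longrightarrow> borel_prob_on (\<mu> l) (states A)"
  using family unfolding invariant_family_def borel_prob_on_states_iff by blast

lemma mean_T:
  assumes f: "continuous_on (states A) f" and l: "0 < l" "l \<le> 1"
  shows "mean (\<mu> l) (T l f) = mean (\<mu> l) f"
proof -
  interpret borel_prob_on "\<mu> l" "states A" using l by (rule borel_prob_on_family)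
  have "mean (\<mu> l) (T l f) = mean (\<mu> l) (\<lambda>z. measure_pmf.expectation (pla_kernel A u \<epsilon> l z) f)"
    using l X_borel by (intro set_lebesgue_integral_cong) (simp_all add: sets_eq expectation_pla_kernel)
  also have "\<dots> = mean (\<mu> l) f"
    using feller_kernel.invariant_measure_iff[OF feller_pla_kernel borel_prob_on_axioms, of l] family l f
    by (simp add: invariant_family_def)
  finally show ?thesis .
qed

lemma mean_diff:
  assumes "continuous_on (states A) f" "continuous_on (states A) g" "0 < l" "l \<le> 1"
  shows "mean (\<mu> l) (\<lambda>z. f z - g z) = mean (\<mu> l) f - mean (\<mu> l) g"
  using assms borel_prob_on.set_integrable_continuous[OF borel_prob_on_family]
  by (intro set_integral_diff)

lemma mean_P_asymptotic:
  assumes f: "continuous_on (states A) f"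
  shows "((\<lambda>l. mean (\<mu> l) f - mean (\<mu> l) (P f)) \<longlongrightarrow> 0) (at_right 0)"
proof -
  obtain B where B_bound: "\<And>z. z \<in> states A \<Longrightarrow> \<bar>f z\<bar> \<le> B"
    using continuous_on_compact_bound[OF compact_states f] by (metis real_norm_def)
  let ?C = "((real CARD('i))\<^sup>2 + 2 * real CARD('i)) * B"
  have "\<forall>\<^sub>F l in at_right 0. norm (mean (\<mu> l) f - mean (\<mu> l) (P f)) \<le> ?C * l"
    using eventually_at_right_0
  proof eventually_elim
    case (elim l)
    then have l: "0 < l" "l \<le> 1" by auto
    have "\<bar>mean (\<mu> l) (\<lambda>z. T l f z - P f z)\<bar> \<le> ?C * l"
      using l B_bound abs_T_minus_P_le[where f=f and B=B and l=l]
      by (intro borel_prob_on.abs_set_integral_le[OF borel_prob_on_family] continuous_on_diff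
          continuous_on_T continuous_on_step f) auto
    then show ?case
      by (simp add: mean_diff[OF continuous_on_T[OF f] continuous_on_step[OF f] l] mean_T[OF f l])
  qed
  moreover have "((\<lambda>l. ?C * l) \<longlongrightarrow> 0) (at_right 0)"
    by (intro tendsto_mult_right_zero tendsto_ident_at)
  ultimately show ?thesis by (rule Lim_null_comparison)
qed

lemma mean_iterate_asymptotic:
  assumes "continuous_on (states A) f"
  shows "((\<lambda>l. mean (\<mu> l) f - mean (\<mu> l) ((P ^^ t) f)) \<longlongrightarrow> 0) (at_right 0)"
proof (induction t)
  case (Suc t)
  from tendsto_add[OF Suc mean_P_asymptotic[OF continuous_on_iterate[OF assms, of t]]]
  show ?case by simp
qed simp

lemma mean_H_asymptotic:
  assumes f: "continuous_on (states A) f"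
  shows "((\<lambda>l. mean (\<mu> l) f - mean (\<mu> l) (H f)) \<longlongrightarrow> 0) (at_right 0)"
proof (rule tendstoI)
  fix e :: real assume "0 < e"
  then have "\<forall>\<^sub>F t in sequentially. \<forall>z\<in>states A. dist ((P ^^ t) f z) (H f z) < e / 2"
    using uniform_limitD[OF iterate_uniform_limit[OF f], of "e / 2"] by simp
  then obtain t where t_close: "\<And>z. z \<in> states A \<Longrightarrow> \<bar>(P ^^ t) f z - H f z\<bar> \<le> e / 2"
    unfolding eventually_sequentially dist_real_def by (meson less_imp_le order_refl)
  have "\<forall>\<^sub>F l in at_right 0. \<bar>mean (\<mu> l) f - mean (\<mu> l) ((P ^^ t) f)\<bar> < e / 2"
    using tendstoD[OF mean_iterate_asymptotic[OF f, of t], of "e / 2"] \<open>0 < e\<close> by simp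
  with eventually_at_right_0
  show "\<forall>\<^sub>F l in at_right 0. dist (mean (\<mu> l) f - mean (\<mu> l) (H f)) 0 < e"
  proof eventually_elim
    case (elim l)
    then have l: "0 < l" "l \<le> 1" by auto
    have "\<bar>mean (\<mu> l) (\<lambda>z. (P ^^ t) f z - H f z)\<bar> \<le> e / 2"
      using t_close by (intro borel_prob_on.abs_set_integral_le[OF borel_prob_on_family[OF l]]
          continuous_on_diff continuous_on_iterate continuous_on_H f)
    then have "\<bar>mean (\<mu> l) ((P ^^ t) f) - mean (\<mu> l) (H f)\<bar> \<le> e / 2"
      by (simp only: mean_diff[OF continuous_on_iterate[OF f] continuous_on_H[OF f] l])
    then show ?case using elim(2) unfolding dist_real_def by linarith
  qed
qed

lemma single_tremble_mean_harmonic_le: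
  assumes h: "continuous_on (states A) h" "step.harmonic {} h" and B_bound: "\<And>z. z \<in> states A \<Longrightarrow> \<bar>h z\<bar> \<le> B"
    and l: "0 < l" "l \<le> 1"
  shows "\<bar>real CARD('i) * tremble_weight l 1 * (mean (\<mu> l) h - mean (\<mu> l) (Q h))\<bar>
    \<le> 2 * B * (real CARD('i) * l)\<^sup>2"
proof -
  interpret borel_prob_on "\<mu> l" "states A" using l by (rule borel_prob_on_family)
  let ?n = "real CARD('i)" and ?a = "tremble_weight l 0" and ?b = "tremble_weight l 1"
  let ?h = "mean (\<mu> l) h" and ?Q = "mean (\<mu> l) (Q h)"
  have "\<bar>mean (\<mu> l) (\<lambda>z. T l h z - (?a * h z + ?n * ?b * Q h z))\<bar> \<le> B * (?n\<^sup>2 * l\<^sup>2)"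
    using T_first_order[where f=h and B=B and l=l] h(2) B_bound l
    by (intro abs_set_integral_le continuous_on_diff continuous_on_add continuous_on_mult continuous_on_const
        continuous_on_T continuous_on_Q h(1)) (auto simp: step.harmonic_def)
  also have "mean (\<mu> l) (\<lambda>z. T l h z - (?a * h z + ?n * ?b * Q h z)) = ?h - (?a * ?h + ?n * ?b * ?Q)"
    using set_integrable_continuous[OF h(1)] set_integrable_continuous[OF continuous_on_Q[OF h(1)]]
      set_integrable_continuous[OF continuous_on_T[OF h(1)]] mean_T[OF h(1) l]
    by (simp add: set_integral_diff set_integral_add)
  finally have first_order: "\<bar>?h - (?a * ?h + ?n * ?b * ?Q)\<bar> \<le> B * (?n\<^sup>2 * l\<^sup>2)" .
  have "0 \<le> 1 - ?a - ?n * ?b"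
    unfolding several_trembles_eq[symmetric] using l by (intro sum_nonneg) (simp add: tremble_weight_def)
  then have several: "\<bar>(1 - ?a - ?n * ?b) * ?h\<bar> \<le> ?n\<^sup>2 * l\<^sup>2 * B"
    unfolding abs_mult using several_trembles_le[of l] abs_set_integral_le[OF h(1) B_bound] l
    by (intro mult_mono) auto
  have "?n * ?b * (?h - ?Q) = (?h - (?a * ?h + ?n * ?b * ?Q)) - (1 - ?a - ?n * ?b) * ?h"
    by (simp add: algebra_simps)
  then have "\<bar>?n * ?b * (?h - ?Q)\<bar>
      \<le> \<bar>?h - (?a * ?h + ?n * ?b * ?Q)\<bar> + \<bar>(1 - ?a - ?n * ?b) * ?h\<bar>" by linarith
  also have "\<dots> \<le> B * (?n\<^sup>2 * l\<^sup>2) + ?n\<^sup>2 * l\<^sup>2 * B" using first_order several by (rule add_mono)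
  finally show ?thesis by (simp add: power_mult_distrib mult_ac)
qed

lemma abs_mean_harmonic_minus_mean_Q_le:
  assumes h: "continuous_on (states A) h" "step.harmonic {} h" and B_bound: "\<And>z. z \<in> states A \<Longrightarrow> \<bar>h z\<bar> \<le> B"
    and l: "0 < l" "l \<le> 1" "real CARD('i) * l \<le> 1 / 2"
  shows "\<bar>mean (\<mu> l) h - mean (\<mu> l) (Q h)\<bar> \<le> 4 * real CARD('i) * B * l"
proof -
  let ?n = "real CARD('i)" and ?b = "tremble_weight l 1" and ?d = "mean (\<mu> l) h - mean (\<mu> l) (Q h)"
  have "l * (1 / 2) \<le> l * (1 - ?n * l)" using l by (intro mult_left_mono) auto
  also have "\<dots> \<le> ?b" using l by (intro tremble_weight_1_bounds) auto
  finally have "l / 2 \<le> \<bar>?b\<bar>" by simp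
  then have "?n * (l / 2) \<le> \<bar>?n * ?b\<bar>" unfolding abs_mult by (simp add: mult_left_mono)
  then have "?n * (l / 2) * \<bar>?d\<bar> \<le> \<bar>?n * ?b * ?d\<bar>"
    unfolding abs_mult[of _ ?d] by (rule mult_right_mono) simp
  also have "\<dots> \<le> 2 * B * (?n * l)\<^sup>2"
    using B_bound l by (intro single_tremble_mean_harmonic_le h)
  finally have "(?n * l / 2) * \<bar>?d\<bar> \<le> (?n * l / 2) * (4 * ?n * B * l)"
    by (simp add: power2_eq_square mult_ac)
  moreover have "0 < ?n * l / 2" using l by simp
  ultimately show ?thesis by (rule mult_left_le_imp_le)
qed

lemma mean_harmonic_asymptotic:
  assumes h: "continuous_on (states A) h" "step.harmonic {} h"
  shows "((\<lambda>l. mean (\<mu> l) h - mean (\<mu> l) (Q h)) \<longlongrightarrow> 0) (at_right 0)"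
proof -
  obtain B where B_bound: "\<And>z. z \<in> states A \<Longrightarrow> \<bar>h z\<bar> \<le> B"
    using continuous_on_compact_bound[OF compact_states h(1)] by (metis real_norm_def)
  have "\<forall>\<^sub>F l in at_right 0. real CARD('i) * l \<le> 1 / 2"
    unfolding eventually_at_right_field by (intro exI[of _ "1 / (2 * real CARD('i))"])
       (auto simp: field_simps)
  with eventually_at_right_0
  have "\<forall>\<^sub>F l in at_right 0. norm (mean (\<mu> l) h - mean (\<mu> l) (Q h)) \<le> 4 * real CARD('i) * B * l"
    by eventually_elim (use abs_mean_harmonic_minus_mean_Q_le[OF h B_bound] in auto)
  moreover have "((\<lambda>l. 4 * real CARD('i) * B * l) \<longlongrightarrow> 0) (at_right 0)"
    by (intro tendsto_mult_right_zero tendsto_ident_at)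
  ultimately show ?thesis by (rule Lim_null_comparison)
qed

definition absorption_vector :: "real \<Rightarrow> 'i state \<Rightarrow> real" where
  "absorption_vector l s = (if s \<in> pure_states A then mean (\<mu> l) (absorb s) else 0)"

lemma mean_sum_absorb:
  assumes "0 < l" "l \<le> 1"
  shows "mean (\<mu> l) (\<lambda>z. \<Sum>s\<in>pure_states A. c s * absorb s z) =
    (\<Sum>s\<in>pure_states A. c s * absorption_vector l s)"
proof -
  interpret borel_prob_on "\<mu> l" "states A" using assms by (rule borel_prob_on_family)
  have "mean (\<mu> l) (\<lambda>z. \<Sum>s\<in>pure_states A. c s * absorb s z) =
      (\<Sum>s\<in>pure_states A. mean (\<mu> l) (\<lambda>z. c s * absorb s z))"
    using set_integrable_continuous[OF continuous_on_mult[OF continuous_on_const continuous_on_absorb]]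
    unfolding set_lebesgue_integral_def set_integrable_def scaleR_sum_right
    by (intro Bochner_Integration.integral_sum)
  then show ?thesis by (simp add: absorption_vector_def)
qed

lemma mean_H:
  assumes "continuous_on (states A) f" "0 < l" "l \<le> 1"
  shows "mean (\<mu> l) (H f) = (\<Sum>s\<in>pure_states A. f s * absorption_vector l s)"
proof -
  interpret borel_prob_on "\<mu> l" "states A" using assms(2,3) by (rule borel_prob_on_family)
  have "mean (\<mu> l) (H f) = mean (\<mu> l) (\<lambda>z. \<Sum>s\<in>pure_states A. f s * absorb s z)"
    using X_borel H_eq_sum_absorb[OF assms(1)] by (intro set_lebesgue_integral_cong) (simp_all add: sets_eq)
  then show ?thesis using mean_sum_absorb[OF assms(2,3)] by simp
qed

lemma absorption_vector_prob:
  assumes "0 < l" "l \<le> 1"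
  shows "absorption_vector l \<in> prob_vectors (pure_states A)"
proof -
  interpret borel_prob_on "\<mu> l" "states A" using assms by (rule borel_prob_on_family)
  have "0 \<le> mean (\<mu> l) (absorb s)" for s
    using set_integral_mono_continuous[OF continuous_on_const continuous_on_absorb, of 0 s] absorb_nonneg
    by (simp add: set_integral_const)
  moreover have "(\<Sum>s\<in>pure_states A. absorption_vector l s) = mean (\<mu> l) (\<lambda>_. 1)"
    using mean_sum_absorb[OF assms, of "\<lambda>_. 1"] X_borel sum_absorb
      set_lebesgue_integral_cong[of "states A" "\<mu> l" "\<lambda>z. \<Sum>s\<in>pure_states A. absorb s z" "\<lambda>_. 1"]
    by (simp add: sets_eq)
  ultimately show ?thesis
    by (simp add: prob_vectors_def absorption_vector_def set_integral_const)
qed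

lemma absorption_vector_defect: "((\<lambda>l. limP.defect (absorption_vector l)) \<longlongrightarrow> 0) (at_right 0)"
proof -
  let ?d = "\<lambda>l s'. (\<Sum>s\<in>pure_states A. absorption_vector l s * limP s s') - absorption_vector l s'"
  have "((\<lambda>l. ?d l s') \<longlongrightarrow> 0) (at_right 0)" if s': "s' \<in> pure_states A" for s'
  proof -
    let ?h = "absorb s'"
    have "((\<lambda>l. - ((mean (\<mu> l) ?h - mean (\<mu> l) (Q ?h)) + (mean (\<mu> l) (Q ?h) - mean (\<mu> l) (H (Q ?h)))))
        \<longlongrightarrow> - (0 + 0)) (at_right 0)"
      by (intro tendsto_minus tendsto_add mean_harmonic_asymptotic mean_H_asymptotic continuous_on_Q
          continuous_on_absorb harmonic_absorb)
    moreover have "\<forall>\<^sub>F l in at_right 0.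
        - ((mean (\<mu> l) ?h - mean (\<mu> l) (Q ?h)) + (mean (\<mu> l) (Q ?h) - mean (\<mu> l) (H (Q ?h)))) = ?d l s'"
      using eventually_at_right_0
      by eventually_elim
         (simp add: mean_H continuous_on_Q continuous_on_absorb limP_def absorption_vector_def
            s' mult.commute)
    ultimately show ?thesis by (simp add: Lim_transform_eventually)
  qed
  then have "((\<lambda>l. \<Sum>s'\<in>pure_states A. \<bar>?d l s'\<bar>) \<longlongrightarrow> (\<Sum>s'\<in>pure_states A. 0)) (at_right 0)"
    by (intro tendsto_sum tendsto_rabs_zero)
  then show ?thesis by (simp add: limP.defect_def)
qed

lemma eventually_absorption_vector_prob:
  "\<forall>\<^sub>F l in at_right 0. absorption_vector l \<in> prob_vectors (pure_states A)"
  using eventually_at_right_0 by eventually_elim (simp add: absorption_vector_prob)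

lemma stationary_exists: "\<exists>\<pi>. limP.stationary \<pi>"
  by (rule limP.stationary_exists[OF trivial_limit_at_right_real eventually_absorption_vector_prob
        absorption_vector_defect]) blast

lemma mean_tendsto:
  assumes f: "continuous_on (states A) f" and \<pi>: "limP.stationary \<pi>"
  shows "((\<lambda>l. mean (\<mu> l) f) \<longlongrightarrow> (\<Sum>s\<in>pure_states A. \<pi> s * f s)) (at_right 0)"
proof -
  have "((\<lambda>l. (mean (\<mu> l) f - mean (\<mu> l) (H f)) + (\<Sum>s\<in>pure_states A. absorption_vector l s * f s))
      \<longlongrightarrow> 0 + (\<Sum>s\<in>pure_states A. \<pi> s * f s)) (at_right 0)"
    by (intro tendsto_add mean_H_asymptotic f tendsto_sum tendsto_mult tendsto_const
        limP.tendsto_stationary[OF \<pi> eventually_absorption_vector_prob absorption_vector_defect])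
  moreover have "\<forall>\<^sub>F l in at_right 0. (mean (\<mu> l) f - mean (\<mu> l) (H f))
      + (\<Sum>s\<in>pure_states A. absorption_vector l s * f s) = mean (\<mu> l) f"
    using eventually_at_right_0 by eventually_elim (simp add: mean_H f mult.commute)
  ultimately show ?thesis by (simp add: Lim_transform_eventually)
qed

end

definition weak_limit :: "(real \<Rightarrow> 'i state measure) \<Rightarrow> ('i state \<Rightarrow> real) \<Rightarrow> bool" where
  "weak_limit \<mu> \<pi> \<longleftrightarrow> (\<forall>f :: 'i state \<Rightarrow> real. continuous_on UNIV f \<and> bounded (range f) \<longrightarrow>
     ((\<lambda>l. integral\<^sup>L (\<mu> l) f) \<longlongrightarrow> (\<Sum>s\<in>pure_states A. \<pi> s * f s)) (at_right 0))"

definition hatP_stationary :: "('i state \<Rightarrow> real) \<Rightarrow> bool" where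
  "hatP_stationary \<pi> \<longleftrightarrow> (\<exists>\<delta>0 > 0. \<forall>\<delta>. 0 < \<delta> \<and> \<delta> < \<delta>0 \<longrightarrow>
     (\<forall>s\<in>pure_states A. \<forall>s'\<in>pure_states A. convergent (\<lambda>t. QPt A u \<epsilon> t s (nbhd A \<delta> s'))) \<and>
     (\<forall>s\<in>pure_states A. (\<Sum>s'\<in>pure_states A. hatP A u \<epsilon> \<delta> s s') = 1) \<and>
     (\<forall>s'\<in>pure_states A. (\<Sum>s\<in>pure_states A. \<pi> s * hatP A u \<epsilon> \<delta> s s') = \<pi> s'))"

lemma weak_limit_stationary:
  assumes \<mu>: "invariant_family \<mu>" and \<pi>: "limP.stationary \<pi>"
  shows "weak_limit \<mu> \<pi>"
  unfolding weak_limit_def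
proof (intro allI impI)
  fix f :: "'i state \<Rightarrow> real" assume "continuous_on UNIV f \<and> bounded (range f)"
  then have f: "continuous_on UNIV f" by simp
  have "\<forall>\<^sub>F l in at_right 0. mean (\<mu> l) f = integral\<^sup>L (\<mu> l) f"
    using eventually_at_right_0
    by eventually_elim
       (simp add: borel_prob_on.integral_eq_set_integral[OF borel_prob_on_family[OF \<mu>]]
          borel_measurable_continuous_onI[OF f])
  moreover have "continuous_on (states A) f" using f by (rule continuous_on_subset) simp
  ultimately show "((\<lambda>l. integral\<^sup>L (\<mu> l) f) \<longlongrightarrow> (\<Sum>s\<in>pure_states A. \<pi> s * f s)) (at_right 0)"
    by (intro Lim_transform_eventually[OF mean_tendsto[OF \<mu> _ \<pi>]])
qed

lemma hatP_eq_limP: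
  "0 < \<delta> \<Longrightarrow> \<delta> < 1 / 2 \<Longrightarrow> s \<in> pure_states A \<Longrightarrow> s' \<in> pure_states A \<Longrightarrow> hatP A u \<epsilon> \<delta> s s' = limP s s'"
  unfolding hatP_def by (rule limI[OF QPt_tendsto_limP])

lemma hatP_stationary_iff: "hatP_stationary \<pi> \<longleftrightarrow> limP.left_invariant \<pi>"
proof
  assume "hatP_stationary \<pi>"
  then obtain \<delta>0 where "0 < \<delta>0" and \<delta>0: "\<And>\<delta>. 0 < \<delta> \<Longrightarrow> \<delta> < \<delta>0 \<Longrightarrow>
      \<forall>s'\<in>pure_states A. (\<Sum>s\<in>pure_states A. \<pi> s * hatP A u \<epsilon> \<delta> s s') = \<pi> s'"
    unfolding hatP_stationary_def by blast
  define \<delta> where "\<delta> = min \<delta>0 (1 / 2) / 2"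
  have "0 < \<delta>" "\<delta> < \<delta>0" "\<delta> < 1 / 2" using \<open>0 < \<delta>0\<close> by (auto simp: \<delta>_def min_def)
  then show "limP.left_invariant \<pi>"
    using \<delta>0[of \<delta>] by (simp add: limP.left_invariant_def hatP_eq_limP cong: sum.cong)
next
  assume \<pi>: "limP.left_invariant \<pi>"
  have "convergent (\<lambda>t. QPt A u \<epsilon> t s (nbhd A \<delta> s'))"
    if "0 < \<delta>" "\<delta> < 1 / 2" "s \<in> pure_states A" "s' \<in> pure_states A" for \<delta> s s'
    using QPt_tendsto_limP[OF that] by (rule convergentI)
  then show "hatP_stationary \<pi>"
    unfolding hatP_stationary_def using \<pi>
    by (intro exI[of _ "1 / 2"]) (simp add: limP.left_invariant_def limP.row_sum hatP_eq_limP cong: sum.cong)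
qed

theorem limit_distribution_unique:
  "\<exists>!\<pi>. \<pi> \<in> prob_vectors (pure_states A) \<and> (\<forall>\<mu>. invariant_family \<mu> \<longrightarrow> weak_limit \<mu> \<pi> \<and> hatP_stationary \<pi>)"
proof -
  obtain \<mu> where \<mu>: "invariant_family \<mu>" using invariant_family_exists by blast
  obtain \<pi> where \<pi>: "limP.stationary \<pi>" using stationary_exists[OF \<mu>] by blast
  show ?thesis
  proof (rule ex1I[of _ \<pi>])
    show "\<pi> \<in> prob_vectors (pure_states A) \<and>
        (\<forall>\<mu>. invariant_family \<mu> \<longrightarrow> weak_limit \<mu> \<pi> \<and> hatP_stationary \<pi>)"
      using \<pi> weak_limit_stationary by (auto simp: hatP_stationary_iff limP.stationary_def)
    show "\<rho> = \<pi>" if "\<rho> \<in> prob_vectors (pure_states A) \<and>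
        (\<forall>\<mu>. invariant_family \<mu> \<longrightarrow> weak_limit \<mu> \<rho> \<and> hatP_stationary \<rho>)" for \<rho>
    proof (rule limP.stationary_unique[OF _ \<pi>])
      show "limP.stationary \<rho>" using that \<mu> by (auto simp: limP.stationary_def hatP_stationary_iff)
    qed
  qed
qed

end

theorem theorem3p1:
  fixes A :: "'i::finite \<Rightarrow> nat set"
    and u :: "'i \<Rightarrow> ('i \<Rightarrow> nat) \<Rightarrow> real"
    and \<epsilon> :: real
  assumes fin: "\<forall>i. finite (A i) \<and> A i \<noteq> {}"
    and upos: "\<forall>i \<alpha>. (\<forall>j. \<alpha> j \<in> A j) \<longrightarrow> 0 < u i \<alpha>"
    and eps: "\<epsilon> > 0"
    and eps_small: "\<forall>i \<alpha>. (\<forall>j. \<alpha> j \<in> A j) \<longrightarrow> 0 < \<epsilon> * u i \<alpha> \<and> \<epsilon> * u i \<alpha> < 1"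
  shows "\<exists>!\<pi> :: 'i state \<Rightarrow> real.
     (\<forall>z. 0 \<le> \<pi> z) \<and> (\<forall>z. z \<notin> pure_states A \<longrightarrow> \<pi> z = 0) \<and> (\<Sum>s\<in>pure_states A. \<pi> s) = 1 \<and>
     (\<forall>\<mu> :: real \<Rightarrow> 'i state measure.
        (\<forall>l. 0 < l \<and> l \<le> 1 \<longrightarrow>
           sets (\<mu> l) = sets borel \<and> prob_space (\<mu> l) \<and> emeasure (\<mu> l) (states A) = 1 \<and>
           invariant_measure (pla_kernel A u \<epsilon> l) (\<mu> l))
        \<longrightarrow>
        (\<forall>f :: 'i state \<Rightarrow> real. continuous_on UNIV f \<and> bounded (range f) \<longrightarrow>
           ((\<lambda>l. integral\<^sup>L (\<mu> l) f) \<longlongrightarrow> (\<Sum>s\<in>pure_states A. \<pi> s * f s)) (at_right 0))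
        \<and>
        (\<exists>\<delta>0 > 0. \<forall>\<delta>. 0 < \<delta> \<and> \<delta> < \<delta>0 \<longrightarrow>
           (\<forall>s\<in>pure_states A. \<forall>s'\<in>pure_states A.
              convergent (\<lambda>t. QPt A u \<epsilon> t s (nbhd A \<delta> s'))) \<and>
           (\<forall>s\<in>pure_states A. (\<Sum>s'\<in>pure_states A. hatP A u \<epsilon> \<delta> s s') = 1) \<and>
           (\<forall>s'\<in>pure_states A. (\<Sum>s\<in>pure_states A. \<pi> s * hatP A u \<epsilon> \<delta> s s') = \<pi> s')))"
proof -
  interpret pla A u \<epsilon> by unfold_locales (use fin eps_small in auto)
  show ?thesis
    using limit_distribution_unique
    unfolding prob_vectors_def invariant_family_def weak_limit_def hatP_stationary_def
      mem_Collect_eq conj_assoc .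
qed

end
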